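(* Let $A$ be a Lie algebroid on a manifold $M$, let $\varphi\colon F\to M$ be a fibered manifold, let $X\mapsto X_F$, $\Gamma A\to\Gamma TF$, be an infinitesimal action of $A$ on $F$, and let $E$ be a vector bundle with base $F$. Then there is a one-to-one correspondence between derivative representations of $A$ on $E$ associated to the infinitesimal action $X\mapsto X_F$ and representations of the action Lie algebroid $A\ltimes F$ on $E$.
   Context: All manifolds are smooth and second countable, and all maps are smooth. $\Gamma$ denotes the module of smooth sections of a vector bundle. A fibered manifold $\varphi\colon F\to M$ is a surjective submersion. Lie algebroid: a Lie algebroid on $M$ is a vector bundle $A\to M$ with a vector bundle map $a\colon A\to TM$ over $M$ (the anchor) and an $\mathbb R$-bilinear alternating bracket on $\Gamma A$ satisfying the Jacobi identity, with $a([X,Y])=[a(X),a(Y)]$ and $[X,fY]=f[X,Y]+a(X)(f)Y$ for all $X,Y\in\Gamma A$, $f\in C^\infty(M)$. A morphism of Lie algebroids on the same base is a base-preserving vector bundle morphism that commutes with the anchors and preserves the brackets of sections. Derivative endomorphisms and $\mathfrak D(E)$ (for $E\to F$): a derivative endomorphism of $\Gamma E$ is an $\mathbb R$-linear endomorphism $D$ of $\Gamma E$ for which there is an $\mathbb R$-linear endomorphism $D_F$ of $C^\infty(F)$ such that $D(h\psi)=hD(\psi)+D_F(h)\psi$ for all $h\in C^\infty(F)$, $\psi\in\Gamma E$. Then $D$ is a first-order differential operator with scalar symbol, and $D_F$ is a vector field on $F$. $\mathfrak D(E)$ denotes the Lie algebroid on $F$ whose sections are the derivative endomorphisms of $\Gamma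 E$, with bracket the commutator and anchor $D\mapsto D_F$; as a vector bundle it is the pullback of the symbol map $\sigma\colon\mathrm{Diff}^1(E)\to TF\otimes\mathrm{End}(E)$ and the injection $TF\to TF\otimes\mathrm{End}(E)$, $Y\mapsto Y\otimes\mathrm{Id}_E$, where $\mathrm{Diff}^1(E)$ is the vector bundle whose sections are the first-order differential operators $\Gamma E\to\Gamma E$. Infinitesimal action: an infinitesimal action of $A$ on $\varphi\colon F\to M$ is an $\mathbb R$-linear map $X\mapsto X_F$, $\Gamma A\to\Gamma TF$, such that (i) for each $X\in\Gamma A$, the vector field $X_F$ is projectable under $\varphi$ to $a(X)$; (ii) $[X,Y]_F=[X_F,Y_F]$ for all $X,Y\in\Gamma A$; (iii) $(fX)_F=(f\circ\varphi)X_F$ for all $f\in C^\infty(M)$, $X\in\Gamma A$. Action Lie algebroid: $A\ltimes F$ is the pullback vector bundle $\varphi^*A\to F$ whose module of sections is identified with $C^\infty(F)\otimes_{C^\infty(M)}\Gamma A$ ($h\otimes X$ corresponding to the section $h\,(X\circ\varphi)$), equipped with the anchor $a_F(h\otimes X)=hX_F$ and the bracket $[h\otimes X,k\otimes Y]=hk\otimes[X,Y]+hX_F(k)\otimes Y-kY_F(h)\otimes X$, for $h,k\in C^\infty(F)$, $X,Y\in\Gamma A$. Derivative representation: a derivative representation of $A$ on $E$ associated to the infinitesimal action $X\mapsto X_F$ is a morphism of Lie algebras $\rho\colon\Gamma A\to\Gamma\mathfrak D(E)$ such that (i) $(\rho(X))_F=X_F$ for all $X\in\Gamma A$; (ii)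 $\rho(fX)=(f\circ\varphi)\rho(X)$ for all $f\in C^\infty(M)$, $X\in\Gamma A$. Representation of a Lie algebroid: a representation of a Lie algebroid $B$ on base $F$ on the vector bundle $E\to F$ is a morphism of Lie algebroids $B\to\mathfrak D(E)$ over $F$. *)

theory Defs
  imports "HOL-Analysis.Analysis" "HOL-Library.Function_Algebras"
begin

instantiation "fun" :: (type, real_vector) real_vector
begin

definition scaleR_fun :: "real \<Rightarrow> ('a \<Rightarrow> 'b) \<Rightarrow> 'a \<Rightarrow> 'b"
  where "scaleR_fun c f = (\<lambda>x. c *\<^sub>R f x)"

instance
  by standard
    (auto simp: scaleR_fun_def fun_eq_iff scaleR_add_right scaleR_add_left)

end


section \<open>Smooth manifolds\<close>

(* The model of a manifold or bundle is a finite-dimensional real vector space. The class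
   euclidean_space is not used because it excludes dimension 0 (a manifold that is a point,
   a bundle of rank 0); real_inner with finite_dim does not. *)

definition finite_dim :: "'a::real_vector itself \<Rightarrow> bool" where
  "finite_dim _ \<longleftrightarrow> (\<exists>B::'a set. finite B \<and> span B = UNIV)"

(* For an open set S: all iterated directional derivatives up to order k exist and are
   continuous. In finite dimension this is the class C^k. *)

primrec Ck_on :: "nat \<Rightarrow> 'a::real_normed_vector set \<Rightarrow> ('a \<Rightarrow> 'b::real_normed_vector) \<Rightarrow> bool" where
  "Ck_on 0 S f \<longleftrightarrow> continuous_on S f"
| "Ck_on (Suc k) S f \<longleftrightarrow>
     (\<forall>x\<in>S. f differentiable (at x)) \<and> (\<forall>v. Ck_on k S (\<lambda>x. frechet_derivative f (at x) v))"

definition smooth_on :: "'a::real_normed_vector set \<Rightarrow> ('a \<Rightarrow> 'b::real_normed_vector) \<Rightarrow> bool" where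
  "smooth_on S f \<longleftrightarrow> (\<forall>k. Ck_on k S f)"

(* A chart is a pair (U, \<kappa>); only the values of \<kappa> on U matter. The points of a manifold are
   the elements of the type 'm. *)

type_synonym ('m, 'n) atlas = "('m set \<times> ('m \<Rightarrow> 'n)) set"

definition manifold ::
  "('m::{t2_space,second_countable_topology}, 'n::real_normed_vector) atlas \<Rightarrow> bool" where
  "manifold M \<longleftrightarrow> finite_dim TYPE('n)
     \<and> (\<Union>(U, \<kappa>)\<in>M. U) = UNIV
     \<and> (\<forall>(U, \<kappa>)\<in>M. open U \<and> open (\<kappa> ` U) \<and> homeomorphism U (\<kappa> ` U) \<kappa> (inv_into U \<kappa>))
     \<and> (\<forall>(U, \<kappa>)\<in>M. \<forall>(V, \<mu>)\<in>M. smooth_on (\<kappa> ` (U \<inter> V)) (\<mu> \<circ> inv_into U \<kappa>))"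

definition smooth_fun_on ::
  "('m, 'n::real_normed_vector) atlas \<Rightarrow> 'm set \<Rightarrow> ('m \<Rightarrow> 'b::real_normed_vector) \<Rightarrow> bool" where
  "smooth_fun_on M W f \<longleftrightarrow> (\<forall>(U, \<kappa>)\<in>M. smooth_on (\<kappa> ` (U \<inter> W)) (f \<circ> inv_into U \<kappa>))"

definition Cinf :: "('m, 'n::real_normed_vector) atlas \<Rightarrow> ('m \<Rightarrow> real) set" where
  "Cinf M = {f. smooth_fun_on M UNIV f}"

definition smooth_map ::
  "('f::topological_space, 'n::real_normed_vector) atlas
     \<Rightarrow> ('m::topological_space, 'p::real_normed_vector) atlas \<Rightarrow> ('f \<Rightarrow> 'm) \<Rightarrow> bool" where
  "smooth_map F M \<phi> \<longleftrightarrow> continuous_on UNIV \<phi>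
     \<and> (\<forall>(V, \<mu>)\<in>M. smooth_fun_on F (\<phi> -` V) (\<mu> \<circ> \<phi>))"


section \<open>Vector bundles\<close>

(* fib E x is the fibre over x, a linear subspace of an ambient real vector space 'v. The
   ambient space carries neither topology nor any relation between different fibres, so this
   is no restriction: every family of vector spaces embeds in its direct sum. The pair
   (U, \<tau>) in triv E is a local trivialization U \<times> 'k \<rightarrow> E|U, (x, w) \<mapsto> \<tau> x w. These
   trivializations determine the topology and the smooth structure of the total space. *)

record ('x, 'k, 'v) vbundle =
  fib :: "'x \<Rightarrow> 'v set"
  triv :: "('x set \<times> ('x \<Rightarrow> 'k \<Rightarrow> 'v)) set"

(* The transition function x \<mapsto> \<sigma>_x^{-1} \<tau>_x takes values in GL('k); since 'k is
   finite-dimensional, it is smooth iff it is smooth after evaluation at every w. *)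

definition vector_bundle ::
  "('x::topological_space, 'n::real_normed_vector) atlas
     \<Rightarrow> ('x, 'k::real_normed_vector, 'v::real_vector, 'z) vbundle_scheme \<Rightarrow> bool" where
  "vector_bundle M E \<longleftrightarrow> finite_dim TYPE('k)
     \<and> (\<forall>x. subspace (fib E x))
     \<and> (\<Union>(U, \<tau>)\<in>triv E. U) = UNIV
     \<and> (\<forall>(U, \<tau>)\<in>triv E. open U \<and> (\<forall>x\<in>U. linear (\<tau> x) \<and> bij_betw (\<tau> x) UNIV (fib E x)))
     \<and> (\<forall>(U, \<tau>)\<in>triv E. \<forall>(V, \<sigma>)\<in>triv E. \<forall>w.
          smooth_fun_on M (U \<inter> V) (\<lambda>x. inv (\<sigma> x) (\<tau> x w)))"

definition sections ::
  "('x, 'n::real_normed_vector) atlas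
     \<Rightarrow> ('x, 'k::real_normed_vector, 'v, 'z) vbundle_scheme \<Rightarrow> ('x \<Rightarrow> 'v) set" where
  "sections M E = {s. (\<forall>x. s x \<in> fib E x)
     \<and> (\<forall>(U, \<tau>)\<in>triv E. smooth_fun_on M U (\<lambda>x. inv (\<tau> x) (s x)))}"

(* Base-preserving; smoothness is tested in trivializations as for transition functions. *)

definition bundle_morphism ::
  "('x, 'n::real_normed_vector) atlas
     \<Rightarrow> ('x, 'k::real_normed_vector, 'v::real_vector, 'z) vbundle_scheme
     \<Rightarrow> ('x, 'l::real_normed_vector, 'w::real_vector, 'y) vbundle_scheme
     \<Rightarrow> ('x \<Rightarrow> 'v \<Rightarrow> 'w) \<Rightarrow> bool" where
  "bundle_morphism M A B R \<longleftrightarrow>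
     (\<forall>x. \<forall>u\<in>fib A x. R x u \<in> fib B x)
     \<and> (\<forall>x. \<forall>u\<in>fib A x. \<forall>v\<in>fib A x. R x (u + v) = R x u + R x v)
     \<and> (\<forall>x. \<forall>u\<in>fib A x. \<forall>c::real. R x (c *\<^sub>R u) = c *\<^sub>R R x u)
     \<and> (\<forall>(U, \<tau>)\<in>triv A. \<forall>(V, \<sigma>)\<in>triv B. \<forall>w.
          smooth_fun_on M (U \<inter> V) (\<lambda>x. inv (\<sigma> x) (R x (\<tau> x w))))"

definition pullback_bundle ::
  "('f \<Rightarrow> 'm) \<Rightarrow> ('m, 'k, 'v, 'z) vbundle_scheme \<Rightarrow> ('f, 'k, 'v) vbundle" where
  "pullback_bundle \<phi> A =
     \<lparr>fib = (\<lambda>y. fib A (\<phi> y)), triv = (\<lambda>(U, \<tau>). (\<phi> -` U, \<lambda>y. \<tau> (\<phi> y))) ` triv A\<rparr>"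


section \<open>Tangent bundle, fibered manifolds\<close>

(* Tangent vectors act on smooth functions as directional derivatives; as functionals they
   are normalized to be 0 outside Cinf M. *)

type_synonym 'm tangent = "('m \<Rightarrow> real) \<Rightarrow> real"

definition chart_vector ::
  "('m, 'n::real_normed_vector) atlas \<Rightarrow> 'm set \<times> ('m \<Rightarrow> 'n) \<Rightarrow> 'm \<Rightarrow> 'n \<Rightarrow> 'm tangent" where
  "chart_vector M = (\<lambda>(U, \<kappa>) x w f.
     if f \<in> Cinf M then frechet_derivative (f \<circ> inv_into U \<kappa>) (at (\<kappa> x)) w else 0)"

definition tangent_bundle ::
  "('m, 'n::real_normed_vector) atlas \<Rightarrow> ('m, 'n, 'm tangent) vbundle" where
  "tangent_bundle M =
     \<lparr>fib = (\<lambda>x. {chart_vector M (U, \<kappa>) x w | U \<kappa> w. (U, \<kappa>) \<in> M \<and> x \<in> U}),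
      triv = (\<lambda>(U, \<kappa>). (U, chart_vector M (U, \<kappa>))) ` M\<rparr>"

abbreviation vector_fields ::
  "('m, 'n::real_normed_vector) atlas \<Rightarrow> ('m \<Rightarrow> 'm tangent) set" where
  "vector_fields M \<equiv> sections M (tangent_bundle M)"

definition vf_bracket ::
  "('m \<Rightarrow> 'm tangent) \<Rightarrow> ('m \<Rightarrow> 'm tangent) \<Rightarrow> 'm \<Rightarrow> 'm tangent" where
  "vf_bracket X Y = (\<lambda>x f. X x (\<lambda>z. Y z f) - Y x (\<lambda>z. X z f))"

definition tangent_map ::
  "('m, 'p::real_normed_vector) atlas \<Rightarrow> ('f \<Rightarrow> 'm) \<Rightarrow> 'f tangent \<Rightarrow> 'm tangent" where
  "tangent_map M \<phi> v = (\<lambda>f. if f \<in> Cinf M then v (f \<circ> \<phi>) else 0)"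

definition fibered_manifold ::
  "('f::topological_space, 'n::real_normed_vector) atlas
     \<Rightarrow> ('m::topological_space, 'p::real_normed_vector) atlas \<Rightarrow> ('f \<Rightarrow> 'm) \<Rightarrow> bool" where
  "fibered_manifold F M \<phi> \<longleftrightarrow> smooth_map F M \<phi> \<and> surj \<phi>
     \<and> (\<forall>y. tangent_map M \<phi> ` fib (tangent_bundle F) y = fib (tangent_bundle M) (\<phi> y))"


section \<open>Lie algebroids\<close>

record ('x, 'k, 'v) algebroid = "('x, 'k, 'v) vbundle" +
  anchor :: "'x \<Rightarrow> 'v \<Rightarrow> 'x tangent"
  bracket :: "('x \<Rightarrow> 'v) \<Rightarrow> ('x \<Rightarrow> 'v) \<Rightarrow> 'x \<Rightarrow> 'v"

definition anchor_field ::
  "('x, 'k, 'v, 'z) algebroid_scheme \<Rightarrow> ('x \<Rightarrow> 'v) \<Rightarrow> 'x \<Rightarrow> 'x tangent" where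
  "anchor_field A X = (\<lambda>x. anchor A x (X x))"

definition lie_algebroid ::
  "('x::topological_space, 'n::real_normed_vector) atlas
     \<Rightarrow> ('x, 'k::real_normed_vector, 'v::real_vector, 'z) algebroid_scheme \<Rightarrow> bool" where
  "lie_algebroid M A \<longleftrightarrow> vector_bundle M A
     \<and> bundle_morphism M A (tangent_bundle M) (anchor A)
     \<and> (\<forall>X\<in>sections M A. \<forall>Y\<in>sections M A. bracket A X Y \<in> sections M A)
     \<and> (\<forall>X\<in>sections M A. \<forall>Y\<in>sections M A. \<forall>Z\<in>sections M A.
          bracket A (X + Y) Z = bracket A X Z + bracket A Y Z
          \<and> bracket A Z (X + Y) = bracket A Z X + bracket A Z Y)
     \<and> (\<forall>X\<in>sections M A. \<forall>Y\<in>sections M A. \<forall>c::real.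
          bracket A (c *\<^sub>R X) Y = c *\<^sub>R bracket A X Y
          \<and> bracket A X (c *\<^sub>R Y) = c *\<^sub>R bracket A X Y)
     \<and> (\<forall>X\<in>sections M A. bracket A X X = 0)
     \<and> (\<forall>X\<in>sections M A. \<forall>Y\<in>sections M A. \<forall>Z\<in>sections M A.
          bracket A X (bracket A Y Z) + bracket A Y (bracket A Z X)
            + bracket A Z (bracket A X Y) = 0)
     \<and> (\<forall>X\<in>sections M A. \<forall>Y\<in>sections M A.
          anchor_field A (bracket A X Y) = vf_bracket (anchor_field A X) (anchor_field A Y))
     \<and> (\<forall>X\<in>sections M A. \<forall>Y\<in>sections M A. \<forall>f\<in>Cinf M.
          bracket A X (\<lambda>x. f x *\<^sub>R Y x)
            = (\<lambda>x. f x *\<^sub>R bracket A X Y x + anchor_field A X x f *\<^sub>R Y x))"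

definition algebroid_morphism ::
  "('x, 'n::real_normed_vector) atlas
     \<Rightarrow> ('x, 'k::real_normed_vector, 'v::real_vector, 'z) algebroid_scheme
     \<Rightarrow> ('x, 'l::real_normed_vector, 'w::real_vector, 'y) algebroid_scheme
     \<Rightarrow> ('x \<Rightarrow> 'v \<Rightarrow> 'w) \<Rightarrow> bool" where
  "algebroid_morphism M A B R \<longleftrightarrow> bundle_morphism M A B R
     \<and> (\<forall>x. \<forall>u\<in>fib A x. anchor B x (R x u) = anchor A x u)
     \<and> (\<forall>s\<in>sections M A. \<forall>t\<in>sections M A.
          (\<lambda>x. R x (bracket A s t x)) = bracket B (\<lambda>x. R x (s x)) (\<lambda>x. R x (t x)))"


section \<open>Derivative endomorphisms and their Lie algebroid\<close>

(* DF plays the role of D_F. Maps on sections are extensional (undefined on functions that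
   are not smooth sections), so that equality of maps is equality on sections. *)

definition derivative_endomorphism ::
  "('f, 'n::real_normed_vector) atlas
     \<Rightarrow> ('f, 'l::real_normed_vector, 'e::real_vector, 'z) vbundle_scheme
     \<Rightarrow> (('f \<Rightarrow> 'e) \<Rightarrow> 'f \<Rightarrow> 'e) \<Rightarrow> (('f \<Rightarrow> real) \<Rightarrow> 'f \<Rightarrow> real) \<Rightarrow> bool" where
  "derivative_endomorphism F E D DF \<longleftrightarrow>
     D \<in> sections F E \<rightarrow>\<^sub>E sections F E
     \<and> (\<forall>\<psi>\<in>sections F E. \<forall>\<eta>\<in>sections F E. D (\<psi> + \<eta>) = D \<psi> + D \<eta>)
     \<and> (\<forall>\<psi>\<in>sections F E. \<forall>c::real. D (c *\<^sub>R \<psi>) = c *\<^sub>R D \<psi>)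
     \<and> DF \<in> Cinf F \<rightarrow> Cinf F
     \<and> (\<forall>g\<in>Cinf F. \<forall>h\<in>Cinf F. DF (g + h) = DF g + DF h)
     \<and> (\<forall>h\<in>Cinf F. \<forall>c::real. DF (c *\<^sub>R h) = c *\<^sub>R DF h)
     \<and> (\<forall>h\<in>Cinf F. \<forall>\<psi>\<in>sections F E.
          D (\<lambda>y. h y *\<^sub>R \<psi> y) = (\<lambda>y. h y *\<^sub>R D \<psi> y + DF h y *\<^sub>R \<psi> y))"

(* Elements over y of the pullback of the symbol map \<sigma> and of v \<mapsto> v \<otimes> Id: pairs (d, v) where
   d : sections of E \<rightarrow> E_y is linear and v is a tangent vector at y with
   d (h \<psi>) - h(y) d \<psi> = v(h) \<psi>(y), that is, \<sigma>(d) = v \<otimes> Id. If E has positive rank, then d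
   determines v. As for tangent vectors, d is normalized to be 0 outside the sections. *)

type_synonym ('f, 'e) deriv_point = "(('f \<Rightarrow> 'e) \<Rightarrow> 'e) \<times> 'f tangent"

definition deriv_fib ::
  "('f, 'n::real_normed_vector) atlas
     \<Rightarrow> ('f, 'l::real_normed_vector, 'e::real_vector, 'z) vbundle_scheme
     \<Rightarrow> 'f \<Rightarrow> ('f, 'e) deriv_point set" where
  "deriv_fib F E y = {(d, v). v \<in> fib (tangent_bundle F) y
     \<and> (\<forall>\<psi>\<in>sections F E. d \<psi> \<in> fib E y)
     \<and> (\<forall>\<psi>\<in>sections F E. \<forall>\<eta>\<in>sections F E. d (\<psi> + \<eta>) = d \<psi> + d \<eta>)
     \<and> (\<forall>\<psi>\<in>sections F E. \<forall>c::real. d (c *\<^sub>R \<psi>) = c *\<^sub>R d \<psi>)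
     \<and> (\<forall>h\<in>Cinf F. \<forall>\<psi>\<in>sections F E. d (\<lambda>z. h z *\<^sub>R \<psi> z) = h y *\<^sub>R d \<psi> + v h *\<^sub>R \<psi> y)
     \<and> (\<forall>\<psi>. \<psi> \<notin> sections F E \<longrightarrow> d \<psi> = 0)}"

(* In a chart (U, \<kappa>) of F and a trivialization (V, \<tau>) of E the pair (w, B) corresponds to the
   operator that differentiates the components of a section along w and adds B applied to
   the components. *)

definition deriv_triv ::
  "('f, 'n::real_normed_vector) atlas
     \<Rightarrow> ('f, 'l::real_normed_vector, 'e::real_vector, 'z) vbundle_scheme
     \<Rightarrow> 'f set \<times> ('f \<Rightarrow> 'n) \<Rightarrow> 'f set \<times> ('f \<Rightarrow> 'l \<Rightarrow> 'e)
     \<Rightarrow> 'f \<Rightarrow> 'n \<times> ('l \<Rightarrow>\<^sub>L 'l) \<Rightarrow> ('f, 'e) deriv_point" where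
  "deriv_triv F E = (\<lambda>(U, \<kappa>) (V, \<tau>) y (w, B).
     (\<lambda>\<psi>. if \<psi> \<in> sections F E
           then \<tau> y (frechet_derivative ((\<lambda>z. inv (\<tau> z) (\<psi> z)) \<circ> inv_into U \<kappa>) (at (\<kappa> y)) w
                     + blinfun_apply B (inv (\<tau> y) (\<psi> y)))
           else 0,
      chart_vector F (U, \<kappa>) y w))"

(* A section D of deriv_algebroid F E acts on \<psi> by y \<mapsto> fst (D y) \<psi>; the bracket is the
   commutator. *)

definition deriv_algebroid ::
  "('f, 'n::real_normed_vector) atlas
     \<Rightarrow> ('f, 'l::real_normed_vector, 'e::real_vector, 'z) vbundle_scheme
     \<Rightarrow> ('f, 'n \<times> ('l \<Rightarrow>\<^sub>L 'l), ('f, 'e) deriv_point) algebroid" where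
  "deriv_algebroid F E =
     \<lparr>fib = deriv_fib F E,
      triv = {(U \<inter> V, deriv_triv F E (U, \<kappa>) (V, \<tau>)) | U \<kappa> V \<tau>. (U, \<kappa>) \<in> F \<and> (V, \<tau>) \<in> triv E},
      anchor = (\<lambda>y. snd),
      bracket = (\<lambda>D1 D2 y.
        (\<lambda>\<psi>. fst (D1 y) (\<lambda>z. fst (D2 z) \<psi>) - fst (D2 y) (\<lambda>z. fst (D1 z) \<psi>),
         vf_bracket (\<lambda>z. snd (D1 z)) (\<lambda>z. snd (D2 z)) y))\<rparr>"


section \<open>Infinitesimal actions and the action Lie algebroid\<close>

definition infinitesimal_action ::
  "('m, 'p::real_normed_vector) atlas \<Rightarrow> ('f, 'n::real_normed_vector) atlas
     \<Rightarrow> ('m, 'k::real_normed_vector, 'v::real_vector, 'z) algebroid_scheme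
     \<Rightarrow> ('f \<Rightarrow> 'm) \<Rightarrow> (('m \<Rightarrow> 'v) \<Rightarrow> 'f \<Rightarrow> 'f tangent) \<Rightarrow> bool" where
  "infinitesimal_action M F A \<phi> act \<longleftrightarrow>
     (\<forall>X\<in>sections M A. act X \<in> vector_fields F)
     \<and> (\<forall>X\<in>sections M A. \<forall>Y\<in>sections M A. act (X + Y) = act X + act Y)
     \<and> (\<forall>X\<in>sections M A. \<forall>c::real. act (c *\<^sub>R X) = c *\<^sub>R act X)
     \<and> (\<forall>X\<in>sections M A. \<forall>y. tangent_map M \<phi> (act X y) = anchor_field A X (\<phi> y))
     \<and> (\<forall>X\<in>sections M A. \<forall>Y\<in>sections M A. act (bracket A X Y) = vf_bracket (act X) (act Y))
     \<and> (\<forall>X\<in>sections M A. \<forall>f\<in>Cinf M.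
          act (\<lambda>x. f x *\<^sub>R X x) = (\<lambda>y. f (\<phi> y) *\<^sub>R act X y))"

(* The section of the pullback bundle corresponding to h_0 \<otimes> X_0 + ... + h_{n-1} \<otimes> X_{n-1}. *)

definition tensor_section ::
  "('f \<Rightarrow> 'm) \<Rightarrow> nat \<Rightarrow> (nat \<Rightarrow> 'f \<Rightarrow> real) \<Rightarrow> (nat \<Rightarrow> 'm \<Rightarrow> 'v::real_vector) \<Rightarrow> 'f \<Rightarrow> 'v" where
  "tensor_section \<phi> n h X = (\<lambda>y. \<Sum>i<n. h i y *\<^sub>R X i (\<phi> y))"

(* The value at y of the biadditive extension of
   [h \<otimes> X, k \<otimes> Y] = hk \<otimes> [X, Y] + h X_F(k) \<otimes> Y - k Y_F(h) \<otimes> X. *)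

definition tensor_bracket_at ::
  "('m, 'k, 'v::real_vector, 'z) algebroid_scheme \<Rightarrow> ('f \<Rightarrow> 'm)
     \<Rightarrow> (('m \<Rightarrow> 'v) \<Rightarrow> 'f \<Rightarrow> 'f tangent)
     \<Rightarrow> nat \<Rightarrow> (nat \<Rightarrow> 'f \<Rightarrow> real) \<Rightarrow> (nat \<Rightarrow> 'm \<Rightarrow> 'v)
     \<Rightarrow> nat \<Rightarrow> (nat \<Rightarrow> 'f \<Rightarrow> real) \<Rightarrow> (nat \<Rightarrow> 'm \<Rightarrow> 'v) \<Rightarrow> 'f \<Rightarrow> 'v" where
  "tensor_bracket_at A \<phi> act n h X m k Y y =
     (\<Sum>i<n. \<Sum>j<m. (h i y * k j y) *\<^sub>R bracket A (X i) (Y j) (\<phi> y)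
        + (h i y * act (X i) y (k j)) *\<^sub>R Y j (\<phi> y)
        - (k j y * act (Y j) y (h i)) *\<^sub>R X i (\<phi> y))"

(* The anchor and the bracket are the unique ones given by the formulas on tensors. The
   bracket is local, so its value at y is computed from any expressions of the two sections
   as finite sums of tensors near y; global expressions are the case U = UNIV. *)

definition action_algebroid ::
  "('m, 'p::real_normed_vector) atlas \<Rightarrow> ('f::topological_space, 'n::real_normed_vector) atlas
     \<Rightarrow> ('m, 'k::real_normed_vector, 'v::real_vector, 'z) algebroid_scheme
     \<Rightarrow> ('f \<Rightarrow> 'm) \<Rightarrow> (('m \<Rightarrow> 'v) \<Rightarrow> 'f \<Rightarrow> 'f tangent) \<Rightarrow> ('f, 'k, 'v) algebroid" where
  "action_algebroid M F A \<phi> act =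
     \<lparr>fib = fib (pullback_bundle \<phi> A),
      triv = triv (pullback_bundle \<phi> A),
      anchor = (\<lambda>y u. THE v. \<forall>h\<in>Cinf F. \<forall>X\<in>sections M A.
        u = h y *\<^sub>R X (\<phi> y) \<longrightarrow> v = h y *\<^sub>R act X y),
      bracket = (\<lambda>s t y. THE u. \<forall>U n h X m k Y.
        open U \<and> y \<in> U
        \<and> (\<forall>i<n. h i \<in> Cinf F \<and> X i \<in> sections M A)
        \<and> (\<forall>j<m. k j \<in> Cinf F \<and> Y j \<in> sections M A)
        \<and> (\<forall>z\<in>U. s z = tensor_section \<phi> n h X z)
        \<and> (\<forall>z\<in>U. t z = tensor_section \<phi> m k Y z)
        \<longrightarrow> u = tensor_bracket_at A \<phi> act n h X m k Y y)\<rparr>"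


section \<open>Representations\<close>

(* The condition (\<rho> X)_F = X_F is the second argument of derivative_endomorphism. *)

definition derivative_representations ::
  "('m, 'p::real_normed_vector) atlas \<Rightarrow> ('f, 'n::real_normed_vector) atlas
     \<Rightarrow> ('m, 'k::real_normed_vector, 'v::real_vector, 'z) algebroid_scheme
     \<Rightarrow> ('f \<Rightarrow> 'm) \<Rightarrow> (('m \<Rightarrow> 'v) \<Rightarrow> 'f \<Rightarrow> 'f tangent)
     \<Rightarrow> ('f, 'l::real_normed_vector, 'e::real_vector, 'y) vbundle_scheme
     \<Rightarrow> (('m \<Rightarrow> 'v) \<Rightarrow> ('f \<Rightarrow> 'e) \<Rightarrow> 'f \<Rightarrow> 'e) set" where
  "derivative_representations M F A \<phi> act E = {\<rho> \<in> extensional (sections M A).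
     (\<forall>X\<in>sections M A. derivative_endomorphism F E (\<rho> X) (\<lambda>h y. act X y h))
     \<and> (\<forall>X\<in>sections M A. \<forall>Y\<in>sections M A. \<forall>\<psi>\<in>sections F E. \<rho> (X + Y) \<psi> = \<rho> X \<psi> + \<rho> Y \<psi>)
     \<and> (\<forall>X\<in>sections M A. \<forall>c::real. \<forall>\<psi>\<in>sections F E. \<rho> (c *\<^sub>R X) \<psi> = c *\<^sub>R \<rho> X \<psi>)
     \<and> (\<forall>X\<in>sections M A. \<forall>Y\<in>sections M A. \<forall>\<psi>\<in>sections F E.
          \<rho> (bracket A X Y) \<psi> = \<rho> X (\<rho> Y \<psi>) - \<rho> Y (\<rho> X \<psi>))
     \<and> (\<forall>X\<in>sections M A. \<forall>f\<in>Cinf M. \<forall>\<psi>\<in>sections F E.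
          \<rho> (\<lambda>x. f x *\<^sub>R X x) \<psi> = (\<lambda>y. f (\<phi> y) *\<^sub>R \<rho> X \<psi> y))}"

definition representations ::
  "('f, 'n::real_normed_vector) atlas
     \<Rightarrow> ('f, 'k::real_normed_vector, 'v::real_vector, 'z) algebroid_scheme
     \<Rightarrow> ('f, 'l::real_normed_vector, 'e::real_vector, 'y) vbundle_scheme
     \<Rightarrow> ('f \<Rightarrow> 'v \<Rightarrow> ('f, 'e) deriv_point) set" where
  "representations F B E = {R. (\<forall>y. R y \<in> extensional (fib B y))
     \<and> algebroid_morphism F B (deriv_algebroid F E) R}"

(* X \<mapsto> R (1 \<otimes> X), where the section y \<mapsto> R y (X (\<phi> y)) is regarded as an operator. *)

definition restrict_representation ::
  "('m, 'p::real_normed_vector) atlas \<Rightarrow> ('f, 'n::real_normed_vector) atlas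
     \<Rightarrow> ('m, 'k::real_normed_vector, 'v, 'z) algebroid_scheme \<Rightarrow> ('f \<Rightarrow> 'm)
     \<Rightarrow> ('f, 'l::real_normed_vector, 'e, 'y) vbundle_scheme
     \<Rightarrow> ('f \<Rightarrow> 'v \<Rightarrow> ('f, 'e) deriv_point) \<Rightarrow> ('m \<Rightarrow> 'v) \<Rightarrow> ('f \<Rightarrow> 'e) \<Rightarrow> 'f \<Rightarrow> 'e" where
  "restrict_representation M F A \<phi> E R =
     (\<lambda>X\<in>sections M A. \<lambda>\<psi>\<in>sections F E. \<lambda>y. fst (R y (X (\<phi> y))) \<psi>)"

end

theory Submission
  imports Defs
begin

text \<open>A representation \<open>R\<close> of the action algebroid and a derivative representation \<open>\<rho>\<close> determine each
  other by \<open>\<rho>(X) \<psi> (y) = R (X (\<phi> y)) \<psi>\<close>: for fixed \<open>\<psi>\<close> and \<open>y\<close> the value \<open>\<rho>(X) \<psi> (y)\<close> is tensorial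
  in \<open>X\<close>, hence depends only on \<open>X (\<phi> y)\<close>. Every section of the action algebroid is locally a finite
  sum of tensors \<open>h \<otimes> X\<close>, and on tensors the bracket condition for \<open>R\<close> reduces to the one for \<open>\<rho>\<close>.
  Smoothness of \<open>R\<close> is read off in a frame of \<open>E\<close>: on sections with constant components the
  derivative part of an element of the derivation bundle vanishes, which leaves its matrix part.\<close>

section \<open>Finite-dimensional inner product spaces\<close>

text \<open>The anchor and the bracket of \<open>action_algebroid\<close> are definite descriptions,
  so nothing can be computed with them until they are known to have a unique solution. For the
  bracket this is the main obstacle: a section has many expressions as a sum of tensors. Passing
  from one to another turns the Leibniz term of the bracket of \<open>A\<close>, a derivative along
  the anchor on \<open>M\<close>, into a derivative on \<open>F\<close>, and the two agree because
  the action projects to the anchor.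

  Sections, tangent vectors and derivations are tested on global objects, whereas frames and
  coordinates are local. Bump functions bridge this gap, which is why the calculus begins with
  exp(-1/x).

  On a bundle of rank 0 a derivation does not determine its symbol. The symbol is therefore carried
  along as a second component, and identities between derivations are proved for the operator and
  for the symbol separately.\<close>

definition parseval_frame :: "nat \<Rightarrow> (nat \<Rightarrow> 'k::real_inner) \<Rightarrow> bool" where
  "parseval_frame n b \<longleftrightarrow> (\<forall>x. (\<Sum>i<n. (x \<bullet> b i) *\<^sub>R b i) = x)"

lemma parseval_frameD: "parseval_frame n b \<Longrightarrow> (\<Sum>i<n. (x \<bullet> b i) *\<^sub>R b i) = x"
  by (simp add: parseval_frame_def)

text \<open>Fourier expansion in an orthogonal spanning set. Some of its vectors may be zero; they
  stay zero after normalization since \<open>inverse 0 = 0\<close>, which a frame tolerates and an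
  orthonormal basis would not. The zero space is included.\<close>

lemma finite_dim_parseval_frame:
  assumes "finite_dim TYPE('k::real_inner)"
  obtains n and b :: "nat \<Rightarrow> 'k::real_inner" where "parseval_frame n b"
proof -
  obtain B :: "'k set" where "finite B" "span B = UNIV"
    using assms by (auto simp: finite_dim_def)
  then obtain C where C: "finite C" "span C = (UNIV :: 'k set)" "pairwise orthogonal C"
    using basis_orthogonal by metis
  have expand: "(\<Sum>c\<in>C. (x \<bullet> (c /\<^sub>R norm c)) *\<^sub>R (c /\<^sub>R norm c)) = x" for x :: 'k
  proof -
    \<comment> \<open>The remainder is orthogonal to every vector of \<open>C\<close>, hence to the
      span of \<open>C\<close>, which contains the remainder itself.\<close>
    define r where "r = x - (\<Sum>c\<in>C. (x \<bullet> (c /\<^sub>R norm c)) *\<^sub>R (c /\<^sub>R norm c))"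
    have "orthogonal r d" if "d \<in> C" for d
    proof -
      have "(\<Sum>c\<in>C. (x \<bullet> (c /\<^sub>R norm c)) *\<^sub>R (c /\<^sub>R norm c)) \<bullet> d
          = (\<Sum>c\<in>C. if c = d then x \<bullet> d else 0)"
        unfolding inner_sum_left
      proof (rule sum.cong[OF refl])
        fix c assume "c \<in> C"
        show "(x \<bullet> (c /\<^sub>R norm c)) *\<^sub>R (c /\<^sub>R norm c) \<bullet> d = (if c = d then x \<bullet> d else 0)"
        proof (cases "c = d")
          case True
          then show ?thesis
            using dot_square_norm[of d] by (cases "d = 0") (simp_all add: power2_eq_square field_simps)
        next
          case False
          then have "c \<bullet> d = 0"
            using C(3) \<open>c \<in> C\<close> \<open>d \<in> C\<close> by (auto simp: pairwise_def orthogonal_def)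
          then show ?thesis using False by simp
        qed
      qed
      then show ?thesis
        using C(1) that by (simp add: r_def orthogonal_def inner_diff_left)
    qed
    then have "orthogonal r r"
      using orthogonal_to_span[of r C r] C(2) by auto
    then show ?thesis by (simp add: r_def orthogonal_def)
  qed
  obtain e where e: "bij_betw e {..<card C} C"
    using ex_bij_betw_nat_finite[OF C(1)] by (auto simp: atLeast0LessThan)
  have "parseval_frame (card C) (\<lambda>i. e i /\<^sub>R norm (e i))"
    unfolding parseval_frame_def
  proof
    fix x
    show "(\<Sum>i<card C. (x \<bullet> (e i /\<^sub>R norm (e i))) *\<^sub>R (e i /\<^sub>R norm (e i))) = x"
      using sum.reindex_bij_betw[OF e, of "\<lambda>c. (x \<bullet> (c /\<^sub>R norm c)) *\<^sub>R (c /\<^sub>R norm c)"] expand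
      by simp
  qed
  then show thesis by (rule that)
qed

text \<open>The standard reduction in what follows: a varying linear map applied to a varying vector
  becomes a finite sum of scalar functions times values in the fixed directions
  \<open>b i\<close>.\<close>

lemma finite_dim_linear_sum:
  assumes "parseval_frame n b" "linear f"
  shows "f x = (\<Sum>i<n. (x \<bullet> b i) *\<^sub>R f (b i))"
proof -
  have "f x = f (\<Sum>i<n. (x \<bullet> b i) *\<^sub>R b i)"
    using assms(1) by (simp add: parseval_frameD)
  also have "\<dots> = (\<Sum>i<n. (x \<bullet> b i) *\<^sub>R f (b i))"
    using assms(2) by (simp add: linear_sum linear_cmul)
  finally show ?thesis .
qed

lemma finite_dim_bounded_linear:
  fixes f :: "'a::real_inner \<Rightarrow> 'b::real_normed_vector"
  assumes "finite_dim TYPE('a)" "linear f"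
  shows "bounded_linear f"
proof -
  obtain n and b :: "nat \<Rightarrow> 'a" where b: "parseval_frame n b"
    using finite_dim_parseval_frame assms(1) by blast
  have "(\<lambda>x. \<Sum>i<n. (x \<bullet> b i) *\<^sub>R f (b i)) = f"
    by (rule ext, rule finite_dim_linear_sum[OF b assms(2), symmetric])
  moreover have "bounded_linear (\<lambda>x. \<Sum>i<n. (x \<bullet> b i) *\<^sub>R f (b i))"
    by (intro bounded_linear_sum bounded_linear_scaleR_left[THEN bounded_linear_compose]
        bounded_linear_inner_left)
  ultimately show ?thesis by simp
qed

text \<open>Heine-Borel: the ball is a closed subset of a translated sum of finitely many compact
  segments. It makes the supports of bump functions compact.\<close>

lemma finite_dim_compact_cball:
  fixes p :: "'a::real_inner"
  assumes "finite_dim TYPE('a)"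
  shows "compact (cball p r)"
proof -
  obtain n and b :: "nat \<Rightarrow> 'a" where b: "parseval_frame n b"
    using finite_dim_parseval_frame assms by blast
  \<comment> \<open>By the Cauchy-Schwarz inequality \<open>r * norm (b i)\<close> bounds the frame
    coefficients on the ball. Each step in \<open>m\<close> adds one segment.\<close>
  define K where "K m = {\<Sum>i<m. c i *\<^sub>R b i | c. \<forall>i<m. \<bar>c i\<bar> \<le> r * norm (b i)}" for m :: nat
  have "compact (K m)" for m
  proof (induction m)
    case 0
    then show ?case by (simp add: K_def)
  next
    case (Suc m)
    define I where "I = (\<lambda>t. t *\<^sub>R b m) ` {- (r * norm (b m)) .. r * norm (b m)}"
    have "K (Suc m) = {x + y | x y. x \<in> K m \<and> y \<in> I}" (is "_ = ?S")
    proof (rule equalityI)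
      show "K (Suc m) \<subseteq> ?S"
      proof (rule subsetI)
        fix z assume "z \<in> K (Suc m)"
        then obtain c where c: "z = (\<Sum>i<Suc m. c i *\<^sub>R b i)"
            "\<forall>i<Suc m. \<bar>c i\<bar> \<le> r * norm (b i)"
          unfolding K_def by blast
        have "(\<Sum>i<m. c i *\<^sub>R b i) \<in> K m" "c m *\<^sub>R b m \<in> I"
          using c(2) unfolding K_def I_def by (auto simp: abs_le_iff intro!: imageI)
        then show "z \<in> ?S" using c(1) by auto
      qed
      show "?S \<subseteq> K (Suc m)"
      proof clarify
        fix x y assume "x \<in> K m" "y \<in> I"
        then obtain c t where c: "x = (\<Sum>i<m. c i *\<^sub>R b i)" "\<forall>i<m. \<bar>c i\<bar> \<le> r * norm (b i)"
          and t: "y = t *\<^sub>R b m" "\<bar>t\<bar> \<le> r * norm (b m)"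
          unfolding K_def I_def by (smt (verit, best) atLeastAtMost_iff imageE mem_Collect_eq)
        have "x + y = (\<Sum>i<Suc m. (c(m := t)) i *\<^sub>R b i)"
          using c t by simp
        moreover have "\<forall>i<Suc m. \<bar>(c(m := t)) i\<bar> \<le> r * norm (b i)"
          using c t by (simp add: less_Suc_eq)
        ultimately show "x + y \<in> K (Suc m)" unfolding K_def by blast
      qed
    qed
    moreover have "compact I" unfolding I_def
      by (intro compact_continuous_image continuous_intros) simp
    ultimately show ?case using compact_sums[OF Suc] by simp
  qed
  then have "compact ((+) p ` K n \<inter> cball p r)"
    by (intro compact_Int_closed compact_translation closed_cball)
  moreover have "cball p r \<subseteq> (+) p ` K n"
  proof
    fix x assume x: "x \<in> cball p r"
    have "\<bar>(x - p) \<bullet> b i\<bar> \<le> r * norm (b i)" for i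
    proof -
      have "\<bar>(x - p) \<bullet> b i\<bar> \<le> norm (x - p) * norm (b i)"
        by (rule Cauchy_Schwarz_ineq2)
      also have "\<dots> \<le> r * norm (b i)"
        using x by (intro mult_right_mono) (simp_all add: dist_norm norm_minus_commute)
      finally show ?thesis .
    qed
    then have "(\<Sum>i<n. ((x - p) \<bullet> b i) *\<^sub>R b i) \<in> K n"
      unfolding K_def by (intro CollectI exI[of _ "\<lambda>i. (x - p) \<bullet> b i"]) simp
    then have "x - p \<in> K n"
      by (simp only: parseval_frameD[OF b])
    then show "x \<in> (+) p ` K n"
      by (intro image_eqI[of _ _ "x - p"]) simp_all
  qed
  ultimately show ?thesis by (simp add: Int_absorb1)
qed


section \<open>Calculus of smooth functions\<close>

lemma Ck_on_subset: "Ck_on k S f \<Longrightarrow> T \<subseteq> S \<Longrightarrow> Ck_on k T f"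
  by (induction k arbitrary: f) (auto intro: continuous_on_subset)

lemma Ck_on_cong:
  assumes "open S" "Ck_on k S f" "\<And>x. x \<in> S \<Longrightarrow> f x = g x"
  shows "Ck_on k S g"
  using assms(2,3)
proof (induction k arbitrary: f g)
  case 0
  then show ?case using continuous_on_eq by fastforce
next
  case (Suc k)
  have fd: "frechet_derivative f (at x) = frechet_derivative g (at x)" if "x \<in> S" for x
    using Suc.prems that assms(1) frechet_derivative_transform_within_open[of f x S g] by auto
  have "g differentiable (at x)" if "x \<in> S" for x
    using Suc.prems that has_derivative_transform_within_open[of f _ x UNIV S g] assms(1)
    unfolding differentiable_def Ck_on.simps by metis
  moreover have "Ck_on k S (\<lambda>x. frechet_derivative g (at x) v)" for v
    by (rule Suc.IH[of "\<lambda>x. frechet_derivative f (at x) v"]) (use Suc.prems fd in auto)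
  ultimately show ?case by simp
qed

lemma Ck_on_local:
  assumes "\<And>x. x \<in> S \<Longrightarrow> \<exists>T. open T \<and> x \<in> T \<and> Ck_on k T f"
  shows "Ck_on k S f"
  using assms
proof (induction k arbitrary: f)
  case 0
  have "isCont f x" if "x \<in> S" for x
    using 0[OF that] continuous_on_eq_continuous_at by auto
  then show ?case by (simp add: continuous_at_imp_continuous_on)
next
  case (Suc k)
  have "f differentiable (at x)" if "x \<in> S" for x
    using Suc.prems[OF that] by auto
  moreover have "Ck_on k S (\<lambda>x. frechet_derivative f (at x) v)" for v
    by (rule Suc.IH) (use Suc.prems in fastforce)
  ultimately show ?case by simp
qed

lemma Ck_on_SucD: "Ck_on (Suc k) S f \<Longrightarrow> Ck_on k S f"
proof (induction k arbitrary: f)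
  case 0
  then show ?case
    by (auto simp: continuous_at_imp_continuous_on differentiable_imp_continuous_within)
qed simp

lemma Ck_on_const: "Ck_on k S (\<lambda>_. c)"
  by (induction k arbitrary: c) auto

lemma Ck_on_bounded_linear: "bounded_linear f \<Longrightarrow> Ck_on k S f"
proof (induction k arbitrary: f)
  case 0
  then show ?case by (simp add: linear_continuous_on)
next
  case (Suc k)
  then have "(f has_derivative f) (at x)" for x by (simp add: bounded_linear_imp_has_derivative)
  then have "frechet_derivative f (at x) = f" "f differentiable (at x)" for x
    using frechet_derivative_at differentiable_def by metis+
  then show ?case by (simp add: Ck_on_const)
qed

lemma Ck_on_add:
  assumes "open S"
  shows "Ck_on k S f \<Longrightarrow> Ck_on k S g \<Longrightarrow> Ck_on k S (\<lambda>x. f x + g x)"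
proof (induction k arbitrary: f g)
  case 0
  then show ?case by (auto intro: continuous_intros)
next
  case (Suc k)
  have d: "((\<lambda>x. f x + g x) has_derivative
      (\<lambda>v. frechet_derivative f (at x) v + frechet_derivative g (at x) v)) (at x)" if "x \<in> S" for x
    using Suc.prems that by (intro has_derivative_add) (auto simp flip: frechet_derivative_works)
  have "Ck_on k S (\<lambda>x. frechet_derivative (\<lambda>x. f x + g x) (at x) v)" for v
    by (rule Ck_on_cong[OF assms Suc.IH[of "\<lambda>x. frechet_derivative f (at x) v"
            "\<lambda>x. frechet_derivative g (at x) v"]])
      (use Suc.prems frechet_derivative_at[OF d] in \<open>auto dest!: fun_cong\<close>)
  then show ?case using d by (auto simp: differentiable_def)
qed

lemma Ck_on_sum:
  assumes "open S" "\<And>i. i \<in> I \<Longrightarrow> Ck_on k S (f i)"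
  shows "Ck_on k S (\<lambda>x. \<Sum>i\<in>I. f i x)"
  using assms(2) by (induction I rule: infinite_finite_induct)
    (auto simp: Ck_on_const Ck_on_add assms(1))

text \<open>One product rule for multiplication, scaling, the inner product and the evaluation of
  bounded linear maps. The derivative involves the functions themselves besides their derivatives,
  so the induction needs \<open>Ck_on_SucD\<close>.\<close>

lemma Ck_on_bilinear:
  assumes "open S" "bounded_bilinear mul"
  shows "Ck_on k S f \<Longrightarrow> Ck_on k S g \<Longrightarrow> Ck_on k S (\<lambda>x. mul (f x) (g x))"
proof (induction k arbitrary: f g)
  case 0
  then show ?case using bounded_bilinear.continuous_on[OF assms(2)] by auto
next
  case (Suc k)
  have d: "((\<lambda>x. mul (f x) (g x)) has_derivative
      (\<lambda>v. mul (f x) (frechet_derivative g (at x) v) + mul (frechet_derivative f (at x) v) (g x)))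
        (at x)" if "x \<in> S" for x
    using Suc.prems that
    by (intro bounded_bilinear.FDERIV[OF assms(2)]) (auto simp flip: frechet_derivative_works)
  have fd: "frechet_derivative (\<lambda>x. mul (f x) (g x)) (at x)
      = (\<lambda>v. mul (f x) (frechet_derivative g (at x) v) + mul (frechet_derivative f (at x) v) (g x))"
    if "x \<in> S" for x
    using frechet_derivative_at[OF d[OF that]] by simp
  have "Ck_on k S (\<lambda>x. mul (f x) (frechet_derivative g (at x) v)
      + mul (frechet_derivative f (at x) v) (g x))" for v
    using Suc.prems Ck_on_SucD[of k S f] Ck_on_SucD[of k S g]
    by (intro Ck_on_add assms Suc.IH) auto
  then have "Ck_on k S (\<lambda>x. frechet_derivative (\<lambda>x. mul (f x) (g x)) (at x) v)" for v
    by (rule Ck_on_cong[OF assms(1)]) (simp add: fd)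
  then show ?case using d by (auto simp: differentiable_def)
qed

lemma Ck_on_bounded_linear_compose:
  assumes "open S" "bounded_linear h" "Ck_on k S f"
  shows "Ck_on k S (\<lambda>x. h (f x))"
  using assms(3)
proof (induction k arbitrary: f)
  case 0
  then show ?case using bounded_linear.continuous_on[OF assms(2)] by auto
next
  case (Suc k)
  have d: "((\<lambda>x. h (f x)) has_derivative (\<lambda>v. h (frechet_derivative f (at x) v))) (at x)"
    if "x \<in> S" for x
    using Suc.prems that
    by (intro bounded_linear.has_derivative[OF assms(2)]) (auto simp flip: frechet_derivative_works)
  have fd: "frechet_derivative (\<lambda>x. h (f x)) (at x) = (\<lambda>v. h (frechet_derivative f (at x) v))"
    if "x \<in> S" for x
    using frechet_derivative_at[OF d[OF that]] by simp
  have "Ck_on k S (\<lambda>x. h (frechet_derivative f (at x) v))" for v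
    using Suc.prems by (intro Suc.IH) auto
  then have "Ck_on k S (\<lambda>x. frechet_derivative (\<lambda>x. h (f x)) (at x) v)" for v
    by (rule Ck_on_cong[OF assms(1)]) (simp add: fd)
  then show ?case using d by (auto simp: differentiable_def)
qed

text \<open>The derivative of \<open>f\<close> is taken in a direction that varies with the point,
  whereas \<open>Ck_on\<close> speaks of fixed directions. Expanding the direction in a Parseval
  frame of the middle space leaves derivatives along the constant vectors \<open>b i\<close>, to
  which the induction hypothesis applies.\<close>

lemma Ck_on_compose:
  fixes g :: "'a::real_normed_vector \<Rightarrow> 'b::real_inner"
  assumes "finite_dim TYPE('b)" "open S" "open T" "g ` S \<subseteq> T" "Ck_on k S g" "Ck_on k T f"
  shows "Ck_on k S (\<lambda>x. f (g x))"
  using assms(5,6)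
proof (induction k arbitrary: f)
  case 0
  then show ?case
    using continuous_on_compose2[of T f S g] assms(4) by simp
next
  case (Suc k)
  obtain n and b :: "nat \<Rightarrow> 'b" where b: "parseval_frame n b"
    using finite_dim_parseval_frame assms(1) by blast
  have d: "((\<lambda>x. f (g x)) has_derivative
      (\<lambda>v. frechet_derivative f (at (g x)) (frechet_derivative g (at x) v))) (at x)"
    and lin: "linear (frechet_derivative f (at (g x)))" if "x \<in> S" for x
  proof -
    have "f differentiable at (g x)" "g differentiable at x"
      using Suc.prems that assms(4) by (simp_all add: image_subset_iff)
    then show "((\<lambda>x. f (g x)) has_derivative
      (\<lambda>v. frechet_derivative f (at (g x)) (frechet_derivative g (at x) v))) (at x)"
      "linear (frechet_derivative f (at (g x)))"
      using diff_chain_at[of g _ x f] linear_frechet_derivative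
      unfolding frechet_derivative_works o_def by blast+
  qed
  have fd: "frechet_derivative (\<lambda>x. f (g x)) (at x) v
      = (\<Sum>i<n. (frechet_derivative g (at x) v \<bullet> b i) *\<^sub>R frechet_derivative f (at (g x)) (b i))"
    if "x \<in> S" for x v
    using frechet_derivative_at[OF d[OF that]] finite_dim_linear_sum[OF b lin[OF that]] by metis
  have "Ck_on k S (\<lambda>x. \<Sum>i<n. (frechet_derivative g (at x) v \<bullet> b i)
      *\<^sub>R frechet_derivative f (at (g x)) (b i))" for v
    using Suc.prems Ck_on_SucD[of k S g]
    by (intro Ck_on_sum Ck_on_bilinear[OF assms(2) bounded_bilinear_scaleR] assms(2) Suc.IH
        Ck_on_bounded_linear_compose[OF assms(2) bounded_linear_inner_left]) auto
  then have "Ck_on k S (\<lambda>x. frechet_derivative (\<lambda>x. f (g x)) (at x) v)" for v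
    by (rule Ck_on_cong[OF assms(2)]) (simp add: fd)
  then show ?case using d by (auto simp: differentiable_def)
qed

lemma smooth_on_differentiable: "smooth_on S f \<Longrightarrow> x \<in> S \<Longrightarrow> f differentiable (at x)"
  unfolding smooth_on_def using Ck_on.simps(2) by metis

lemma smooth_on_frechet_derivative:
  "smooth_on S f \<Longrightarrow> smooth_on S (\<lambda>x. frechet_derivative f (at x) v)"
  unfolding smooth_on_def using Ck_on.simps(2) by metis

lemma smooth_on_subset: "smooth_on S f \<Longrightarrow> T \<subseteq> S \<Longrightarrow> smooth_on T f"
  unfolding smooth_on_def using Ck_on_subset by blast

lemma smooth_on_cong:
  "open S \<Longrightarrow> smooth_on S f \<Longrightarrow> (\<And>x. x \<in> S \<Longrightarrow> f x = g x) \<Longrightarrow> smooth_on S g"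
  using Ck_on_cong by (fastforce simp: smooth_on_def)

lemma smooth_on_local:
  "(\<And>x. x \<in> S \<Longrightarrow> \<exists>T. open T \<and> x \<in> T \<and> smooth_on T f) \<Longrightarrow> smooth_on S f"
  unfolding smooth_on_def by (metis Ck_on_local)

lemma smooth_on_const: "smooth_on S (\<lambda>_. c)"
  by (simp add: smooth_on_def Ck_on_const)

lemma smooth_on_bounded_linear: "bounded_linear f \<Longrightarrow> smooth_on S f"
  by (simp add: smooth_on_def Ck_on_bounded_linear)

lemma smooth_on_add:
  "open S \<Longrightarrow> smooth_on S f \<Longrightarrow> smooth_on S g \<Longrightarrow> smooth_on S (\<lambda>x. f x + g x)"
  by (simp add: smooth_on_def Ck_on_add)

lemma smooth_on_bilinear:
  "open S \<Longrightarrow> bounded_bilinear mul \<Longrightarrow> smooth_on S f \<Longrightarrow> smooth_on S g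
    \<Longrightarrow> smooth_on S (\<lambda>x. mul (f x) (g x))"
  by (simp add: smooth_on_def Ck_on_bilinear)

lemma smooth_on_bounded_linear_compose:
  "open S \<Longrightarrow> bounded_linear h \<Longrightarrow> smooth_on S f \<Longrightarrow> smooth_on S (\<lambda>x. h (f x))"
  by (simp add: smooth_on_def Ck_on_bounded_linear_compose)

lemma smooth_on_compose:
  fixes g :: "'a::real_normed_vector \<Rightarrow> 'b::real_inner"
  assumes "finite_dim TYPE('b)" "open S" "open T" "g ` S \<subseteq> T" "smooth_on S g" "smooth_on T f"
  shows "smooth_on S (\<lambda>x. f (g x))"
  using assms Ck_on_compose unfolding smooth_on_def by metis


subsection \<open>Smooth bump functions\<close>

text \<open>\<open>flat 0\<close> is the classical function exp(-1/x), extended by 0. The powers of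
  \<open>inverse x\<close> make the family closed under differentiation up to linear combinations,
  so that smoothness of all members follows by one induction.\<close>

definition flat :: "nat \<Rightarrow> real \<Rightarrow> real" where
  "flat m x = (if x > 0 then inverse x ^ m * exp (- inverse x) else 0)"

lemma tendsto_flat_at_right: "(flat m \<longlongrightarrow> 0) (at_right 0)"
proof -
  have "((\<lambda>x. inverse x ^ m / exp (inverse x)) \<longlongrightarrow> 0) (at_right (0::real))"
    by (rule filterlim_compose[OF tendsto_power_div_exp_0 filterlim_inverse_at_top_right])
  moreover have "\<forall>\<^sub>F x in at_right 0. inverse x ^ m / exp (inverse x) = flat m x"
    using eventually_at_right_less[of "0::real"]
    by eventually_elim (simp add: flat_def exp_minus field_simps)
  ultimately show ?thesis by (rule Lim_transform_eventually)
qed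

text \<open>The point 0 is the essential case: the right difference quotient of
  \<open>flat m\<close> there is \<open>flat (m + 1)\<close>, again a member of the family, and
  tends to 0.\<close>

lemma flat_has_derivative:
  "(flat m has_real_derivative flat (m + 2) x - of_nat m * flat (m + 1) x) (at x)"
proof (cases "x = 0")
  case True
  have "((\<lambda>h. (flat m h - flat m 0) / (h - 0)) \<longlongrightarrow> 0) (at 0)"
  proof (rule filterlim_split_at)
    have "\<forall>\<^sub>F h in at_left (0::real). 0 = (flat m h - flat m 0) / (h - 0)"
      by (auto simp: eventually_at_filter flat_def)
    then show "((\<lambda>h. (flat m h - flat m 0) / (h - 0)) \<longlongrightarrow> 0) (at_left 0)"
      by (rule Lim_transform_eventually[OF tendsto_const])
    have "\<forall>\<^sub>F h in at_right (0::real). flat (m + 1) h = (flat m h - flat m 0) / (h - 0)"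
      using eventually_at_right_less[of "0::real"]
      by eventually_elim (simp add: flat_def field_simps)
    then show "((\<lambda>h. (flat m h - flat m 0) / (h - 0)) \<longlongrightarrow> 0) (at_right 0)"
      by (rule Lim_transform_eventually[OF tendsto_flat_at_right])
  qed
  then show ?thesis using True by (simp add: has_field_derivative_iff flat_def)
next
  case False
  show ?thesis
  proof (cases "x > 0")
    case True
    have "((\<lambda>x. inverse x ^ m * exp (- inverse x)) has_real_derivative
        flat (m + 2) x - of_nat m * flat (m + 1) x) (at x)"
      using True
      by (auto intro!: derivative_eq_intros simp: flat_def algebra_simps power2_eq_square)
        (cases m, auto simp: algebra_simps)
    then show ?thesis
      by (rule has_field_derivative_transform_within_open[where S = "{0<..}"])
        (use True in \<open>auto simp: flat_def\<close>)
  next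
    case neg: False
    have "((\<lambda>x. 0) has_real_derivative flat (m + 2) x - of_nat m * flat (m + 1) x) (at x)"
      using neg by (simp add: flat_def)
    then show ?thesis
      by (rule has_field_derivative_transform_within_open[where S = "{..<0}"])
        (use neg \<open>x \<noteq> 0\<close> in \<open>auto simp: flat_def\<close>)
  qed
qed

lemma Ck_on_flat: "Ck_on k UNIV (flat m)"
proof (induction k arbitrary: m)
  case 0
  then show ?case
    using DERIV_isCont[OF flat_has_derivative] by (simp add: continuous_at_imp_continuous_on)
next
  case (Suc k)
  have d: "(flat m has_derivative (\<lambda>v. (flat (m + 2) x + (- of_nat m) * flat (m + 1) x) * v)) (at x)"
    for x
    using flat_has_derivative[of m x] by (simp add: has_field_derivative_def)
  have "frechet_derivative (flat m) (at x) = (\<lambda>v. (flat (m + 2) x + (- of_nat m) * flat (m + 1) x) * v)"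
    for x
    using frechet_derivative_at[OF d] by simp
  moreover have "Ck_on k UNIV (\<lambda>x. (flat (m + 2) x + (- of_nat m) * flat (m + 1) x) * v)" for v
    by (intro Ck_on_bilinear[OF _ bounded_bilinear_mult] Ck_on_add Ck_on_const Suc.IH) auto
  ultimately show ?case using d by (auto simp: differentiable_def)
qed

text \<open>The derivative is a product of two copies of the function and a constant, so the product
  rule closes the induction.\<close>

lemma smooth_on_inverse: "smooth_on {0<..} (inverse :: real \<Rightarrow> real)"
  unfolding smooth_on_def
proof
  fix k
  show "Ck_on k {0<..} (inverse :: real \<Rightarrow> real)"
  proof (induction k)
    case 0
    then show ?case by (auto intro!: continuous_intros)
  next
    case (Suc k)
    have d: "(inverse has_derivative (\<lambda>v. - (inverse x * v * inverse x))) (at x)"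
      if "x \<in> {0<..}" for x :: real
      using that by (intro has_derivative_inverse') simp
    have fd: "frechet_derivative inverse (at x) = (\<lambda>v. - (inverse x * v * inverse x))"
      if "x \<in> {0<..}" for x :: real
      using frechet_derivative_at[OF d[OF that]] by simp
    have "Ck_on k {0<..} (\<lambda>x. (inverse x * (- v)) * inverse x)" for v :: real
      by (intro Ck_on_bilinear[OF _ bounded_bilinear_mult] Suc.IH Ck_on_const) auto
    then have "Ck_on k {0<..} (\<lambda>x::real. frechet_derivative inverse (at x) v)" for v
      by (rule Ck_on_cong[rotated]) (simp_all add: fd)
    then show ?case using d by (auto simp: differentiable_def)
  qed
qed

lemma finite_dim_real: "finite_dim TYPE(real)"
  unfolding finite_dim_def
proof (intro exI conjI)
  show "span {1} = (UNIV :: real set)"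
    by (auto simp: span_singleton)
qed simp

lemma smooth_bump_ball:
  fixes p :: "'a::real_inner"
  assumes "r > 0"
  obtains g :: "'a \<Rightarrow> real" where "smooth_on UNIV g" "\<And>x. x \<in> ball p (r / 2) \<Longrightarrow> g x = 1"
    "\<And>x. x \<notin> cball p r \<Longrightarrow> g x = 0"
proof -
  \<comment> \<open>The squared distance in units of \<open>r\<close> is quadratic, hence smooth
    also at \<open>p\<close>. \<open>u\<close> is positive exactly where \<open>q x < 1\<close> and
    \<open>v\<close> exactly where \<open>q x > 1/4\<close>, so \<open>u x + v x\<close> never
    vanishes; \<open>1/4\<close> corresponds to the radius \<open>r / 2\<close>.\<close>
  define q where "q x = (x - p) \<bullet> (x - p) * inverse (r\<^sup>2)" for x
  define u where "u x = flat 0 (1 + (-1) * q x)" for x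
  define v where "v x = flat 0 (q x + - (1/4))" for x
  have q: "smooth_on UNIV q"
    unfolding q_def diff_conv_add_uminus
    by (intro smooth_on_bilinear[OF _ bounded_bilinear_mult] smooth_on_const
        smooth_on_bilinear[OF _ bounded_bilinear_inner] smooth_on_add
        smooth_on_bounded_linear[OF bounded_linear_ident]) auto
  have fl: "smooth_on UNIV (\<lambda>x. flat 0 (h x))" if "smooth_on UNIV h" for h :: "'a \<Rightarrow> real"
    by (rule smooth_on_compose[OF finite_dim_real open_UNIV open_UNIV])
      (use that Ck_on_flat in \<open>auto simp: smooth_on_def\<close>)
  have u: "smooth_on UNIV u" and v: "smooth_on UNIV v"
    unfolding u_def v_def
    by (intro fl smooth_on_add q smooth_on_bilinear[OF _ bounded_bilinear_mult] smooth_on_const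
        open_UNIV)+
  have nonneg: "0 \<le> flat 0 x" and pos: "0 < flat 0 x \<longleftrightarrow> 0 < x" for x
    by (auto simp: flat_def)
  have uv: "u x + v x > 0" for x
    using nonneg[of "1 - q x"] nonneg[of "q x - 1/4"] pos[of "1 - q x"] pos[of "q x - 1/4"]
    by (cases "q x < 1") (auto simp: u_def v_def intro: add_pos_nonneg add_nonneg_pos)
  define g where "g x = u x * inverse (u x + v x)" for x
  have "smooth_on UNIV (\<lambda>x. inverse (u x + v x))"
    by (rule smooth_on_compose[OF finite_dim_real open_UNIV _ _ _ smooth_on_inverse])
      (use uv u v in \<open>auto intro: smooth_on_add\<close>)
  then have "smooth_on UNIV g"
    unfolding g_def using u by (intro smooth_on_bilinear[OF _ bounded_bilinear_mult]) auto
  moreover have "g x = 1" if "x \<in> ball p (r / 2)" for x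
  proof -
    have "norm (x - p) < r / 2"
      using that by (simp add: dist_norm norm_minus_commute)
    then have "(norm (x - p))\<^sup>2 < (r / 2)\<^sup>2"
      by (intro power_strict_mono) auto
    then have "q x < 1/4"
      using assms by (simp add: q_def field_simps flip: power2_norm_eq_inner)
    then have "v x = 0" by (simp add: v_def flat_def)
    then show ?thesis using uv[of x] by (simp add: g_def)
  qed
  moreover have "g x = 0" if "x \<notin> cball p r" for x
  proof -
    have "r < norm (x - p)"
      using that by (simp add: dist_norm norm_minus_commute)
    then have "r\<^sup>2 < (norm (x - p))\<^sup>2"
      using assms by (intro power_strict_mono) auto
    then have "q x > 1"
      using assms by (simp add: q_def field_simps flip: power2_norm_eq_inner)
    then show ?thesis by (simp add: g_def u_def flat_def)
  qed
  ultimately show thesis by (rule that)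
qed


section \<open>Smooth functions on manifolds\<close>

lemma smooth_fun_on_subset:
  "smooth_fun_on M W f \<Longrightarrow> V \<subseteq> W \<Longrightarrow> smooth_fun_on M V f"
  unfolding smooth_fun_on_def by (blast intro: smooth_on_subset)

lemma CinfD: "f \<in> Cinf M \<Longrightarrow> smooth_fun_on M W f"
  unfolding Cinf_def using smooth_fun_on_subset by blast

lemma smooth_fun_on_const: "smooth_fun_on M W (\<lambda>_. c)"
  by (auto simp: smooth_fun_on_def o_def smooth_on_const)

lemma Cinf_const: "(\<lambda>_. c) \<in> Cinf M"
  by (simp add: Cinf_def smooth_fun_on_const)

context
  fixes M :: "('m::{t2_space,second_countable_topology}, 'n::real_inner) atlas"
  assumes M: "manifold M"
begin

lemma finite_dim_model: "finite_dim TYPE('n)"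
  using M by (simp add: manifold_def)

lemma chart_at: obtains U \<kappa> where "(U, \<kappa>) \<in> M" "x \<in> U"
proof -
  have "x \<in> (\<Union>(U, \<kappa>)\<in>M. U)"
    using M unfolding manifold_def by simp
  then show thesis using that by auto
qed

lemma chart_open: "(U, \<kappa>) \<in> M \<Longrightarrow> open U"
  using M unfolding manifold_def by blast

lemma chart_homeo: "(U, \<kappa>) \<in> M \<Longrightarrow> homeomorphism U (\<kappa> ` U) \<kappa> (inv_into U \<kappa>)"
  using M unfolding manifold_def by blast

lemma chart_inv: "(U, \<kappa>) \<in> M \<Longrightarrow> x \<in> U \<Longrightarrow> inv_into U \<kappa> (\<kappa> x) = x"
  using chart_homeo unfolding homeomorphism_def by blast

lemma chart_image_open:
  assumes "(U, \<kappa>) \<in> M" "open W"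
  shows "open (\<kappa> ` (U \<inter> W))"
proof -
  have "openin (top_of_set (\<kappa> ` U)) (\<kappa> ` (U \<inter> W))"
    using homeomorphism_imp_open_map[OF chart_homeo[OF assms(1)], of "U \<inter> W"] assms(2)
    by (simp add: openin_open_Int)
  moreover have "open (\<kappa> ` U)"
    using M assms(1) unfolding manifold_def by blast
  ultimately show ?thesis by (metis openin_open_eq)
qed

lemma smooth_fun_on_cong:
  assumes "open W" "smooth_fun_on M W f" "\<And>x. x \<in> W \<Longrightarrow> f x = g x"
  shows "smooth_fun_on M W g"
  unfolding smooth_fun_on_def
proof clarify
  fix U \<kappa> assume c: "(U, \<kappa>) \<in> M"
  then have "smooth_on (\<kappa> ` (U \<inter> W)) (f \<circ> inv_into U \<kappa>)"
    using assms(2) by (auto simp: smooth_fun_on_def)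
  then show "smooth_on (\<kappa> ` (U \<inter> W)) (g \<circ> inv_into U \<kappa>)"
    by (rule smooth_on_cong[OF chart_image_open[OF c assms(1)]])
      (use assms(3) in \<open>auto simp: chart_inv[OF c]\<close>)
qed

lemma smooth_fun_on_local:
  assumes "\<And>x. x \<in> W \<Longrightarrow> \<exists>N. open N \<and> x \<in> N \<and> smooth_fun_on M N f"
  shows "smooth_fun_on M W f"
  unfolding smooth_fun_on_def
proof clarify
  fix U \<kappa> assume c: "(U, \<kappa>) \<in> M"
  show "smooth_on (\<kappa> ` (U \<inter> W)) (f \<circ> inv_into U \<kappa>)"
  proof (rule smooth_on_local, elim imageE, clarify)
    fix x assume "x \<in> U" "x \<in> W"
    then obtain N where "open N" "x \<in> N" "smooth_fun_on M N f"
      using assms by blast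
    then show "\<exists>T. open T \<and> \<kappa> x \<in> T \<and> smooth_on T (f \<circ> inv_into U \<kappa>)"
      using chart_image_open[OF c] c \<open>x \<in> U\<close> unfolding smooth_fun_on_def by blast
  qed
qed

lemma smooth_fun_onD:
  "smooth_fun_on M W f \<Longrightarrow> (U, \<kappa>) \<in> M \<Longrightarrow> W \<subseteq> U \<Longrightarrow> smooth_on (\<kappa> ` W) (f \<circ> inv_into U \<kappa>)"
  unfolding smooth_fun_on_def by (metis (no_types, lifting) case_prodD inf.absorb2)

text \<open>Testing in one chart whose domain contains \<open>W\<close> suffices: the expression in
  any other chart arises by composition with a smooth transition map.\<close>

lemma smooth_fun_on_chart:
  assumes c: "(U, \<kappa>) \<in> M" and W: "open W" "W \<subseteq> U"
    and f: "smooth_on (\<kappa> ` W) (f \<circ> inv_into U \<kappa>)"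
  shows "smooth_fun_on M W f"
  unfolding smooth_fun_on_def
proof clarify
  fix V \<mu> assume d: "(V, \<mu>) \<in> M"
  have "smooth_on (\<mu> ` (V \<inter> U)) (\<kappa> \<circ> inv_into V \<mu>)"
    using M c d unfolding manifold_def by blast
  then have "smooth_on (\<mu> ` (V \<inter> W)) (\<kappa> \<circ> inv_into V \<mu>)"
    by (rule smooth_on_subset) (use W in auto)
  moreover have "open (\<kappa> ` W)"
    using chart_image_open[OF c W(1)] W(2) by (simp add: Int_absorb1)
  ultimately have "smooth_on (\<mu> ` (V \<inter> W)) (\<lambda>p. (f \<circ> inv_into U \<kappa>) ((\<kappa> \<circ> inv_into V \<mu>) p))"
    by (intro smooth_on_compose[OF finite_dim_model chart_image_open[OF d W(1)] _ _ _ f])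
      (auto simp: chart_inv[OF d] o_def)
  then show "smooth_on (\<mu> ` (V \<inter> W)) (f \<circ> inv_into V \<mu>)"
    by (rule smooth_on_cong[OF chart_image_open[OF d W(1)]])
      (use W in \<open>auto simp: chart_inv[OF d] chart_inv[OF c]\<close>)
qed

lemma smooth_fun_on_add:
  "open W \<Longrightarrow> smooth_fun_on M W f \<Longrightarrow> smooth_fun_on M W g \<Longrightarrow> smooth_fun_on M W (\<lambda>x. f x + g x)"
  unfolding smooth_fun_on_def o_def by (auto intro!: smooth_on_add chart_image_open)

lemma smooth_fun_on_bilinear:
  "open W \<Longrightarrow> bounded_bilinear mul \<Longrightarrow> smooth_fun_on M W f \<Longrightarrow> smooth_fun_on M W g
    \<Longrightarrow> smooth_fun_on M W (\<lambda>x. mul (f x) (g x))"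
  unfolding smooth_fun_on_def
  using smooth_on_bilinear[OF chart_image_open, of _ _ W mul "f \<circ> inv_into _ _" "g \<circ> inv_into _ _"]
  by (fastforce simp: o_def)

lemma smooth_fun_on_bounded_linear:
  "open W \<Longrightarrow> bounded_linear h \<Longrightarrow> smooth_fun_on M W f \<Longrightarrow> smooth_fun_on M W (\<lambda>x. h (f x))"
  unfolding smooth_fun_on_def
  using smooth_on_bounded_linear_compose[OF chart_image_open, of _ _ W h "f \<circ> inv_into _ _"]
  by (auto simp: o_def)

lemma smooth_fun_on_sum:
  assumes "open W" "\<And>i. i \<in> I \<Longrightarrow> smooth_fun_on M W (f i)"
  shows "smooth_fun_on M W (\<lambda>x. \<Sum>i\<in>I. f i x)"
  using assms(2)
  by (induction I rule: infinite_finite_induct)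
    (auto simp: smooth_fun_on_const smooth_fun_on_add assms(1))

lemmas smooth_fun_on_scaleR = smooth_fun_on_bilinear[OF _ bounded_bilinear_scaleR]
lemmas smooth_fun_on_mult = smooth_fun_on_bilinear[OF _ bounded_bilinear_mult]
lemmas smooth_fun_on_inner_left =
  smooth_fun_on_bounded_linear[OF _ bounded_linear_inner_left]

lemma Cinf_add: "f \<in> Cinf M \<Longrightarrow> g \<in> Cinf M \<Longrightarrow> (\<lambda>x. f x + g x) \<in> Cinf M"
  by (simp add: Cinf_def smooth_fun_on_add)

lemma Cinf_mult: "f \<in> Cinf M \<Longrightarrow> g \<in> Cinf M \<Longrightarrow> (\<lambda>x. f x * g x) \<in> Cinf M"
  by (simp add: Cinf_def smooth_fun_on_mult)

lemma Cinf_sum: "(\<And>i. i \<in> I \<Longrightarrow> f i \<in> Cinf M) \<Longrightarrow> (\<lambda>x. \<Sum>i\<in>I. f i x) \<in> Cinf M"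
  by (simp add: Cinf_def smooth_fun_on_sum)

lemma smooth_fun_on_differentiable:
  assumes "smooth_fun_on M W f" "(U, \<kappa>) \<in> M" "x \<in> U" "x \<in> W"
  shows "(f \<circ> inv_into U \<kappa>) differentiable (at (\<kappa> x))"
  using assms smooth_on_differentiable unfolding smooth_fun_on_def by blast

text \<open>\<open>C\<close> is the image of a closed ball in a chart. Being compact, it is closed
  in the Hausdorff space, so the function extends by 0 across the boundary of the chart
  domain.\<close>

lemma bump_function:
  assumes "open W" "x \<in> W"
  obtains \<beta> N C where "\<beta> \<in> Cinf M" "open N" "x \<in> N" "N \<subseteq> C" "closed C" "C \<subseteq> W"
    "\<And>z. z \<in> N \<Longrightarrow> \<beta> z = 1" "\<And>z. z \<notin> C \<Longrightarrow> \<beta> z = 0"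
proof -
  obtain U \<kappa> where c: "(U, \<kappa>) \<in> M" and x: "x \<in> U" by (rule chart_at)
  have "open (\<kappa> ` (U \<inter> W))" by (rule chart_image_open[OF c assms(1)])
  then obtain r where r: "r > 0" "cball (\<kappa> x) r \<subseteq> \<kappa> ` (U \<inter> W)"
    using x assms(2) by (metis IntI image_eqI open_contains_cball)
  obtain g :: "'n \<Rightarrow> real" where g: "smooth_on UNIV g"
    "\<And>p. p \<in> ball (\<kappa> x) (r / 2) \<Longrightarrow> g p = 1" "\<And>p. p \<notin> cball (\<kappa> x) r \<Longrightarrow> g p = 0"
    using smooth_bump_ball[OF r(1)] by blast
  define C where "C = inv_into U \<kappa> ` cball (\<kappa> x) r"
  define N where "N = inv_into U \<kappa> ` ball (\<kappa> x) (r / 2)"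
  define \<beta> where "\<beta> z = (if z \<in> U then g (\<kappa> z) else 0)" for z
  have sub: "cball (\<kappa> x) r \<subseteq> \<kappa> ` U" "ball (\<kappa> x) (r / 2) \<subseteq> cball (\<kappa> x) r"
    using r by auto
  have cont: "continuous_on (\<kappa> ` U) (inv_into U \<kappa>)"
    using chart_homeo[OF c] by (simp add: homeomorphism_def)
  have "closed C"
    unfolding C_def
    by (intro compact_imp_closed compact_continuous_image continuous_on_subset[OF cont] sub
        finite_dim_compact_cball finite_dim_model)
  have CW: "C \<subseteq> U \<inter> W"
    unfolding C_def using r(2) by (force simp: chart_inv[OF c])
  have inC: "z \<in> C \<longleftrightarrow> z \<in> U \<and> \<kappa> z \<in> cball (\<kappa> x) r" for z
  proof
    assume "z \<in> C"
    then obtain p where p: "p \<in> cball (\<kappa> x) r" "z = inv_into U \<kappa> p" by (auto simp: C_def)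
    then obtain y where "y \<in> U" "p = \<kappa> y" using sub(1) by blast
    then show "z \<in> U \<and> \<kappa> z \<in> cball (\<kappa> x) r" using p by (simp add: chart_inv[OF c])
  next
    assume "z \<in> U \<and> \<kappa> z \<in> cball (\<kappa> x) r"
    then show "z \<in> C"
      unfolding C_def using chart_inv[OF c, of z] by (metis image_eqI)
  qed
  have "openin (top_of_set U) N"
    unfolding N_def
    by (rule homeomorphism_imp_open_map[OF homeomorphism_symD[OF chart_homeo[OF c]]])
      (use sub in \<open>auto intro!: open_subset\<close>)
  then have "open N" using chart_open[OF c] by (metis openin_open_eq)
  have "smooth_fun_on M U \<beta>"
  proof (rule smooth_fun_on_chart[OF c chart_open[OF c] order_refl])
    have "open (\<kappa> ` U)" using chart_image_open[OF c open_UNIV] by simp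
    then show "smooth_on (\<kappa> ` U) (\<beta> \<circ> inv_into U \<kappa>)"
      by (rule smooth_on_cong[OF _ smooth_on_subset[OF g(1) subset_UNIV]])
        (auto simp: \<beta>_def chart_inv[OF c])
  qed
  moreover have "smooth_fun_on M (- C) \<beta>"
    by (rule smooth_fun_on_cong[OF _ smooth_fun_on_const[of M "- C" 0]])
      (use \<open>closed C\<close> g(3) inC in \<open>auto simp: \<beta>_def\<close>)
  \<comment> \<open>The chart domain and the complement of \<open>C\<close> are open and cover the
    manifold, because \<open>C\<close> lies in the chart domain.\<close>
  ultimately have "smooth_fun_on M UNIV \<beta>"
    by (intro smooth_fun_on_local)
      (metis CW Compl_iff IntD1 \<open>closed C\<close> chart_open[OF c] open_Compl subsetD)
  then have "\<beta> \<in> Cinf M" by (simp add: Cinf_def)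
  moreover have "x \<in> N"
    unfolding N_def using r(1) chart_inv[OF c x] by (metis centre_in_ball half_gt_zero image_eqI)
  moreover have "\<beta> z = 1" if "z \<in> N" for z
    using that sub g(2) unfolding N_def \<beta>_def by (force simp: chart_inv[OF c])
  moreover have "N \<subseteq> C" unfolding N_def C_def using sub(2) by blast
  moreover have "\<beta> z = 0" if "z \<notin> C" for z
    using that g(3) inC by (auto simp: \<beta>_def)
  ultimately show thesis using \<open>open N\<close> \<open>closed C\<close> CW by (intro that[of \<beta> N C]) auto
qed

text \<open>\<open>V\<close> is covered by \<open>U \<inter> V\<close> and \<open>V - C\<close>, and
  on the second set the function is 0. \<open>V\<close> is separate from \<open>U\<close> because a
  section cut off in one trivialization must be tested in every other one, where \<open>f\<close> is
  smooth on the overlap only.\<close>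

lemma smooth_fun_on_extend:
  assumes "open U" "open V" "\<beta> \<in> Cinf M" "closed C" "C \<subseteq> U" "\<And>z. z \<notin> C \<Longrightarrow> \<beta> z = 0"
    and f: "smooth_fun_on M (U \<inter> V) f"
  shows "smooth_fun_on M V (\<lambda>x. if x \<in> U then \<beta> x *\<^sub>R f x else 0)"
proof (rule smooth_fun_on_local)
  fix x assume "x \<in> V"
  have "smooth_fun_on M (U \<inter> V) (\<lambda>x. if x \<in> U then \<beta> x *\<^sub>R f x else 0)"
    by (rule smooth_fun_on_cong[OF _ smooth_fun_on_scaleR[OF _ CinfD f]]) (use assms in auto)
  moreover have "smooth_fun_on M (V - C) (\<lambda>x. if x \<in> U then \<beta> x *\<^sub>R f x else 0)"
    by (rule smooth_fun_on_cong[OF _ smooth_fun_on_const[of M "V - C" 0]]) (use assms in auto)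
  ultimately show "\<exists>N. open N \<and> x \<in> N
      \<and> smooth_fun_on M N (\<lambda>x. if x \<in> U then \<beta> x *\<^sub>R f x else 0)"
    using assms \<open>x \<in> V\<close> by (cases "x \<in> U") (blast intro: open_Int open_Diff)+
qed

end

lemma smooth_map_compose:
  fixes F :: "('f::{t2_space,second_countable_topology}, 'n::real_inner) atlas"
    and M :: "('m::{t2_space,second_countable_topology}, 'p::real_inner) atlas"
  assumes F: "manifold F" and M: "manifold M" and phi: "smooth_map F M \<phi>"
    and W: "open W" and f: "smooth_fun_on M W f"
  shows "smooth_fun_on F (\<phi> -` W) (\<lambda>y. f (\<phi> y))"
proof (rule smooth_fun_on_local[OF F])
  fix y assume "y \<in> \<phi> -` W"
  obtain V \<mu> where d: "(V, \<mu>) \<in> M" and V: "\<phi> y \<in> V" by (rule chart_at[OF M])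
  have cont: "open (\<phi> -` S)" if "open S" for S
    using phi that by (auto simp: smooth_map_def intro: open_vimage)
  have "smooth_fun_on F (\<phi> -` V) (\<mu> \<circ> \<phi>)"
    using phi d by (auto simp: smooth_map_def)
  then have 1: "smooth_fun_on F (\<phi> -` (V \<inter> W)) (\<mu> \<circ> \<phi>)"
    by (rule smooth_fun_on_subset) auto
  have 2: "smooth_on (\<mu> ` (V \<inter> W)) (f \<circ> inv_into V \<mu>)"
    using f d by (auto simp: smooth_fun_on_def)
  have oW: "open (\<phi> -` (V \<inter> W))" by (intro cont open_Int W chart_open[OF M d])
  have "smooth_fun_on F (\<phi> -` (V \<inter> W)) (\<lambda>y. f (\<phi> y))"
    unfolding smooth_fun_on_def
  proof clarify
    fix U \<kappa> assume c: "(U, \<kappa>) \<in> F"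
    let ?S = "\<kappa> ` (U \<inter> \<phi> -` (V \<inter> W))"
    have "smooth_on ?S (\<mu> \<circ> \<phi> \<circ> inv_into U \<kappa>)"
      using 1 c by (auto simp: smooth_fun_on_def)
    then have "smooth_on ?S (\<lambda>p. (f \<circ> inv_into V \<mu>) ((\<mu> \<circ> \<phi> \<circ> inv_into U \<kappa>) p))"
      by (intro smooth_on_compose[OF finite_dim_model[OF M] _ _ _ _ 2] chart_image_open[OF F c]
          chart_image_open[OF M d] oW W) (auto simp: chart_inv[OF F c] o_def)
    then show "smooth_on ?S ((\<lambda>y. f (\<phi> y)) \<circ> inv_into U \<kappa>)"
      by (rule smooth_on_cong[OF chart_image_open[OF F c oW]])
        (auto simp: chart_inv[OF F c] chart_inv[OF M d])
  qed
  then show "\<exists>N. open N \<and> y \<in> N \<and> smooth_fun_on F N (\<lambda>y. f (\<phi> y))"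
    using oW V \<open>y \<in> \<phi> -` W\<close> by blast
qed


subsection \<open>Tangent vectors\<close>

lemma chart_vector_apply:
  "chart_vector M (U, \<kappa>) x w f
    = (if f \<in> Cinf M then frechet_derivative (f \<circ> inv_into U \<kappa>) (at (\<kappa> x)) w else 0)"
  by (simp add: chart_vector_def)

context
  fixes M :: "('m::{t2_space,second_countable_topology}, 'n::real_inner) atlas"
  assumes M: "manifold M"
begin

lemma Cinf_differentiable:
  "f \<in> Cinf M \<Longrightarrow> (U, \<kappa>) \<in> M \<Longrightarrow> x \<in> U \<Longrightarrow> (f \<circ> inv_into U \<kappa>) differentiable (at (\<kappa> x))"
  using smooth_fun_on_differentiable[OF M, of UNIV f U \<kappa> x] by (simp add: Cinf_def)

lemma linear_chart_vector:
  assumes "(U, \<kappa>) \<in> M" "x \<in> U"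
  shows "linear (chart_vector M (U, \<kappa>) x)"
proof (rule linearI)
  have lin: "linear (frechet_derivative (f \<circ> inv_into U \<kappa>) (at (\<kappa> x)))" if "f \<in> Cinf M" for f
    using Cinf_differentiable[OF that assms] linear_frechet_derivative by blast
  show "chart_vector M (U, \<kappa>) x (v + w) = chart_vector M (U, \<kappa>) x v + chart_vector M (U, \<kappa>) x w"
    for v w
    using lin by (auto simp: chart_vector_apply linear_add fun_eq_iff)
  show "chart_vector M (U, \<kappa>) x (c *\<^sub>R w) = c *\<^sub>R chart_vector M (U, \<kappa>) x w" for c w
    using lin by (auto simp: chart_vector_apply linear_cmul scaleR_fun_def fun_eq_iff)
qed

text \<open>The coordinate function \<open>\<kappa> z \<bullet> w\<close> detects \<open>w\<close>:
  its derivative along \<open>w\<close> is \<open>w \<bullet> w\<close>. It must be cut off, since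
  tangent vectors act on globally defined functions.\<close>

lemma inj_chart_vector:
  assumes c: "(U, \<kappa>) \<in> M" and x: "x \<in> U"
  shows "inj (chart_vector M (U, \<kappa>) x)"
  unfolding linear_injective_0[OF linear_chart_vector[OF assms]]
proof (intro allI impI)
  fix w assume 0: "chart_vector M (U, \<kappa>) x w = 0"
  obtain \<beta> N C where \<beta>: "\<beta> \<in> Cinf M" "open N" "x \<in> N" "N \<subseteq> C" "closed C" "C \<subseteq> U"
    "\<And>z. z \<in> N \<Longrightarrow> \<beta> z = 1" "\<And>z. z \<notin> C \<Longrightarrow> \<beta> z = 0"
    using bump_function[OF M chart_open[OF M c] x] by blast
  define f where "f z = (if z \<in> U then \<beta> z *\<^sub>R (\<kappa> z \<bullet> w) else 0)" for z
  have "smooth_fun_on M U (\<lambda>z. \<kappa> z \<bullet> w)"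
  proof (rule smooth_fun_on_chart[OF M c chart_open[OF M c] order_refl])
    have "open (\<kappa> ` U)" using chart_image_open[OF M c open_UNIV] by simp
    then show "smooth_on (\<kappa> ` U) ((\<lambda>z. \<kappa> z \<bullet> w) \<circ> inv_into U \<kappa>)"
      by (rule smooth_on_cong[OF _ smooth_on_bounded_linear[OF bounded_linear_inner_left[of w]]])
        (auto simp: chart_inv[OF M c])
  qed
  then have f: "f \<in> Cinf M"
    unfolding f_def Cinf_def using chart_open[OF M c] \<beta>
    by (auto intro!: smooth_fun_on_extend[OF M _ _ \<beta>(1,5,6,8)])
  have oN: "open (\<kappa> ` (U \<inter> N))" by (rule chart_image_open[OF M c \<beta>(2)])
  have "(f \<circ> inv_into U \<kappa> has_derivative (\<lambda>v. v \<bullet> w)) (at (\<kappa> x))"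
    by (rule has_derivative_transform_within_open[OF
          bounded_linear_imp_has_derivative[OF bounded_linear_inner_left[of w]] oN])
      (use x \<beta> in \<open>auto simp: f_def chart_inv[OF M c]\<close>)
  then have "frechet_derivative (f \<circ> inv_into U \<kappa>) (at (\<kappa> x)) = (\<lambda>v. v \<bullet> w)"
    using frechet_derivative_at by metis
  then have "w \<bullet> w = chart_vector M (U, \<kappa>) x w f"
    using f by (simp add: chart_vector_apply)
  then show "w = 0" using 0 by simp
qed

text \<open>Chain rule for the transition map. It shows that the tangent fibre, defined as a union
  over all charts around \<open>x\<close>, is the range of each single chart map.\<close>

lemma chart_vector_change:
  assumes c: "(U, \<kappa>) \<in> M" and x: "x \<in> U" and d: "(V, \<mu>) \<in> M" and y: "x \<in> V"
  shows "chart_vector M (U, \<kappa>) x w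
    = chart_vector M (V, \<mu>) x (frechet_derivative (\<mu> \<circ> inv_into U \<kappa>) (at (\<kappa> x)) w)"
proof
  fix f
  show "chart_vector M (U, \<kappa>) x w f
    = chart_vector M (V, \<mu>) x (frechet_derivative (\<mu> \<circ> inv_into U \<kappa>) (at (\<kappa> x)) w) f"
  proof (cases "f \<in> Cinf M")
    case True
    have t: "(\<mu> \<circ> inv_into U \<kappa>) differentiable (at (\<kappa> x))"
      using M c d x y smooth_on_differentiable unfolding manifold_def by blast
    have f: "(f \<circ> inv_into V \<mu>) differentiable (at ((\<mu> \<circ> inv_into U \<kappa>) (\<kappa> x)))"
      using Cinf_differentiable[OF True d y] by (simp add: chart_inv[OF M c x])
    have oV: "open (\<kappa> ` (U \<inter> V))" by (rule chart_image_open[OF M c chart_open[OF M d]])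
    have "frechet_derivative (f \<circ> inv_into U \<kappa>) (at (\<kappa> x))
        = frechet_derivative ((f \<circ> inv_into V \<mu>) \<circ> (\<mu> \<circ> inv_into U \<kappa>)) (at (\<kappa> x))"
      by (rule frechet_derivative_transform_within_open[OF Cinf_differentiable[OF True c x] oV])
        (use x y in \<open>auto simp: chart_inv[OF M c] chart_inv[OF M d]\<close>)
    also have "\<dots> = frechet_derivative (f \<circ> inv_into V \<mu>) (at (\<mu> x))
        \<circ> frechet_derivative (\<mu> \<circ> inv_into U \<kappa>) (at (\<kappa> x))"
      using frechet_derivative_compose[OF t f]
      unfolding o_apply[of \<mu> "inv_into U \<kappa>" "\<kappa> x"] chart_inv[OF M c x] .
    finally show ?thesis using True by (simp add: chart_vector_apply)
  qed (simp add: chart_vector_apply)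
qed

lemma bij_chart_vector:
  assumes c: "(U, \<kappa>) \<in> M" and x: "x \<in> U"
  shows "bij_betw (chart_vector M (U, \<kappa>) x) UNIV (fib (tangent_bundle M) x)"
  unfolding bij_betw_def
proof (intro conjI inj_chart_vector assms equalityI subsetI)
  fix v assume "v \<in> fib (tangent_bundle M) x"
  then show "v \<in> range (chart_vector M (U, \<kappa>) x)"
    using chart_vector_change[OF _ _ c x] by (auto simp: tangent_bundle_def)
qed (use assms in \<open>auto simp: tangent_bundle_def\<close>)

section \<open>Tangent vectors as local derivations of smooth functions\<close>

lemma tangent_chart_vector:
  assumes "v \<in> fib (tangent_bundle M) x"
  obtains U \<kappa> w where "(U, \<kappa>) \<in> M" "x \<in> U" "v = chart_vector M (U, \<kappa>) x w"
  using assms by (auto simp: tangent_bundle_def)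

lemma tangent_outside: "v \<in> fib (tangent_bundle M) x \<Longrightarrow> f \<notin> Cinf M \<Longrightarrow> v f = 0"
  by (auto simp: tangent_bundle_def chart_vector_apply)

lemma tangent_add:
  assumes "v \<in> fib (tangent_bundle M) x" "f \<in> Cinf M" "g \<in> Cinf M"
  shows "v (\<lambda>z. f z + g z) = v f + v g"
proof -
  obtain U \<kappa> w where c: "(U, \<kappa>) \<in> M" "x \<in> U" and v: "v = chart_vector M (U, \<kappa>) x w"
    using tangent_chart_vector[OF assms(1)] .
  have "((\<lambda>z. f z + g z) \<circ> inv_into U \<kappa> has_derivative
      (\<lambda>w. frechet_derivative (f \<circ> inv_into U \<kappa>) (at (\<kappa> x)) w
        + frechet_derivative (g \<circ> inv_into U \<kappa>) (at (\<kappa> x)) w)) (at (\<kappa> x))"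
    using has_derivative_add[OF Cinf_differentiable[OF assms(2) c, unfolded frechet_derivative_works]
        Cinf_differentiable[OF assms(3) c, unfolded frechet_derivative_works]]
    by (simp add: o_def)
  from frechet_derivative_at[OF this] show ?thesis
    using assms Cinf_add[OF M assms(2,3)] unfolding v chart_vector_apply
    by (simp add: fun_eq_iff)
qed

lemma tangent_mult:
  assumes "v \<in> fib (tangent_bundle M) x" "f \<in> Cinf M" "g \<in> Cinf M"
  shows "v (\<lambda>z. f z * g z) = f x * v g + v f * g x"
proof -
  obtain U \<kappa> w where c: "(U, \<kappa>) \<in> M" "x \<in> U" and v: "v = chart_vector M (U, \<kappa>) x w"
    using tangent_chart_vector[OF assms(1)] .
  have "((\<lambda>z. f z * g z) \<circ> inv_into U \<kappa> has_derivative
      (\<lambda>w. f x * frechet_derivative (g \<circ> inv_into U \<kappa>) (at (\<kappa> x)) w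
        + frechet_derivative (f \<circ> inv_into U \<kappa>) (at (\<kappa> x)) w * g x)) (at (\<kappa> x))"
    using has_derivative_mult[OF Cinf_differentiable[OF assms(2) c, unfolded frechet_derivative_works]
        Cinf_differentiable[OF assms(3) c, unfolded frechet_derivative_works]]
    by (simp add: o_def chart_inv[OF M c])
  from frechet_derivative_at[OF this] show ?thesis
    using assms Cinf_mult[OF M assms(2,3)] unfolding v chart_vector_apply
    by (simp add: fun_eq_iff)
qed

lemma tangent_local:
  assumes v: "v \<in> fib (tangent_bundle M) x" and f: "f \<in> Cinf M" and g: "g \<in> Cinf M"
    and N: "open N" "x \<in> N" "\<And>z. z \<in> N \<Longrightarrow> f z = g z"
  shows "v f = v g"
proof -
  obtain U \<kappa> w where c: "(U, \<kappa>) \<in> M" "x \<in> U" and v: "v = chart_vector M (U, \<kappa>) x w"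
    using tangent_chart_vector[OF v] .
  have "frechet_derivative (f \<circ> inv_into U \<kappa>) (at (\<kappa> x))
      = frechet_derivative (g \<circ> inv_into U \<kappa>) (at (\<kappa> x))"
    by (rule frechet_derivative_transform_within_open[OF Cinf_differentiable[OF f c]
          chart_image_open[OF M c(1) N(1)]])
      (use N c in \<open>auto simp: chart_inv[OF M c(1)]\<close>)
  then show ?thesis using f g by (simp add: v chart_vector_apply)
qed

lemma tangent_const: "v \<in> fib (tangent_bundle M) x \<Longrightarrow> v (\<lambda>_. c) = 0"
  by (auto simp: tangent_bundle_def chart_vector_apply o_def)

lemma tangent_scale:
  "v \<in> fib (tangent_bundle M) x \<Longrightarrow> f \<in> Cinf M \<Longrightarrow> v (\<lambda>z. c * f z) = c * v f"
  using tangent_mult[of v x "\<lambda>_. c" f] by (simp add: Cinf_const tangent_const)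

lemma tangent_sum:
  assumes "v \<in> fib (tangent_bundle M) x" "\<And>i. i \<in> I \<Longrightarrow> f i \<in> Cinf M"
  shows "v (\<lambda>z. \<Sum>i\<in>I. f i z) = (\<Sum>i\<in>I. v (f i))"
  using assms(2)
  by (induction I rule: infinite_finite_induct)
    (simp_all add: tangent_const[OF assms(1)] tangent_add[OF assms(1)] Cinf_sum[OF M])

section \<open>Vector fields acting on smooth functions\<close>

lemma vector_field_in_fib: "X \<in> vector_fields M \<Longrightarrow> X x \<in> fib (tangent_bundle M) x"
  by (simp add: sections_def)

lemma vector_field_smooth_coordinates:
  "X \<in> vector_fields M \<Longrightarrow> (U, \<kappa>) \<in> M
    \<Longrightarrow> smooth_fun_on M U (\<lambda>x. inv (chart_vector M (U, \<kappa>) x) (X x))"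
  unfolding sections_def tangent_bundle_def by fastforce

text \<open>Point and direction both vary, so the direction is expanded in constant vectors. The
  target space is arbitrary in order to cover the components of bundle sections besides real
  functions.\<close>

lemma smooth_fun_on_directional_derivative:
  fixes f :: "'m \<Rightarrow> 'b::real_normed_vector"
  assumes c: "(U, \<kappa>) \<in> M" and W: "open W" "W \<subseteq> U"
    and f: "smooth_fun_on M W f" and w: "smooth_fun_on M W w"
  shows "smooth_fun_on M W (\<lambda>x. frechet_derivative (f \<circ> inv_into U \<kappa>) (at (\<kappa> x)) (w x))"
proof (rule smooth_fun_on_chart[OF M c W])
  obtain n and b :: "nat \<Rightarrow> 'n" where b: "parseval_frame n b"
    using finite_dim_parseval_frame[OF finite_dim_model[OF M]] by blast
  have oW: "open (\<kappa> ` W)"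
    using chart_image_open[OF M c W(1)] W(2) by (simp add: Int_absorb1)
  have sf: "smooth_on (\<kappa> ` W) (f \<circ> inv_into U \<kappa>)" and sw: "smooth_on (\<kappa> ` W) (w \<circ> inv_into U \<kappa>)"
    using smooth_fun_onD[OF M f c W(2)] smooth_fun_onD[OF M w c W(2)] .
  have "smooth_on (\<kappa> ` W) (\<lambda>p. ((w \<circ> inv_into U \<kappa>) p \<bullet> b i)
      *\<^sub>R frechet_derivative (f \<circ> inv_into U \<kappa>) (at p) (b i))" for i
    by (intro smooth_on_bilinear[OF oW bounded_bilinear_scaleR] smooth_on_frechet_derivative sf
        smooth_on_bounded_linear_compose[OF oW bounded_linear_inner_left] sw)
  then have "smooth_on (\<kappa> ` W) (\<lambda>p. \<Sum>i<n. ((w \<circ> inv_into U \<kappa>) p \<bullet> b i)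
      *\<^sub>R frechet_derivative (f \<circ> inv_into U \<kappa>) (at p) (b i))"
    unfolding smooth_on_def by (intro allI Ck_on_sum oW) auto
  then show "smooth_on (\<kappa> ` W)
      ((\<lambda>x. frechet_derivative (f \<circ> inv_into U \<kappa>) (at (\<kappa> x)) (w x)) \<circ> inv_into U \<kappa>)"
  proof (rule smooth_on_cong[OF oW])
    fix p assume "p \<in> \<kappa> ` W"
    then obtain x where x: "x \<in> W" "x \<in> U" "p = \<kappa> x" using W by blast
    have "linear (frechet_derivative (f \<circ> inv_into U \<kappa>) (at p))"
      using smooth_on_differentiable[OF sf \<open>p \<in> \<kappa> ` W\<close>] by (rule linear_frechet_derivative)
    from finite_dim_linear_sum[OF b this, of "w x"]
    show "(\<Sum>i<n. ((w \<circ> inv_into U \<kappa>) p \<bullet> b i)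
        *\<^sub>R frechet_derivative (f \<circ> inv_into U \<kappa>) (at p) (b i))
      = ((\<lambda>x. frechet_derivative (f \<circ> inv_into U \<kappa>) (at (\<kappa> x)) (w x)) \<circ> inv_into U \<kappa>) p"
      by (simp add: x chart_inv[OF M c])
  qed
qed

lemma vector_field_apply_Cinf:
  assumes X: "X \<in> vector_fields M" and h: "h \<in> Cinf M"
  shows "(\<lambda>x. X x h) \<in> Cinf M"
  unfolding Cinf_def mem_Collect_eq
proof (rule smooth_fun_on_local[OF M])
  fix x
  obtain U \<kappa> where c: "(U, \<kappa>) \<in> M" and x: "x \<in> U" by (rule chart_at[OF M])
  have oU: "open U" using chart_open[OF M c] .
  have "smooth_fun_on M U (\<lambda>z. frechet_derivative (h \<circ> inv_into U \<kappa>) (at (\<kappa> z))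
      (inv (chart_vector M (U, \<kappa>) z) (X z)))"
    by (intro smooth_fun_on_directional_derivative c oU order_refl CinfD h
        vector_field_smooth_coordinates X)
  then have "smooth_fun_on M U (\<lambda>z. X z h)"
  proof (rule smooth_fun_on_cong[OF M oU])
    fix z assume "z \<in> U"
    then have "chart_vector M (U, \<kappa>) z (inv (chart_vector M (U, \<kappa>) z) (X z)) = X z"
      using bij_chart_vector[OF c] vector_field_in_fib[OF X, of z]
      by (simp add: bij_betw_def f_inv_into_f)
    then show "frechet_derivative (h \<circ> inv_into U \<kappa>) (at (\<kappa> z))
      (inv (chart_vector M (U, \<kappa>) z) (X z)) = X z h"
      using h chart_vector_apply[of M U \<kappa> z "inv (chart_vector M (U, \<kappa>) z) (X z)" h] by simp
  qed
  then show "\<exists>N. open N \<and> x \<in> N \<and> smooth_fun_on M N (\<lambda>x. X x h)"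
    using oU x by blast
qed

end


section \<open>Sections of vector bundles\<close>

lemma sum_fun_apply: "(\<Sum>i\<in>I. f i) x = (\<Sum>i\<in>I. f i x)"
  by (induction I rule: infinite_finite_induct) auto

lemma scaleR_fun_apply: "(c *\<^sub>R f) x = c *\<^sub>R f x"
  by (simp add: scaleR_fun_def)

lemma linear_bij_betw_inv:
  assumes "linear f" "bij_betw f UNIV S"
  shows "inv f (f w) = w"
    and "u \<in> S \<Longrightarrow> f (inv f u) = u"
    and "u \<in> S \<Longrightarrow> v \<in> S \<Longrightarrow> inv f (u + v) = inv f u + inv f v"
    and "u \<in> S \<Longrightarrow> inv f (c *\<^sub>R u) = c *\<^sub>R inv f u"
    and "inv f 0 = 0"
proof -
  have inj: "inv f (f w) = w" for w
    using assms(2) by (simp add: bij_betw_def inv_f_f)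
  have surj: "f (inv f u) = u" if "u \<in> S" for u
    using assms(2) that by (simp add: bij_betw_def f_inv_into_f)
  show "inv f (f w) = w" "u \<in> S \<Longrightarrow> f (inv f u) = u" by (fact inj, fact surj)
  show "inv f (u + v) = inv f u + inv f v" if "u \<in> S" "v \<in> S"
    using inj[of "inv f u + inv f v"] surj that by (simp add: linear_add[OF assms(1)])
  show "inv f (c *\<^sub>R u) = c *\<^sub>R inv f u" if "u \<in> S"
    using inj[of "c *\<^sub>R inv f u"] surj that by (simp add: linear_cmul[OF assms(1)])
  show "inv f 0 = 0"
    using inj[of 0] by (simp add: linear_0[OF assms(1)])
qed

lemma sectionsI:
  "(\<And>x. s x \<in> fib E x)
    \<Longrightarrow> (\<And>U \<tau>. (U, \<tau>) \<in> triv E \<Longrightarrow> smooth_fun_on M U (\<lambda>x. inv (\<tau> x) (s x)))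
    \<Longrightarrow> s \<in> sections M E"
  by (auto simp: sections_def)

lemma section_in_fib: "s \<in> sections M E \<Longrightarrow> s x \<in> fib E x"
  by (simp add: sections_def)

lemma section_smooth:
  "s \<in> sections M E \<Longrightarrow> (U, \<tau>) \<in> triv E \<Longrightarrow> smooth_fun_on M U (\<lambda>x. inv (\<tau> x) (s x))"
  by (auto simp: sections_def)

text \<open>Covers tensorial maps, derivations at \<open>x\<close>, and \<open>X \<mapsto> [Y, X](x)\<close>: in all three cases
  the Leibniz term vanishes together with \<open>X x\<close>.\<close>

definition point_operator ::
  "('m, 'n::real_normed_vector) atlas
     \<Rightarrow> ('m, 'k::real_normed_vector, 'v::real_vector, 'z) vbundle_scheme
     \<Rightarrow> 'm \<Rightarrow> (('m \<Rightarrow> 'v) \<Rightarrow> 'w::real_vector) \<Rightarrow> bool" where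
  "point_operator M E x d \<longleftrightarrow>
     (\<forall>X\<in>sections M E. \<forall>Y\<in>sections M E. d (X + Y) = d X + d Y)
     \<and> (\<forall>f\<in>Cinf M. \<forall>X\<in>sections M E. X x = 0 \<longrightarrow> d (\<lambda>z. f z *\<^sub>R X z) = f x *\<^sub>R d X)"

section \<open>Global sections and local frames of a vector bundle\<close>

context
  fixes M :: "('m::{t2_space,second_countable_topology}, 'n::real_inner) atlas"
    and E :: "('m, 'k::real_inner, 'v::real_vector, 'z) vbundle_scheme"
  assumes M: "manifold M" and E: "vector_bundle M E"
begin

lemma finite_dim_fibre: "finite_dim TYPE('k)"
  using E by (simp add: vector_bundle_def)

lemma triv_at: obtains U \<tau> where "(U, \<tau>) \<in> triv E" "x \<in> U"
proof -
  have "x \<in> (\<Union>(U, \<tau>)\<in>triv E. U)"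
    using E unfolding vector_bundle_def by simp
  then show thesis using that by auto
qed

lemma triv_open: "(U, \<tau>) \<in> triv E \<Longrightarrow> open U"
  using E unfolding vector_bundle_def by blast

lemma triv_linear: "(U, \<tau>) \<in> triv E \<Longrightarrow> x \<in> U \<Longrightarrow> linear (\<tau> x)"
  using E unfolding vector_bundle_def by blast

lemma triv_bij: "(U, \<tau>) \<in> triv E \<Longrightarrow> x \<in> U \<Longrightarrow> bij_betw (\<tau> x) UNIV (fib E x)"
  using E unfolding vector_bundle_def by blast

lemma triv_in_fib: "(U, \<tau>) \<in> triv E \<Longrightarrow> x \<in> U \<Longrightarrow> \<tau> x w \<in> fib E x"
  using triv_bij bij_betwE by blast

lemma triv_inv:
  assumes "(U, \<tau>) \<in> triv E" "x \<in> U"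
  shows "inv (\<tau> x) (\<tau> x w) = w"
    and "u \<in> fib E x \<Longrightarrow> \<tau> x (inv (\<tau> x) u) = u"
    and "u \<in> fib E x \<Longrightarrow> v \<in> fib E x \<Longrightarrow> inv (\<tau> x) (u + v) = inv (\<tau> x) u + inv (\<tau> x) v"
    and "u \<in> fib E x \<Longrightarrow> inv (\<tau> x) (c *\<^sub>R u) = c *\<^sub>R inv (\<tau> x) u"
    and "inv (\<tau> x) 0 = 0"
  using linear_bij_betw_inv[OF triv_linear[OF assms] triv_bij[OF assms]] by blast+

lemma fib_subspace: "subspace (fib E x)"
  using E by (simp add: vector_bundle_def)

lemma fib_0: "0 \<in> fib E x"
  using fib_subspace by (rule subspace_0)

lemma fib_scale: "u \<in> fib E x \<Longrightarrow> c *\<^sub>R u \<in> fib E x"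
  using fib_subspace by (rule subspace_scale)

lemma fib_add: "u \<in> fib E x \<Longrightarrow> v \<in> fib E x \<Longrightarrow> u + v \<in> fib E x"
  using fib_subspace by (rule subspace_add)

lemma transition_smooth:
  "(U, \<tau>) \<in> triv E \<Longrightarrow> (V, \<sigma>) \<in> triv E \<Longrightarrow> smooth_fun_on M (U \<inter> V) (\<lambda>x. inv (\<sigma> x) (\<tau> x w))"
  using E unfolding vector_bundle_def by blast

lemma section_add:
  assumes "s \<in> sections M E" "t \<in> sections M E"
  shows "s + t \<in> sections M E"
proof (rule sectionsI)
  show "(s + t) x \<in> fib E x" for x
    using assms by (simp add: fib_add section_in_fib[of _ M E])
  fix U \<tau> assume c: "(U, \<tau>) \<in> triv E"
  show "smooth_fun_on M U (\<lambda>x. inv (\<tau> x) ((s + t) x))"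
    by (rule smooth_fun_on_cong[OF M triv_open[OF c] smooth_fun_on_add[OF M triv_open[OF c]
            section_smooth[OF assms(1) c] section_smooth[OF assms(2) c]]])
      (simp add: triv_inv(3)[OF c] section_in_fib[of _ M E] assms)
qed

lemma section_mult:
  assumes "f \<in> Cinf M" "s \<in> sections M E"
  shows "(\<lambda>x. f x *\<^sub>R s x) \<in> sections M E"
proof (rule sectionsI)
  show "f x *\<^sub>R s x \<in> fib E x" for x
    using assms by (simp add: fib_scale section_in_fib[of _ M E])
  fix U \<tau> assume c: "(U, \<tau>) \<in> triv E"
  show "smooth_fun_on M U (\<lambda>x. inv (\<tau> x) (f x *\<^sub>R s x))"
    by (rule smooth_fun_on_cong[OF M triv_open[OF c] smooth_fun_on_scaleR[OF M triv_open[OF c]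
            CinfD[OF assms(1)] section_smooth[OF assms(2) c]]])
      (simp add: triv_inv(4)[OF c] section_in_fib[of _ M E] assms)
qed

lemma section_scale: "s \<in> sections M E \<Longrightarrow> c *\<^sub>R s \<in> sections M E"
  using section_mult[OF Cinf_const] by (simp add: scaleR_fun_def)

lemma section_0: "0 \<in> sections M E"
proof (rule sectionsI)
  fix U \<tau> assume c: "(U, \<tau>) \<in> triv E"
  show "smooth_fun_on M U (\<lambda>x. inv (\<tau> x) (0 x))"
    by (rule smooth_fun_on_cong[OF M triv_open[OF c] smooth_fun_on_const[of M U 0]])
      (simp add: triv_inv(5)[OF c])
qed (simp add: fib_0)

lemma section_sum: "(\<And>i. i \<in> I \<Longrightarrow> s i \<in> sections M E) \<Longrightarrow> (\<Sum>i\<in>I. s i) \<in> sections M E"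
  by (induction I rule: infinite_finite_induct) (auto intro: section_0 section_add)

lemma section_minus: "s \<in> sections M E \<Longrightarrow> - s \<in> sections M E"
  using section_scale[of s "-1"] by simp

text \<open>The bump function that cuts off the frame does not depend on \<open>w\<close>. Hence one
  neighbourhood \<open>N\<close> serves all \<open>w\<close>, and a whole frame can be chosen at
  once.\<close>

lemma local_frame_section:
  assumes c: "(U, \<tau>) \<in> triv E" and "x \<in> U"
  obtains N where "open N" "x \<in> N" "N \<subseteq> U"
    "\<forall>w. \<exists>X\<in>sections M E. \<forall>z\<in>N. X z = \<tau> z w"
proof -
  note oU = triv_open[OF c]
  obtain \<beta> N C where \<beta>: "\<beta> \<in> Cinf M" "open N" "x \<in> N" "N \<subseteq> C" "closed C" "C \<subseteq> U"
    "\<And>z. z \<in> N \<Longrightarrow> \<beta> z = 1" "\<And>z. z \<notin> C \<Longrightarrow> \<beta> z = 0"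
    using bump_function[OF M oU assms(2)] by blast
  have "(\<lambda>z. if z \<in> U then \<beta> z *\<^sub>R \<tau> z w else 0) \<in> sections M E" for w
  proof (rule sectionsI)
    show "(if z \<in> U then \<beta> z *\<^sub>R \<tau> z w else 0) \<in> fib E z" for z
      using triv_in_fib[OF c] fib_0 fib_scale by simp
    fix V \<sigma> assume d: "(V, \<sigma>) \<in> triv E"
    show "smooth_fun_on M V (\<lambda>z. inv (\<sigma> z) (if z \<in> U then \<beta> z *\<^sub>R \<tau> z w else 0))"
      by (rule smooth_fun_on_cong[OF M triv_open[OF d] smooth_fun_on_extend[OF M oU triv_open[OF d]
              \<beta>(1,5,6,8) transition_smooth[OF c d, of w]]])
        (auto simp: triv_inv(4)[OF d] triv_inv(5)[OF d] triv_in_fib[OF c])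
  qed
  then have "\<exists>X\<in>sections M E. \<forall>z\<in>N. X z = \<tau> z w" for w
    by (rule bexI[rotated]) (use \<beta> in auto)
  then show thesis using \<beta> by (intro that[of N]) auto
qed

text \<open>It lets fibrewise statements be proved on values of global sections, the objects on
  which brackets, actions and derivative representations are defined.\<close>

lemma section_through:
  assumes "u \<in> fib E x"
  obtains X where "X \<in> sections M E" "X x = u"
proof -
  obtain U \<tau> where c: "(U, \<tau>) \<in> triv E" and x: "x \<in> U" by (rule triv_at)
  obtain N where "open N" "x \<in> N" "N \<subseteq> U" "\<forall>w. \<exists>X\<in>sections M E. \<forall>z\<in>N. X z = \<tau> z w"
    by (rule local_frame_section[OF c x])
  then obtain X where "X \<in> sections M E" "X x = \<tau> x (inv (\<tau> x) u)" by blast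
  then show thesis using that triv_inv(2)[OF c x assms] by simp
qed

text \<open>\<open>c i\<close> are coordinate functionals of the frame \<open>e i\<close>, cut off by a bump function so that
  they are globally defined.\<close>

lemma local_coframe:
  fixes F :: "('f::{t2_space,second_countable_topology}, 'q::real_inner) atlas"
  assumes F: "manifold F" and \<phi>: "smooth_map F M \<phi>"
  obtains n N and c :: "nat \<Rightarrow> 'm \<Rightarrow> 'v \<Rightarrow> real" and e where
    "open N" "x \<in> N" "\<forall>i. e i \<in> sections M E"
    "\<forall>i z. \<forall>u\<in>fib E z. \<forall>v\<in>fib E z. c i z (u + v) = c i z u + c i z v"
    "\<forall>i z r. \<forall>u\<in>fib E z. c i z (r *\<^sub>R u) = r * c i z u"
    "\<forall>z\<in>N. \<forall>u\<in>fib E z. (\<Sum>i<n. c i z u *\<^sub>R e i z) = u"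
    "\<forall>i. \<forall>s\<in>sections F (pullback_bundle \<phi> E). (\<lambda>y. c i (\<phi> y) (s y)) \<in> Cinf F"
proof -
  obtain U \<tau> where t: "(U, \<tau>) \<in> triv E" and x: "x \<in> U" by (rule triv_at)
  obtain N where N: "open N" "x \<in> N" "N \<subseteq> U" "\<forall>w. \<exists>X\<in>sections M E. \<forall>z\<in>N. X z = \<tau> z w"
    by (rule local_frame_section[OF t x])
  obtain n and b :: "nat \<Rightarrow> 'k" where b: "parseval_frame n b"
    using finite_dim_parseval_frame[OF finite_dim_fibre] by blast
  obtain X where X: "\<And>w. X w \<in> sections M E \<and> (\<forall>z\<in>N. X w z = \<tau> z w)"
    using choice[OF N(4)[unfolded Bex_def]] by blast
  define e where "e i = X (b i)" for i
  have e: "\<And>i. e i \<in> sections M E" "\<And>i z. z \<in> N \<Longrightarrow> e i z = \<tau> z (b i)"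
    using X by (simp_all add: e_def)
  obtain \<beta> L C where \<beta>: "\<beta> \<in> Cinf M" "open L" "x \<in> L" "L \<subseteq> C" "closed C" "C \<subseteq> U"
    "\<And>z. z \<in> L \<Longrightarrow> \<beta> z = 1" "\<And>z. z \<notin> C \<Longrightarrow> \<beta> z = 0"
    using bump_function[OF M triv_open[OF t] x] by blast
  define c where "c i z u = (if z \<in> U then \<beta> z *\<^sub>R (inv (\<tau> z) u \<bullet> b i) else 0)" for i z u
  have cont: "continuous_on UNIV \<phi>" using \<phi> by (simp add: smooth_map_def)
  have "(\<lambda>y. c i (\<phi> y) (s y)) \<in> Cinf F" if s: "s \<in> sections F (pullback_bundle \<phi> E)" for i s
  proof -
    have oU: "open (\<phi> -` U)" using cont triv_open[OF t] by (rule open_vimage[rotated])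
    have "(\<phi> -` U, \<lambda>y. \<tau> (\<phi> y)) \<in> triv (pullback_bundle \<phi> E)"
      using t by (force simp: pullback_bundle_def)
    from section_smooth[OF s this]
    have "smooth_fun_on F (\<phi> -` U) (\<lambda>y. inv (\<tau> (\<phi> y)) (s y))" .
    then have "smooth_fun_on F (\<phi> -` U) (\<lambda>y. inv (\<tau> (\<phi> y)) (s y) \<bullet> b i)"
      by (rule smooth_fun_on_inner_left[OF F oU])
    moreover have "(\<lambda>y. \<beta> (\<phi> y)) \<in> Cinf F"
      using smooth_map_compose[OF F M \<phi> open_UNIV] \<beta>(1) by (simp add: Cinf_def)
    moreover have "closed (\<phi> -` C)" using cont \<beta>(5) by (rule closed_vimage[rotated])
    ultimately have "smooth_fun_on F UNIV
        (\<lambda>y. if y \<in> \<phi> -` U then \<beta> (\<phi> y) *\<^sub>R (inv (\<tau> (\<phi> y)) (s y) \<bullet> b i) else 0)"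
      using \<beta>(6,8) oU by (intro smooth_fun_on_extend[OF F _ open_UNIV]) auto
    then show ?thesis by (simp add: Cinf_def c_def)
  qed
  \<comment> \<open>The sections \<open>e i\<close> are known to be the frame on \<open>N\<close>,
    and the cut-off is known to be 1 on \<open>L\<close>; the expansion is therefore claimed on the
    intersection.\<close>
  moreover have "(\<Sum>i<n. c i z u *\<^sub>R e i z) = u" if "z \<in> L \<inter> N" "u \<in> fib E z" for z u
  proof -
    have z: "z \<in> U" using that N by blast
    have "(\<Sum>i<n. c i z u *\<^sub>R e i z) = (\<Sum>i<n. (inv (\<tau> z) u \<bullet> b i) *\<^sub>R \<tau> z (b i))"
      using that z \<beta>(7) e(2) by (simp add: c_def)
    also have "\<dots> = \<tau> z (inv (\<tau> z) u)"
      by (rule finite_dim_linear_sum[OF b triv_linear[OF t z], symmetric])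
    also have "\<dots> = u" using triv_inv(2)[OF t z that(2)] .
    finally show ?thesis .
  qed
  moreover have "c i z (u + v) = c i z u + c i z v" if "u \<in> fib E z" "v \<in> fib E z" for i z u v
    using that by (simp add: c_def triv_inv(3)[OF t] inner_add_left distrib_left)
  moreover have "c i z (r *\<^sub>R u) = r * c i z u" if "u \<in> fib E z" for i z r u
    using that by (simp add: c_def triv_inv(4)[OF t])
  ultimately show thesis
    using N(1,2) \<beta>(2,3) e(1) by (intro that[of "L \<inter> N" e c n]) (simp_all add: open_Int)
qed

text \<open>\<open>local_coframe\<close> speaks of a pullback bundle; along the identity map it
  yields smooth coefficient functions for sections of \<open>E\<close> itself.\<close>

lemma smooth_map_id: "smooth_map M M (\<lambda>x. x)"
  using M unfolding smooth_map_def manifold_def smooth_fun_on_def by (auto simp: o_def)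

lemma pullback_id:
  "fib (pullback_bundle (\<lambda>x. x) E) = fib E"
  "triv (pullback_bundle (\<lambda>x. x) E) = triv E"
  by (auto simp: pullback_bundle_def)

lemma sections_pullback_id: "sections M (pullback_bundle (\<lambda>x. x) E) = sections M E"
  by (simp add: sections_def pullback_id)

section \<open>Operators on sections that depend only on the germ at a point\<close>

context
  fixes x :: 'm and d :: "('m \<Rightarrow> 'v) \<Rightarrow> 'w::real_vector"
  assumes d: "point_operator M E x d"
begin

lemma point_operator_add:
  "X \<in> sections M E \<Longrightarrow> Y \<in> sections M E \<Longrightarrow> d (X + Y) = d X + d Y"
  using d by (simp add: point_operator_def)

lemma point_operator_mult:
  "f \<in> Cinf M \<Longrightarrow> X \<in> sections M E \<Longrightarrow> X x = 0 \<Longrightarrow> d (\<lambda>z. f z *\<^sub>R X z) = f x *\<^sub>R d X"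
  using d by (simp add: point_operator_def)

lemma point_operator_0: "d 0 = 0"
  using point_operator_add[OF section_0 section_0] by simp

lemma point_operator_diff:
  assumes "X \<in> sections M E" "Y \<in> sections M E"
  shows "d (X - Y) = d X - d Y"
proof -
  have "d (X - Y) + d Y = d (X - Y + Y)"
    using assms section_add section_minus
    by (subst point_operator_add) (simp_all add: diff_conv_add_uminus del: add_uminus_conv_diff)
  then show ?thesis by (simp add: algebra_simps)
qed

lemma point_operator_sum:
  "(\<And>i. i \<in> I \<Longrightarrow> X i \<in> sections M E) \<Longrightarrow> d (\<Sum>i\<in>I. X i) = (\<Sum>i\<in>I. d (X i))"
  by (induction I rule: infinite_finite_induct)
    (simp_all add: point_operator_0 point_operator_add section_sum)

text \<open>A bump function supported where the two sections agree kills \<open>X - Y\<close>. Since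
  \<open>X - Y\<close> vanishes at \<open>x\<close>, the bump function can be pulled out of
  \<open>d\<close>, and its value at \<open>x\<close> is 1.\<close>

lemma point_operator_local:
  assumes X: "X \<in> sections M E" and Y: "Y \<in> sections M E"
    and N: "open N" "x \<in> N" "\<And>z. z \<in> N \<Longrightarrow> X z = Y z"
  shows "d X = d Y"
proof -
  obtain \<beta> L C where \<beta>: "\<beta> \<in> Cinf M" "x \<in> L" "C \<subseteq> N"
    "\<And>z. z \<in> L \<Longrightarrow> \<beta> z = 1" "\<And>z. z \<notin> C \<Longrightarrow> \<beta> z = 0"
    using bump_function[OF M N(1,2)] by metis
  have S: "X - Y \<in> sections M E"
    using section_add[OF X section_minus[OF Y]] by simp
  have "(\<lambda>z. \<beta> z *\<^sub>R (X - Y) z) = 0"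
    using \<beta> N by (auto simp: fun_eq_iff)
  moreover have "d (\<lambda>z. \<beta> z *\<^sub>R (X - Y) z) = \<beta> x *\<^sub>R d (X - Y)"
    by (rule point_operator_mult[OF \<beta>(1) S]) (use N in simp)
  ultimately show ?thesis
    using \<beta> point_operator_0 point_operator_diff[OF X Y] by simp
qed

text \<open>The difference \<open>Z\<close> vanishes at \<open>x\<close>. Near \<open>x\<close> it
  is a combination of frame sections with coefficients that vanish at \<open>x\<close>, and
  tensoriality pulls these out of \<open>d\<close>. Locality is used first because the expansion
  holds near \<open>x\<close> only.\<close>

lemma point_operator_tensorial:
  assumes t: "\<And>f X. f \<in> Cinf M \<Longrightarrow> X \<in> sections M E \<Longrightarrow> d (\<lambda>z. f z *\<^sub>R X z) = f x *\<^sub>R d X"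
    and X: "X \<in> sections M E" and Y: "Y \<in> sections M E" and "X x = Y x"
  shows "d X = d Y"
proof -
  define Z where "Z = X - Y"
  have Z: "Z \<in> sections M E" "Z x = 0"
    using section_add[OF X section_minus[OF Y]] assms(4) by (simp_all add: Z_def)
  obtain n N and c :: "nat \<Rightarrow> 'm \<Rightarrow> 'v \<Rightarrow> real" and e where
    "open N" "x \<in> N" "\<forall>i. e i \<in> sections M E"
    "\<forall>i z r. \<forall>u\<in>fib E z. c i z (r *\<^sub>R u) = r * c i z u"
    "\<forall>z\<in>N. \<forall>u\<in>fib E z. (\<Sum>i<n. c i z u *\<^sub>R e i z) = u"
    "\<forall>i. \<forall>s\<in>sections M E. (\<lambda>y. c i y (s y)) \<in> Cinf M"
    by (rule local_coframe[OF M smooth_map_id, unfolded sections_pullback_id, of x])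
  note c = this[rule_format]
  have ce: "(\<lambda>z. c i z (Z z) *\<^sub>R e i z) \<in> sections M E" for i
    by (intro section_mult c Z)
  have "d Z = d (\<Sum>i<n. (\<lambda>z. c i z (Z z) *\<^sub>R e i z))"
    by (rule point_operator_local[OF Z(1) section_sum[OF ce] c(1,2)])
      (simp add: sum_fun_apply c(5) section_in_fib[OF Z(1)])
  also have "\<dots> = (\<Sum>i<n. c i x (Z x) *\<^sub>R d (e i))"
    by (simp add: point_operator_sum[OF ce] t c Z(1))
  also have "\<dots> = 0"
    using c(4)[OF fib_0, of _ x 0] by (simp add: Z(2))
  finally show ?thesis using point_operator_diff[OF X Y] by (simp add: Z_def)
qed

end

text \<open>The target need not be a vector bundle: this way the transition functions of
  \<open>deriv_algebroid\<close> never have to be shown smooth.\<close>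

lemma bundle_morphism_section:
  fixes B :: "('m, 'l::real_normed_vector, 'w::real_vector, 'y) vbundle_scheme"
  assumes R: "bundle_morphism M E B R"
    and B: "\<And>V \<sigma>. (V, \<sigma>) \<in> triv B \<Longrightarrow> open V"
      "\<And>V \<sigma> x. (V, \<sigma>) \<in> triv B \<Longrightarrow> x \<in> V \<Longrightarrow> linear (\<sigma> x)"
      "\<And>V \<sigma> x. (V, \<sigma>) \<in> triv B \<Longrightarrow> x \<in> V \<Longrightarrow> bij_betw (\<sigma> x) UNIV (fib B x)"
    and s: "s \<in> sections M E"
  shows "(\<lambda>x. R x (s x)) \<in> sections M B"
proof -
  have Rfib: "\<And>x u. u \<in> fib E x \<Longrightarrow> R x u \<in> fib B x"
    and Radd: "\<And>x u v. u \<in> fib E x \<Longrightarrow> v \<in> fib E x \<Longrightarrow> R x (u + v) = R x u + R x v"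
    and Rscale: "\<And>x u c. u \<in> fib E x \<Longrightarrow> R x (c *\<^sub>R u) = c *\<^sub>R R x u"
    and Rsmooth: "\<And>U \<tau> V \<sigma> w. (U, \<tau>) \<in> triv E \<Longrightarrow> (V, \<sigma>) \<in> triv B
      \<Longrightarrow> smooth_fun_on M (U \<inter> V) (\<lambda>x. inv (\<sigma> x) (R x (\<tau> x w)))"
    using R unfolding bundle_morphism_def by blast+
  obtain n and b :: "nat \<Rightarrow> 'k" where b: "parseval_frame n b"
    using finite_dim_parseval_frame[OF finite_dim_fibre] by blast
  have "smooth_fun_on M V (\<lambda>x. inv (\<sigma> x) (R x (s x)))" if d: "(V, \<sigma>) \<in> triv B" for V \<sigma>
  proof (rule smooth_fun_on_local[OF M])
    fix x assume "x \<in> V"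
    obtain U \<tau> where t: "(U, \<tau>) \<in> triv E" and x: "x \<in> U" by (rule triv_at)
    have oUV: "open (U \<inter> V)" using triv_open[OF t] B(1)[OF d] by blast
    \<comment> \<open>A bundle morphism is known to be smooth on frame vectors with constant
      coordinates, so \<open>s\<close> is expanded in the vectors \<open>b i\<close> of the model
      fibre.\<close>
    have "smooth_fun_on M (U \<inter> V)
        (\<lambda>z. \<Sum>i<n. (inv (\<tau> z) (s z) \<bullet> b i) *\<^sub>R inv (\<sigma> z) (R z (\<tau> z (b i))))"
      by (intro smooth_fun_on_sum[OF M oUV] smooth_fun_on_scaleR[OF M oUV] Rsmooth[OF t d]
          smooth_fun_on_inner_left[OF M oUV]
          smooth_fun_on_subset[OF section_smooth[OF s t] Int_lower1])
    then have "smooth_fun_on M (U \<inter> V) (\<lambda>z. inv (\<sigma> z) (R z (s z)))"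
    proof (rule smooth_fun_on_cong[OF M oUV])
      fix z assume z: "z \<in> U \<inter> V"
      then have zU: "z \<in> U" and zV: "z \<in> V" by auto
      note inv = linear_bij_betw_inv[OF B(2)[OF d zV] B(3)[OF d zV]]
      have lin: "linear (\<lambda>w. inv (\<sigma> z) (R z (\<tau> z w)))"
        by (rule linearI)
          (simp_all add: linear_add[OF triv_linear[OF t zU]] linear_cmul[OF triv_linear[OF t zU]]
            Radd Rscale triv_in_fib[OF t zU] inv Rfib)
      show "(\<Sum>i<n. (inv (\<tau> z) (s z) \<bullet> b i) *\<^sub>R inv (\<sigma> z) (R z (\<tau> z (b i))))
          = inv (\<sigma> z) (R z (s z))"
        using finite_dim_linear_sum[OF b lin, of "inv (\<tau> z) (s z)"]
          triv_inv(2)[OF t zU section_in_fib[OF s]] by simp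
    qed
    then show "\<exists>N. open N \<and> x \<in> N \<and> smooth_fun_on M N (\<lambda>x. inv (\<sigma> x) (R x (s x)))"
      using oUV x \<open>x \<in> V\<close> by blast
  qed
  then show ?thesis
    using Rfib section_in_fib[OF s] by (auto simp: sections_def)
qed

end

section \<open>Pullback of a vector bundle along a smooth map\<close>

context
  fixes M :: "('m::{t2_space,second_countable_topology}, 'p::real_inner) atlas"
    and A :: "('m, 'k::real_inner, 'v::real_vector, 'z) vbundle_scheme"
    and F :: "('f::{t2_space,second_countable_topology}, 'n::real_inner) atlas"
    and \<phi> :: "'f \<Rightarrow> 'm"
  assumes M: "manifold M" and A: "vector_bundle M A" and F: "manifold F"
    and \<phi>: "smooth_map F M \<phi>"
begin

lemma vimage_open: "open U \<Longrightarrow> open (\<phi> -` U)"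
  using \<phi> by (auto simp: smooth_map_def intro: open_vimage)

lemma Cinf_compose: "f \<in> Cinf M \<Longrightarrow> (\<lambda>y. f (\<phi> y)) \<in> Cinf F"
  using smooth_map_compose[OF F M \<phi> open_UNIV] by (simp add: Cinf_def)

lemma pullback_vector_bundle: "vector_bundle F (pullback_bundle \<phi> A)"
  unfolding vector_bundle_def
proof (intro conjI)
  show "finite_dim TYPE('k)" by (rule finite_dim_fibre[OF M A])
  show "\<forall>x. subspace (fib (pullback_bundle \<phi> A) x)"
    by (simp add: pullback_bundle_def fib_subspace[OF M A])
  show "(\<Union>(U, \<tau>)\<in>triv (pullback_bundle \<phi> A). U) = UNIV"
  proof (intro equalityI subset_UNIV subsetI)
    fix y
    obtain U \<tau> where "(U, \<tau>) \<in> triv A" "\<phi> y \<in> U" by (rule triv_at[OF M A])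
    then show "y \<in> (\<Union>(U, \<tau>)\<in>triv (pullback_bundle \<phi> A). U)"
      by (force simp: pullback_bundle_def)
  qed
  show "\<forall>(U, \<tau>)\<in>triv (pullback_bundle \<phi> A). open U
      \<and> (\<forall>x\<in>U. linear (\<tau> x) \<and> bij_betw (\<tau> x) UNIV (fib (pullback_bundle \<phi> A) x))"
    by (auto simp: pullback_bundle_def vimage_open triv_open[OF M A] triv_linear[OF M A]
        triv_bij[OF M A])
  show "\<forall>(U, \<tau>)\<in>triv (pullback_bundle \<phi> A). \<forall>(V, \<sigma>)\<in>triv (pullback_bundle \<phi> A). \<forall>w.
      smooth_fun_on F (U \<inter> V) (\<lambda>x. inv (\<sigma> x) (\<tau> x w))"
  proof (clarsimp simp: pullback_bundle_def)
    fix U \<tau> V \<sigma> w assume t: "(U, \<tau>) \<in> triv A" and d: "(V, \<sigma>) \<in> triv A"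
    have "smooth_fun_on F (\<phi> -` (U \<inter> V)) (\<lambda>x. inv (\<sigma> (\<phi> x)) (\<tau> (\<phi> x) w))"
      by (rule smooth_map_compose[OF F M \<phi> _ transition_smooth[OF M A t d]])
        (intro open_Int triv_open[OF M A t] triv_open[OF M A d])
    then show "smooth_fun_on F (\<phi> -` U \<inter> \<phi> -` V) (\<lambda>x. inv (\<sigma> (\<phi> x)) (\<tau> (\<phi> x) w))"
      by simp
  qed
qed

lemma pullback_section:
  assumes X: "X \<in> sections M A"
  shows "(\<lambda>y. X (\<phi> y)) \<in> sections F (pullback_bundle \<phi> A)"
proof -
  have "smooth_fun_on F (\<phi> -` U) (\<lambda>y. inv (\<tau> (\<phi> y)) (X (\<phi> y)))" if t: "(U, \<tau>) \<in> triv A" for U \<tau>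
    by (rule smooth_map_compose[OF F M \<phi> triv_open[OF M A t] section_smooth[OF X t]])
  then show ?thesis
    using section_in_fib[OF X] by (auto simp: sections_def pullback_bundle_def)
qed

end


section \<open>The bundle of derivative endomorphisms\<close>

context
  fixes F :: "('f::{t2_space,second_countable_topology}, 'n::real_inner) atlas"
    and E :: "('f, 'l::real_inner, 'e::real_vector, 'z) vbundle_scheme"
  assumes F: "manifold F" and E: "vector_bundle F E"
begin

lemma deriv_fibD:
  assumes "D \<in> deriv_fib F E y"
  shows "snd D \<in> fib (tangent_bundle F) y"
    and "\<psi> \<in> sections F E \<Longrightarrow> fst D \<psi> \<in> fib E y"
    and "\<psi> \<in> sections F E \<Longrightarrow> \<eta> \<in> sections F E \<Longrightarrow> fst D (\<psi> + \<eta>) = fst D \<psi> + fst D \<eta>"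
    and "\<psi> \<in> sections F E \<Longrightarrow> fst D (c *\<^sub>R \<psi>) = c *\<^sub>R fst D \<psi>"
    and "h \<in> Cinf F \<Longrightarrow> \<psi> \<in> sections F E
      \<Longrightarrow> fst D (\<lambda>z. h z *\<^sub>R \<psi> z) = h y *\<^sub>R fst D \<psi> + snd D h *\<^sub>R \<psi> y"
    and "\<psi> \<notin> sections F E \<Longrightarrow> fst D \<psi> = 0"
  using assms by (auto simp: deriv_fib_def)

lemma deriv_fib_point_operator:
  "D \<in> deriv_fib F E y \<Longrightarrow> point_operator F E y (fst D)"
  by (simp add: point_operator_def deriv_fibD)

text \<open>The symbols are compared separately: on a bundle of rank 0 the operators do not
  determine them. Arguments that are not sections are settled by the normalization to 0.\<close>

lemma deriv_fib_eqI:
  assumes "D \<in> deriv_fib F E y" "D' \<in> deriv_fib F E y" "snd D = snd D'"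
    and "\<And>\<psi>. \<psi> \<in> sections F E \<Longrightarrow> fst D \<psi> = fst D' \<psi>"
  shows "D = D'"
  using assms deriv_fibD(6) by (metis ext prod.expand)

section \<open>Coordinates of derivations in a chart and a trivialization\<close>

context
  fixes U \<kappa> V \<tau>
  assumes c: "(U, \<kappa>) \<in> F" and t: "(V, \<tau>) \<in> triv E"
begin

lemma snd_deriv_triv: "snd (deriv_triv F E (U, \<kappa>) (V, \<tau>) y q) = chart_vector F (U, \<kappa>) y (fst q)"
  by (simp add: deriv_triv_def case_prod_beta)

lemma fst_deriv_triv: "\<psi> \<in> sections F E \<Longrightarrow> fst (deriv_triv F E (U, \<kappa>) (V, \<tau>) y q) \<psi>
  = \<tau> y (frechet_derivative ((\<lambda>z. inv (\<tau> z) (\<psi> z)) \<circ> inv_into U \<kappa>) (at (\<kappa> y)) (fst q)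
      + blinfun_apply (snd q) (inv (\<tau> y) (\<psi> y)))"
  by (simp add: deriv_triv_def case_prod_beta)

lemma fst_deriv_triv_outside:
  "\<psi> \<notin> sections F E \<Longrightarrow> fst (deriv_triv F E (U, \<kappa>) (V, \<tau>) y q) \<psi> = 0"
  by (simp add: deriv_triv_def case_prod_beta)

lemma components_differentiable:
  "\<psi> \<in> sections F E \<Longrightarrow> y \<in> U \<inter> V
    \<Longrightarrow> ((\<lambda>z. inv (\<tau> z) (\<psi> z)) \<circ> inv_into U \<kappa>) differentiable (at (\<kappa> y))"
  using smooth_fun_on_differentiable[OF F section_smooth[OF _ t] c] by auto

lemma linear_deriv_triv:
  assumes y: "y \<in> U \<inter> V"
  shows "linear (deriv_triv F E (U, \<kappa>) (V, \<tau>) y)"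
proof (rule linearI)
  note lt = triv_linear[OF F E t IntD2[OF y]]
  note ld = linear_frechet_derivative[OF components_differentiable[OF _ y]]
  note lc = linear_chart_vector[OF F c IntD1[OF y]]
  fix p q :: "'n \<times> ('l \<Rightarrow>\<^sub>L 'l)" and r :: real
  show "deriv_triv F E (U, \<kappa>) (V, \<tau>) y (p + q)
      = deriv_triv F E (U, \<kappa>) (V, \<tau>) y p + deriv_triv F E (U, \<kappa>) (V, \<tau>) y q"
  proof (intro prod_eqI ext)
    fix \<psi>
    show "fst (deriv_triv F E (U, \<kappa>) (V, \<tau>) y (p + q)) \<psi>
      = fst (deriv_triv F E (U, \<kappa>) (V, \<tau>) y p + deriv_triv F E (U, \<kappa>) (V, \<tau>) y q) \<psi>"
      by (cases "\<psi> \<in> sections F E")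
        (simp_all add: fst_deriv_triv fst_deriv_triv_outside linear_add[OF ld] blinfun.add_left add_ac
          flip: linear_add[OF lt])
  qed (simp add: snd_deriv_triv linear_add[OF lc])
  show "deriv_triv F E (U, \<kappa>) (V, \<tau>) y (r *\<^sub>R p) = r *\<^sub>R deriv_triv F E (U, \<kappa>) (V, \<tau>) y p"
  proof (intro prod_eqI ext)
    fix \<psi>
    show "fst (deriv_triv F E (U, \<kappa>) (V, \<tau>) y (r *\<^sub>R p)) \<psi>
      = fst (r *\<^sub>R deriv_triv F E (U, \<kappa>) (V, \<tau>) y p) \<psi>"
      by (cases "\<psi> \<in> sections F E")
        (simp_all add: fst_deriv_triv fst_deriv_triv_outside linear_cmul[OF ld] blinfun.scaleR_left
          scaleR_fun_def flip: linear_cmul[OF lt] scaleR_add_right)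
  qed (simp add: snd_deriv_triv linear_cmul[OF lc])
qed

lemma deriv_triv_frame:
  assumes y: "y \<in> U \<inter> V" and \<psi>: "\<psi> \<in> sections F E"
    and N: "open N" "y \<in> N" "\<And>z. z \<in> N \<Longrightarrow> \<psi> z = \<tau> z l"
  shows "fst (deriv_triv F E (U, \<kappa>) (V, \<tau>) y q) \<psi> = \<tau> y (blinfun_apply (snd q) l)"
proof -
  have o: "open (\<kappa> ` (U \<inter> (N \<inter> V)))"
    using N(1) triv_open[OF F E t] by (intro chart_image_open[OF F c]) auto
  have "frechet_derivative ((\<lambda>z. inv (\<tau> z) (\<psi> z)) \<circ> inv_into U \<kappa>) (at (\<kappa> y))
      = frechet_derivative (\<lambda>_. l) (at (\<kappa> y))"
    by (rule frechet_derivative_transform_within_open[OF components_differentiable[OF \<psi> y] o])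
      (use y N in \<open>auto simp: chart_inv[OF F c] triv_inv(1)[OF F E t]\<close>)
  then show ?thesis
    using y N by (simp add: fst_deriv_triv[OF \<psi>] triv_inv(1)[OF F E t])
qed

lemma deriv_triv_in_fib:
  assumes y: "y \<in> U \<inter> V"
  shows "deriv_triv F E (U, \<kappa>) (V, \<tau>) y q \<in> deriv_fib F E y"
proof -
  note lt = triv_linear[OF F E t IntD2[OF y]]
  note inv = triv_inv[OF F E t IntD2[OF y]]
  define comp where "comp \<psi> = (\<lambda>z. inv (\<tau> z) (\<psi> z)) \<circ> inv_into U \<kappa>" for \<psi>
  define T where "T \<psi> = frechet_derivative (comp \<psi>) (at (\<kappa> y)) (fst q)" for \<psi>
  have o: "open (\<kappa> ` (U \<inter> V))"
    by (rule chart_image_open[OF F c triv_open[OF F E t]])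
  have hd: "(comp \<psi> has_derivative frechet_derivative (comp \<psi>) (at (\<kappa> y))) (at (\<kappa> y))"
    if "\<psi> \<in> sections F E" for \<psi>
    using components_differentiable[OF that y] by (simp add: comp_def frechet_derivative_works)
  have Tadd: "T (\<psi> + \<eta>) = T \<psi> + T \<eta>" if \<psi>: "\<psi> \<in> sections F E" "\<eta> \<in> sections F E" for \<psi> \<eta>
  proof -
    have "(comp (\<psi> + \<eta>) has_derivative (\<lambda>w. frechet_derivative (comp \<psi>) (at (\<kappa> y)) w
        + frechet_derivative (comp \<eta>) (at (\<kappa> y)) w)) (at (\<kappa> y))"
      by (rule has_derivative_transform_within_open[OF has_derivative_add[OF hd hd] o])
        (use y \<psi> in \<open>auto simp: comp_def chart_inv[OF F c] triv_inv(3)[OF F E t]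
            section_in_fib[of _ F E]\<close>)
    from frechet_derivative_at[OF this] show ?thesis by (simp add: T_def fun_eq_iff)
  qed
  have Tmult: "T (\<lambda>z. h z *\<^sub>R \<psi> z) = h y *\<^sub>R T \<psi>
      + chart_vector F (U, \<kappa>) y (fst q) h *\<^sub>R inv (\<tau> y) (\<psi> y)"
    if \<psi>: "\<psi> \<in> sections F E" and h: "h \<in> Cinf F" for \<psi> h
  proof -
    have hdh: "(h \<circ> inv_into U \<kappa> has_derivative frechet_derivative (h \<circ> inv_into U \<kappa>) (at (\<kappa> y)))
        (at (\<kappa> y))"
      using Cinf_differentiable[OF F h c] y by (simp add: frechet_derivative_works)
    have "(comp (\<lambda>z. h z *\<^sub>R \<psi> z) has_derivative (\<lambda>w. (h \<circ> inv_into U \<kappa>) (\<kappa> y)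
          *\<^sub>R frechet_derivative (comp \<psi>) (at (\<kappa> y)) w
        + frechet_derivative (h \<circ> inv_into U \<kappa>) (at (\<kappa> y)) w *\<^sub>R comp \<psi> (\<kappa> y))) (at (\<kappa> y))"
      by (rule has_derivative_transform_within_open[OF has_derivative_scaleR[OF hdh hd[OF \<psi>]] o])
        (use y \<psi> in \<open>auto simp: comp_def chart_inv[OF F c] triv_inv(4)[OF F E t]
            section_in_fib[of _ F E]\<close>)
    from frechet_derivative_at[OF this] show ?thesis
      using y h by (simp add: T_def fun_eq_iff comp_def chart_inv[OF F c] chart_vector_apply)
  qed
  have Tscale: "T (r *\<^sub>R \<psi>) = r *\<^sub>R T \<psi>" if "\<psi> \<in> sections F E" for \<psi> r
    using Tmult[OF that Cinf_const, of r]
      tangent_const[OF F, of "chart_vector F (U, \<kappa>) y (fst q)" y r]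
      bij_betwE[OF bij_chart_vector[OF F c IntD1[OF y]]]
    by (simp add: scaleR_fun_def)
  have eq: "fst (deriv_triv F E (U, \<kappa>) (V, \<tau>) y q) \<psi>
      = \<tau> y (T \<psi> + blinfun_apply (snd q) (inv (\<tau> y) (\<psi> y)))" if "\<psi> \<in> sections F E" for \<psi>
    using that by (simp add: fst_deriv_triv T_def comp_def)
  have "snd (deriv_triv F E (U, \<kappa>) (V, \<tau>) y q) \<in> fib (tangent_bundle F) y"
    using bij_betwE[OF bij_chart_vector[OF F c IntD1[OF y]]] by (simp add: snd_deriv_triv)
  moreover have "fst (deriv_triv F E (U, \<kappa>) (V, \<tau>) y q) \<psi> \<in> fib E y" if "\<psi> \<in> sections F E" for \<psi>
    using triv_in_fib[OF F E t] y by (simp add: eq that)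
  moreover have "fst (deriv_triv F E (U, \<kappa>) (V, \<tau>) y q) (\<psi> + \<eta>)
      = fst (deriv_triv F E (U, \<kappa>) (V, \<tau>) y q) \<psi> + fst (deriv_triv F E (U, \<kappa>) (V, \<tau>) y q) \<eta>"
    if "\<psi> \<in> sections F E" "\<eta> \<in> sections F E" for \<psi> \<eta>
    by (simp add: eq that section_add[OF F E] Tadd inv section_in_fib[of _ F E] blinfun.add_right
        linear_add[OF lt])
  moreover have "fst (deriv_triv F E (U, \<kappa>) (V, \<tau>) y q) (r *\<^sub>R \<psi>)
      = r *\<^sub>R fst (deriv_triv F E (U, \<kappa>) (V, \<tau>) y q) \<psi>" if "\<psi> \<in> sections F E" for \<psi> r
    by (simp add: eq that section_scale[OF F E] Tscale inv(4) section_in_fib[of _ F E]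
        blinfun.scaleR_right linear_add[OF lt] linear_cmul[OF lt] scaleR_fun_apply scaleR_add_right)
  moreover have "fst (deriv_triv F E (U, \<kappa>) (V, \<tau>) y q) (\<lambda>z. h z *\<^sub>R \<psi> z)
      = h y *\<^sub>R fst (deriv_triv F E (U, \<kappa>) (V, \<tau>) y q) \<psi>
        + snd (deriv_triv F E (U, \<kappa>) (V, \<tau>) y q) h *\<^sub>R \<psi> y"
    if "\<psi> \<in> sections F E" "h \<in> Cinf F" for \<psi> h
    by (simp add: eq that section_mult[OF F E] Tmult inv section_in_fib[of _ F E] snd_deriv_triv
        blinfun.scaleR_right linear_add[OF lt] linear_cmul[OF lt] scaleR_add_right)
  ultimately show ?thesis
    by (simp add: deriv_fib_def case_prod_beta fst_deriv_triv_outside)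
qed

text \<open>Sections that are constant in the trivialization near \<open>y\<close> recover the
  matrix part, which gives injectivity. For surjectivity the symbol of \<open>D\<close> supplies
  \<open>w\<close>, the values of \<open>D\<close> on these sections supply the matrix, and what
  then remains of \<open>D\<close> is tensorial and vanishes on a frame.\<close>

lemma deriv_triv_bij:
  assumes y: "y \<in> U \<inter> V"
  shows "bij_betw (deriv_triv F E (U, \<kappa>) (V, \<tau>) y) UNIV (deriv_fib F E y)"
  unfolding bij_betw_def
proof
  have yV: "y \<in> V" using y by simp
  note inv = triv_inv[OF F E t yV]
  obtain N where N: "open N" "y \<in> N" "N \<subseteq> V"
    "\<forall>w. \<exists>X\<in>sections F E. \<forall>z\<in>N. X z = \<tau> z w"
    by (rule local_frame_section[OF F E t yV])
  obtain \<epsilon> where "\<And>w. \<epsilon> w \<in> sections F E \<and> (\<forall>z\<in>N. \<epsilon> w z = \<tau> z w)"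
    using choice[OF N(4)[unfolded Bex_def]] by blast
  then have \<epsilon>: "\<And>w. \<epsilon> w \<in> sections F E" "\<And>w z. z \<in> N \<Longrightarrow> \<epsilon> w z = \<tau> z w"
    by simp_all
  show "inj (deriv_triv F E (U, \<kappa>) (V, \<tau>) y)"
    unfolding linear_injective_0[OF linear_deriv_triv[OF y]]
  proof (intro allI impI)
    fix q assume 0: "deriv_triv F E (U, \<kappa>) (V, \<tau>) y q = 0"
    have "chart_vector F (U, \<kappa>) y (fst q) = 0"
      using 0 snd_deriv_triv[of y q] by simp
    then have "fst q = 0"
      using inj_chart_vector[OF F c IntD1[OF y]]
        linear_injective_0[OF linear_chart_vector[OF F c IntD1[OF y]]]
      by blast
    moreover have "snd q = 0"
    proof (rule blinfun_eqI)
      fix l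
      have "\<tau> y (blinfun_apply (snd q) l) = 0"
        using deriv_triv_frame[OF y \<epsilon>(1) N(1,2) \<epsilon>(2), of q l] 0 by simp
      then show "blinfun_apply (snd q) l = blinfun_apply 0 l"
        using inv(1)[of "blinfun_apply (snd q) l"] inv(5) by simp
    qed
    ultimately show "q = 0" by (simp add: prod_eq_iff)
  qed
  show "range (deriv_triv F E (U, \<kappa>) (V, \<tau>) y) = deriv_fib F E y"
  proof (intro equalityI subsetI)
    fix D assume D: "D \<in> deriv_fib F E y"
    obtain w where w: "snd D = chart_vector F (U, \<kappa>) y w"
      using deriv_fibD(1)[OF D] bij_chart_vector[OF F c IntD1[OF y]]
      by (auto simp: bij_betw_def)
    define B where "B l = inv (\<tau> y) (fst D (\<epsilon> l))" for l
    have "linear B"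
    proof (rule linearI)
      fix l m :: 'l and r :: real
      \<comment> \<open>The sections \<open>\<epsilon> l\<close> are chosen one at a time, so
        linearity in \<open>l\<close> is guaranteed near \<open>y\<close> only; locality of
        \<open>D\<close> turns it into linearity of \<open>B\<close>.\<close>
      have "fst D (\<epsilon> (l + m)) = fst D (\<epsilon> l + \<epsilon> m)"
        by (rule point_operator_local[OF F E deriv_fib_point_operator[OF D] \<epsilon>(1)
              section_add[OF F E \<epsilon>(1) \<epsilon>(1)], of "N \<inter> V"])
          (use N \<epsilon> yV triv_open[OF F E t] in
            \<open>auto simp: linear_add[OF triv_linear[OF F E t]]\<close>)
      then show "B (l + m) = B l + B m"
        by (simp add: B_def deriv_fibD[OF D] \<epsilon> inv)
      have "fst D (\<epsilon> (r *\<^sub>R l)) = fst D (r *\<^sub>R \<epsilon> l)"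
        by (rule point_operator_local[OF F E deriv_fib_point_operator[OF D] \<epsilon>(1)
              section_scale[OF F E \<epsilon>(1)], of "N \<inter> V"])
          (use N \<epsilon> yV triv_open[OF F E t] in
            \<open>auto simp: linear_cmul[OF triv_linear[OF F E t]] scaleR_fun_def\<close>)
      then show "B (r *\<^sub>R l) = r *\<^sub>R B l"
        by (simp add: B_def deriv_fibD[OF D] \<epsilon> inv)
    qed
    then have B: "blinfun_apply (Blinfun B) = B"
      by (intro bounded_linear_Blinfun_apply finite_dim_bounded_linear[OF finite_dim_fibre[OF F E]])
    define D' where "D' = deriv_triv F E (U, \<kappa>) (V, \<tau>) y (w, Blinfun B)"
    have D': "D' \<in> deriv_fib F E y" "snd D' = snd D"
      unfolding D'_def by (rule deriv_triv_in_fib[OF y]) (simp add: snd_deriv_triv w)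
    have "fst D \<psi> = fst D' \<psi>" if \<psi>: "\<psi> \<in> sections F E" for \<psi>
    proof -
      \<comment> \<open>The difference of two derivations with the same symbol is tensorial.\<close>
      define d where "d \<eta> = fst D \<eta> - fst D' \<eta>" for \<eta>
      have td: "d (\<lambda>z. f z *\<^sub>R \<eta> z) = f y *\<^sub>R d \<eta>" if "f \<in> Cinf F" "\<eta> \<in> sections F E" for f \<eta>
        using that by (simp add: d_def deriv_fibD[OF D] deriv_fibD[OF D'(1)] D'(2) algebra_simps)
      have pd: "point_operator F E y d"
        using td unfolding point_operator_def
        by (simp add: d_def deriv_fibD[OF D] deriv_fibD[OF D'(1)] D'(2) algebra_simps)
      define l where "l = inv (\<tau> y) (\<psi> y)"
      have "d \<psi> = d (\<epsilon> l)"
        by (rule point_operator_tensorial[OF F E pd td \<psi> \<epsilon>(1)])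
          (simp_all add: l_def \<epsilon>(2)[OF N(2)] inv section_in_fib[OF \<psi>])
      also have "fst D' (\<epsilon> l) = fst D (\<epsilon> l)"
        using deriv_triv_frame[OF y \<epsilon>(1) N(1,2) \<epsilon>(2), of "(w, Blinfun B)" l]
        by (simp add: D'_def B B_def inv deriv_fibD[OF D] \<epsilon>(1))
      then have "d (\<epsilon> l) = 0" by (simp add: d_def)
      finally show ?thesis by (simp add: d_def)
    qed
    then have "D = D'"
      using deriv_fib_eqI[OF D D'(1)] D'(2) by simp
    then show "D \<in> range (deriv_triv F E (U, \<kappa>) (V, \<tau>) y)" by (simp add: D'_def)
  qed (auto simp: deriv_triv_in_fib[OF y])
qed

lemmas deriv_triv_inv = linear_bij_betw_inv[OF linear_deriv_triv deriv_triv_bij]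

text \<open>The coordinates of a derivation are a vector and a matrix. The vector comes from the
  symbol, and the matrix is recovered from its values on the finitely many \<open>b i\<close>, which
  the frame sections \<open>\<epsilon> i\<close> reveal.\<close>

lemma smooth_deriv_coordinates:
  assumes W: "open W" "W \<subseteq> U \<inter> V" and b: "parseval_frame n b"
    and \<epsilon>: "\<And>i. \<epsilon> i \<in> sections F E" "\<And>i z. z \<in> W \<Longrightarrow> \<epsilon> i z = \<tau> z (b i)"
    and D: "\<And>y. y \<in> W \<Longrightarrow> D y \<in> deriv_fib F E y"
    and D_snd: "smooth_fun_on F W (\<lambda>y. inv (chart_vector F (U, \<kappa>) y) (snd (D y)))"
    and D_fst: "\<And>i. smooth_fun_on F W (\<lambda>y. inv (\<tau> y) (fst (D y) (\<epsilon> i)))"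
  shows "smooth_fun_on F W (\<lambda>y. inv (deriv_triv F E (U, \<kappa>) (V, \<tau>) y) (D y))"
proof -
  \<comment> \<open>\<open>T i u\<close> is the rank-one map that sends \<open>l\<close> to
    \<open>(l \<bullet> b i) *\<^sub>R u\<close>. By the Parseval identity a matrix is the sum of
    the \<open>T i u\<close> with \<open>u\<close> its value at \<open>b i\<close>.\<close>
  define T where "T i u = blinfun_scaleR_left u o\<^sub>L blinfun_inner_left (b i)" for i and u :: 'l
  have T: "bounded_linear (T i)" for i
    unfolding T_def
    by (intro bounded_linear_compose[OF bounded_bilinear.bounded_linear_left[OF
            bounded_bilinear_blinfun_compose] bounded_linear_blinfun_scaleR_left])
  have bl1: "bounded_linear (\<lambda>w::'n. (w, 0 :: 'l \<Rightarrow>\<^sub>L 'l))"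
    and bl2: "bounded_linear (\<lambda>B::'l \<Rightarrow>\<^sub>L 'l. (0 :: 'n, B))"
    by (intro bounded_linear_Pair bounded_linear_ident bounded_linear_zero)+
  have "smooth_fun_on F W (\<lambda>y. (inv (chart_vector F (U, \<kappa>) y) (snd (D y)), 0)
      + (0, \<Sum>i<n. T i (inv (\<tau> y) (fst (D y) (\<epsilon> i)))))"
    by (intro smooth_fun_on_add[OF F W(1)] smooth_fun_on_bounded_linear[OF F W(1) bl1]
        smooth_fun_on_bounded_linear[OF F W(1) bl2] smooth_fun_on_sum[OF F W(1)]
        smooth_fun_on_bounded_linear[OF F W(1) T] D_snd D_fst)
  then show ?thesis
  proof (rule smooth_fun_on_cong[OF F W(1)])
    fix y assume yW: "y \<in> W"
    then have y: "y \<in> U \<inter> V" and yV: "y \<in> V" using W by auto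
    define q where "q = inv (deriv_triv F E (U, \<kappa>) (V, \<tau>) y) (D y)"
    have q: "D y = deriv_triv F E (U, \<kappa>) (V, \<tau>) y q"
      using deriv_triv_inv(2)[OF y y D[OF yW]] by (simp add: q_def)
    have "fst (D y) (\<epsilon> i) = \<tau> y (blinfun_apply (snd q) (b i))" for i
      unfolding q by (rule deriv_triv_frame[OF y \<epsilon>(1) W(1) yW \<epsilon>(2)])
    then have B: "inv (\<tau> y) (fst (D y) (\<epsilon> i)) = blinfun_apply (snd q) (b i)" for i
      by (simp add: triv_inv(1)[OF F E t yV])
    have "(\<Sum>i<n. T i (inv (\<tau> y) (fst (D y) (\<epsilon> i)))) = snd q"
    proof (rule blinfun_eqI)
      fix l
      have "linear (blinfun_apply (snd q))"
        by (simp add: bounded_linear.linear blinfun.bounded_linear_right)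
      from finite_dim_linear_sum[OF b this, of l]
      show "blinfun_apply (\<Sum>i<n. T i (inv (\<tau> y) (fst (D y) (\<epsilon> i)))) l = blinfun_apply (snd q) l"
        by (simp add: blinfun.sum_left T_def B)
    qed
    moreover have "inv (chart_vector F (U, \<kappa>) y) (snd (D y)) = fst q"
      unfolding q snd_deriv_triv using inj_chart_vector[OF F c] y by (simp add: inv_f_f)
    ultimately show "(inv (chart_vector F (U, \<kappa>) y) (snd (D y)), 0)
      + (0, \<Sum>i<n. T i (inv (\<tau> y) (fst (D y) (\<epsilon> i))))
      = inv (deriv_triv F E (U, \<kappa>) (V, \<tau>) y) (D y)"
      by (simp add: q_def[symmetric])
  qed
qed

end

section \<open>Sections of the derivation algebroid\<close>

lemma deriv_algebroid_simps:
  "fib (deriv_algebroid F E) = deriv_fib F E"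
  "triv (deriv_algebroid F E) = {(U \<inter> V, deriv_triv F E (U, \<kappa>) (V, \<tau>)) | U \<kappa> V \<tau>.
    (U, \<kappa>) \<in> F \<and> (V, \<tau>) \<in> triv E}"
  "anchor (deriv_algebroid F E) = (\<lambda>y. snd)"
  by (simp_all add: deriv_algebroid_def)

lemma deriv_algebroid_triv:
  assumes "(W, \<sigma>) \<in> triv (deriv_algebroid F E)"
  shows "open W" and "y \<in> W \<Longrightarrow> linear (\<sigma> y)"
    and "y \<in> W \<Longrightarrow> bij_betw (\<sigma> y) UNIV (fib (deriv_algebroid F E) y)"
  using assms
  by (auto simp: deriv_algebroid_simps chart_open[OF F] triv_open[OF F E] linear_deriv_triv
      deriv_triv_bij)

text \<open>The first coordinate in \<open>deriv_triv\<close> is the chart coordinate of the symbol.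
  It is available over \<open>U \<inter> V\<close> only, while a vector field is tested on all of
  \<open>U\<close>, hence the localization.\<close>

lemma deriv_section_snd:
  assumes D: "D \<in> sections F (deriv_algebroid F E)"
  shows "(\<lambda>y. snd (D y)) \<in> vector_fields F"
proof -
  have Dfib: "D y \<in> deriv_fib F E y" for y
    using section_in_fib[OF D] by (simp add: deriv_algebroid_simps)
  have "smooth_fun_on F U (\<lambda>y. inv (chart_vector F (U, \<kappa>) y) (snd (D y)))"
    if c: "(U, \<kappa>) \<in> F" for U \<kappa>
  proof (rule smooth_fun_on_local[OF F])
    fix y assume "y \<in> U"
    obtain V \<tau> where t: "(V, \<tau>) \<in> triv E" and y: "y \<in> V" by (rule triv_at[OF F E])
    let ?W = "U \<inter> V"
    have oW: "open ?W" using chart_open[OF F c] triv_open[OF F E t] by blast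
    have "(?W, deriv_triv F E (U, \<kappa>) (V, \<tau>)) \<in> triv (deriv_algebroid F E)"
      using c t by (auto simp: deriv_algebroid_simps)
    then have "smooth_fun_on F ?W (\<lambda>z. fst (inv (deriv_triv F E (U, \<kappa>) (V, \<tau>) z) (D z)))"
      using smooth_fun_on_bounded_linear[OF F oW bounded_linear_fst section_smooth[OF D]] by blast
    then have "smooth_fun_on F ?W (\<lambda>z. inv (chart_vector F (U, \<kappa>) z) (snd (D z)))"
    proof (rule smooth_fun_on_cong[OF F oW])
      fix z assume z: "z \<in> ?W"
      define q where "q = inv (deriv_triv F E (U, \<kappa>) (V, \<tau>) z) (D z)"
      have "D z = deriv_triv F E (U, \<kappa>) (V, \<tau>) z q"
        using deriv_triv_inv(2)[OF c t z z Dfib] by (simp add: q_def)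
      then have "snd (D z) = chart_vector F (U, \<kappa>) z (fst q)"
        by (simp add: snd_deriv_triv[OF c t])
      then show "fst (inv (deriv_triv F E (U, \<kappa>) (V, \<tau>) z) (D z))
          = inv (chart_vector F (U, \<kappa>) z) (snd (D z))"
        using inj_chart_vector[OF F c] z by (simp add: inv_f_f q_def)
    qed
    then show "\<exists>N. open N \<and> y \<in> N
        \<and> smooth_fun_on F N (\<lambda>y. inv (chart_vector F (U, \<kappa>) y) (snd (D y)))"
      using oW y \<open>y \<in> U\<close> by blast
  qed
  then show ?thesis
    using deriv_fibD(1)[OF Dfib] by (auto simp: sections_def tangent_bundle_def)
qed

text \<open>It allows sections of the derivation algebroid to be composed as operators. In
  coordinates the result is a derivative along a smoothly varying direction plus the value of a
  smoothly varying matrix.\<close>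

lemma deriv_section_apply:
  assumes D: "D \<in> sections F (deriv_algebroid F E)" and \<psi>: "\<psi> \<in> sections F E"
  shows "(\<lambda>y. fst (D y) \<psi>) \<in> sections F E"
proof (rule sectionsI)
  have Dfib: "D y \<in> deriv_fib F E y" for y
    using D by (simp add: sections_def deriv_algebroid_simps)
  show "fst (D y) \<psi> \<in> fib E y" for y
    using deriv_fibD(2)[OF Dfib \<psi>] .
  fix V \<tau> assume t: "(V, \<tau>) \<in> triv E"
  show "smooth_fun_on F V (\<lambda>y. inv (\<tau> y) (fst (D y) \<psi>))"
  proof (rule smooth_fun_on_local[OF F])
    fix y assume "y \<in> V"
    obtain U \<kappa> where c: "(U, \<kappa>) \<in> F" and y: "y \<in> U" by (rule chart_at[OF F])
    let ?W = "U \<inter> V"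
    define q where "q z = inv (deriv_triv F E (U, \<kappa>) (V, \<tau>) z) (D z)" for z
    have oW: "open ?W" using chart_open[OF F c] triv_open[OF F E t] by blast
    have "(?W, deriv_triv F E (U, \<kappa>) (V, \<tau>)) \<in> triv (deriv_algebroid F E)"
      using c t by (auto simp: deriv_algebroid_simps)
    from section_smooth[OF D this] have q: "smooth_fun_on F ?W q"
      by (simp add: q_def[abs_def])
    have s\<psi>: "smooth_fun_on F ?W (\<lambda>z. inv (\<tau> z) (\<psi> z))"
      using smooth_fun_on_subset[OF section_smooth[OF \<psi> t]] by blast
    have "smooth_fun_on F ?W (\<lambda>z.
        frechet_derivative ((\<lambda>z. inv (\<tau> z) (\<psi> z)) \<circ> inv_into U \<kappa>) (at (\<kappa> z)) (fst (q z))
        + blinfun_apply (snd (q z)) (inv (\<tau> z) (\<psi> z)))"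
      by (intro smooth_fun_on_add[OF F oW] smooth_fun_on_directional_derivative[OF F c oW Int_lower1]
          smooth_fun_on_bilinear[OF F oW bounded_bilinear_blinfun_apply] s\<psi>
          smooth_fun_on_bounded_linear[OF F oW bounded_linear_fst q]
          smooth_fun_on_bounded_linear[OF F oW bounded_linear_snd q])
    then have "smooth_fun_on F ?W (\<lambda>z. inv (\<tau> z) (fst (D z) \<psi>))"
    proof (rule smooth_fun_on_cong[OF F oW])
      fix z assume z: "z \<in> ?W"
      then have "D z = deriv_triv F E (U, \<kappa>) (V, \<tau>) z (q z)"
        using deriv_triv_inv(2)[OF c t z z Dfib] by (simp add: q_def)
      then show "frechet_derivative ((\<lambda>z. inv (\<tau> z) (\<psi> z)) \<circ> inv_into U \<kappa>) (at (\<kappa> z)) (fst (q z))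
        + blinfun_apply (snd (q z)) (inv (\<tau> z) (\<psi> z)) = inv (\<tau> z) (fst (D z) \<psi>)"
        using z by (simp add: fst_deriv_triv[OF c t \<psi>] triv_inv(1)[OF F E t])
    qed
    then show "\<exists>N. open N \<and> y \<in> N \<and> smooth_fun_on F N (\<lambda>y. inv (\<tau> y) (fst (D y) \<psi>))"
      using oW y \<open>y \<in> V\<close> by blast
  qed
qed

end


section \<open>The action Lie algebroid\<close>

context
  fixes M :: "('m::{t2_space,second_countable_topology}, 'p::real_inner) atlas"
    and F :: "('f::{t2_space,second_countable_topology}, 'n::real_inner) atlas"
    and A :: "('m, 'k::real_inner, 'a::real_vector, 'z) algebroid_scheme"
    and \<phi> :: "'f \<Rightarrow> 'm"
    and act :: "('m \<Rightarrow> 'a) \<Rightarrow> 'f \<Rightarrow> 'f tangent"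
  assumes M: "manifold M" and A: "lie_algebroid M A" and F: "manifold F"
    and \<phi>: "smooth_map F M \<phi>" and act: "infinitesimal_action M F A \<phi> act"
begin

lemma algebroid_vector_bundle: "vector_bundle M A"
  using A by (simp add: lie_algebroid_def)

lemma bracket_section: "X \<in> sections M A \<Longrightarrow> Y \<in> sections M A \<Longrightarrow> bracket A X Y \<in> sections M A"
  using A by (simp add: lie_algebroid_def)

lemma bracket_add:
  "X \<in> sections M A \<Longrightarrow> Y \<in> sections M A \<Longrightarrow> Z \<in> sections M A
    \<Longrightarrow> bracket A (X + Y) Z = bracket A X Z + bracket A Y Z"
  "X \<in> sections M A \<Longrightarrow> Y \<in> sections M A \<Longrightarrow> Z \<in> sections M A
    \<Longrightarrow> bracket A Z (X + Y) = bracket A Z X + bracket A Z Y"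
  using A by (simp_all add: lie_algebroid_def)

lemma bracket_self: "X \<in> sections M A \<Longrightarrow> bracket A X X = 0"
  using A by (simp add: lie_algebroid_def)

lemma bracket_mult_right:
  "X \<in> sections M A \<Longrightarrow> Y \<in> sections M A \<Longrightarrow> f \<in> Cinf M
    \<Longrightarrow> bracket A X (\<lambda>x. f x *\<^sub>R Y x)
      = (\<lambda>x. f x *\<^sub>R bracket A X Y x + anchor_field A X x f *\<^sub>R Y x)"
  using A by (simp add: lie_algebroid_def)

lemma bracket_antisym:
  assumes X: "X \<in> sections M A" and Y: "Y \<in> sections M A"
  shows "bracket A X Y = - bracket A Y X"
proof -
  have "0 = bracket A (X + Y) (X + Y)"
    using bracket_self[OF section_add[OF M algebroid_vector_bundle X Y]] by simp
  also have "\<dots> = bracket A X Y + bracket A Y X"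
    by (simp add: bracket_add X Y section_add[OF M algebroid_vector_bundle] bracket_self[OF X]
        bracket_self[OF Y])
  finally show ?thesis by (metis eq_neg_iff_add_eq_0)
qed

lemma bracket_mult_left:
  assumes X: "X \<in> sections M A" and Y: "Y \<in> sections M A" and f: "f \<in> Cinf M"
  shows "bracket A (\<lambda>x. f x *\<^sub>R X x) Y x = f x *\<^sub>R bracket A X Y x - anchor_field A Y x f *\<^sub>R X x"
  by (simp add: bracket_antisym[OF _ Y] section_mult[OF M algebroid_vector_bundle] X f
      bracket_mult_right[OF Y X f])

lemma act_vector_field: "X \<in> sections M A \<Longrightarrow> act X \<in> vector_fields F"
  using act by (simp add: infinitesimal_action_def)

lemma act_tangent: "X \<in> sections M A \<Longrightarrow> act X y \<in> fib (tangent_bundle F) y"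
  using vector_field_in_fib[OF F act_vector_field] .

lemma act_add: "X \<in> sections M A \<Longrightarrow> Y \<in> sections M A \<Longrightarrow> act (X + Y) = act X + act Y"
  using act by (simp add: infinitesimal_action_def)

lemma act_scale: "X \<in> sections M A \<Longrightarrow> act (c *\<^sub>R X) = c *\<^sub>R act X"
  using act by (simp add: infinitesimal_action_def)

lemma act_mult:
  "X \<in> sections M A \<Longrightarrow> f \<in> Cinf M \<Longrightarrow> act (\<lambda>x. f x *\<^sub>R X x) = (\<lambda>y. f (\<phi> y) *\<^sub>R act X y)"
  using act by (simp add: infinitesimal_action_def)

lemma act_bracket:
  "X \<in> sections M A \<Longrightarrow> Y \<in> sections M A \<Longrightarrow> act (bracket A X Y) = vf_bracket (act X) (act Y)"
  using act by (simp add: infinitesimal_action_def)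

text \<open>Projectability in the form used for the bracket: it converts the Leibniz term of the
  bracket of \<open>A\<close> into the derivative of a pulled-back coefficient along the
  action.\<close>

lemma act_project:
  assumes "X \<in> sections M A" "f \<in> Cinf M"
  shows "act X y (\<lambda>z. f (\<phi> z)) = anchor_field A X (\<phi> y) f"
proof -
  have "tangent_map M \<phi> (act X y) = anchor_field A X (\<phi> y)"
    using act assms(1) by (simp add: infinitesimal_action_def)
  from fun_cong[OF this, of f] show ?thesis
    using assms(2) by (simp add: tangent_map_def o_def)
qed

lemma act_tensorial:
  assumes "X \<in> sections M A" "Y \<in> sections M A" "X (\<phi> y) = Y (\<phi> y)"
  shows "act X y = act Y y"
  by (rule point_operator_tensorial[OF M algebroid_vector_bundle, of "\<phi> y" "\<lambda>X. act X y"])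
    (simp_all add: point_operator_def act_add act_mult assms)

lemma act_sum:
  assumes "\<And>i. i \<in> I \<Longrightarrow> X i \<in> sections M A"
  shows "act (\<Sum>i\<in>I. h i *\<^sub>R X i) y = (\<Sum>i\<in>I. h i *\<^sub>R act (X i) y)"
proof -
  have "point_operator M A (\<phi> y) (\<lambda>X. act X y)"
    by (simp add: point_operator_def act_add act_mult)
  from point_operator_sum[OF M algebroid_vector_bundle this, of I "\<lambda>i. h i *\<^sub>R X i"]
  show ?thesis
    using assms by (simp add: section_scale[OF M algebroid_vector_bundle] act_scale scaleR_fun_apply)
qed

section \<open>The anchor and the bracket of the action algebroid are well defined\<close>

lemma action_algebroid_simps:
  "fib (action_algebroid M F A \<phi> act) = (\<lambda>y. fib A (\<phi> y))"
  "triv (action_algebroid M F A \<phi> act) = triv (pullback_bundle \<phi> A)"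
  by (simp_all add: action_algebroid_def pullback_bundle_def)

lemma sections_action: "sections F (action_algebroid M F A \<phi> act) = sections F (pullback_bundle \<phi> A)"
  by (simp add: sections_def action_algebroid_def)

lemma action_vector_bundle: "vector_bundle F (action_algebroid M F A \<phi> act)"
  using pullback_vector_bundle[OF M algebroid_vector_bundle F \<phi>]
  by (simp add: vector_bundle_def action_algebroid_def)

lemma action_section:
  "X \<in> sections M A \<Longrightarrow> (\<lambda>y. X (\<phi> y)) \<in> sections F (action_algebroid M F A \<phi> act)"
  using pullback_section[OF M algebroid_vector_bundle F \<phi>] by (simp add: sections_action)

text \<open>The expression \<open>1 \<otimes> X\<close> forces the value. Any other expression
  \<open>h \<otimes> Y\<close> gives the same one by tensoriality, applied to \<open>X\<close> and
  to \<open>Y\<close> scaled by the real number \<open>h y\<close>.\<close>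

lemma action_anchor:
  assumes X: "X \<in> sections M A"
  shows "anchor (action_algebroid M F A \<phi> act) y (X (\<phi> y)) = act X y"
proof -
  have "(THE v. \<forall>h\<in>Cinf F. \<forall>Y\<in>sections M A. X (\<phi> y) = h y *\<^sub>R Y (\<phi> y) \<longrightarrow> v = h y *\<^sub>R act Y y)
      = act X y"
  proof (rule the_equality)
    show "\<forall>h\<in>Cinf F. \<forall>Y\<in>sections M A. X (\<phi> y) = h y *\<^sub>R Y (\<phi> y) \<longrightarrow> act X y = h y *\<^sub>R act Y y"
    proof (intro ballI impI)
      fix h Y assume Y: "Y \<in> sections M A" and "X (\<phi> y) = h y *\<^sub>R Y (\<phi> y)"
      then have "act X y = act (h y *\<^sub>R Y) y"
        by (intro act_tensorial X section_scale[OF M algebroid_vector_bundle])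
          (simp_all add: scaleR_fun_apply)
      then show "act X y = h y *\<^sub>R act Y y"
        by (simp add: act_scale Y scaleR_fun_apply)
    qed
    fix v
    assume "\<forall>h\<in>Cinf F. \<forall>Y\<in>sections M A. X (\<phi> y) = h y *\<^sub>R Y (\<phi> y) \<longrightarrow> v = h y *\<^sub>R act Y y"
    from bspec[OF bspec[OF this Cinf_const[of 1]] X] show "v = act X y" by simp
  qed
  then show ?thesis by (simp add: action_algebroid_def)
qed

text \<open>The value at \<open>y\<close> of the bracket of the sum of the
  \<open>h i \<otimes> X i\<close> with \<open>1 \<otimes> Y\<close>; the term that differentiates
  the constant 1 has disappeared.\<close>

definition half_bracket ::
  "nat \<Rightarrow> (nat \<Rightarrow> 'f \<Rightarrow> real) \<Rightarrow> (nat \<Rightarrow> 'm \<Rightarrow> 'a) \<Rightarrow> ('m \<Rightarrow> 'a) \<Rightarrow> 'f \<Rightarrow> 'a" where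
  "half_bracket n h X Y y
    = (\<Sum>i<n. h i y *\<^sub>R bracket A (X i) Y (\<phi> y) - act Y y (h i) *\<^sub>R X i (\<phi> y))"

text \<open>Leibniz rule in the second argument. The first section enters only through its brackets
  with the \<open>1 \<otimes> Y j\<close> and through its anchor at \<open>y\<close>, written as the
  action of the section of \<open>A\<close> whose coefficients are frozen at
  \<open>y\<close>.\<close>

lemma tensor_bracket_half:
  assumes "\<And>i. i < n \<Longrightarrow> X i \<in> sections M A"
  shows "tensor_bracket_at A \<phi> act n h X m k Y y
    = (\<Sum>j<m. k j y *\<^sub>R half_bracket n h X (Y j) y
        + act (\<Sum>i<n. h i y *\<^sub>R X i) y (k j) *\<^sub>R Y j (\<phi> y))"
proof -
  have "act (\<Sum>i<n. h i y *\<^sub>R X i) y = (\<Sum>i<n. h i y *\<^sub>R act (X i) y)"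
    by (rule act_sum) (use assms in simp)
  then have "act (\<Sum>i<n. h i y *\<^sub>R X i) y (k j) = (\<Sum>i<n. h i y * act (X i) y (k j))" for j
    by (simp only: sum_fun_apply scaleR_fun_apply real_scaleR_def)
  then show ?thesis
    unfolding tensor_bracket_at_def half_bracket_def
    by (subst sum.swap)
      (simp add: scaleR_sum_right scaleR_sum_left sum.distrib sum_subtractf scaleR_diff_right
        mult.commute algebra_simps)
qed

lemma tensor_bracket_antisym:
  assumes "\<And>i. i < n \<Longrightarrow> X i \<in> sections M A" "\<And>j. j < m \<Longrightarrow> Y j \<in> sections M A"
  shows "tensor_bracket_at A \<phi> act n h X m k Y y = - tensor_bracket_at A \<phi> act m k Y n h X y"
  unfolding tensor_bracket_at_def
  by (subst sum.swap, simp only: sum_negf[symmetric], intro sum.cong refl,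
      subst bracket_antisym) (use assms in \<open>simp_all add: algebra_simps\<close>)

text \<open>Rewriting all \<open>X i\<close> in one local frame shows that \<open>half_bracket\<close> depends only on the
  germ of the section \<open>\<Sum>i<n. h i \<otimes> X i\<close>, whose coefficients in that frame are \<open>g a\<close>.\<close>

lemma half_bracket_local:
  assumes h: "\<And>i. i < n \<Longrightarrow> h i \<in> Cinf F" and X: "\<And>i. i < n \<Longrightarrow> X i \<in> sections M A"
    and h': "\<And>i. i < n' \<Longrightarrow> h' i \<in> Cinf F" and X': "\<And>i. i < n' \<Longrightarrow> X' i \<in> sections M A"
    and Y: "Y \<in> sections M A" and U: "open U" "y \<in> U"
    and eq: "\<And>z. z \<in> U \<Longrightarrow> tensor_section \<phi> n h X z = tensor_section \<phi> n' h' X' z"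
  shows "half_bracket n h X Y y = half_bracket n' h' X' Y y"
proof -
  note AV = algebroid_vector_bundle
  obtain r N and c :: "nat \<Rightarrow> 'm \<Rightarrow> 'a \<Rightarrow> real" and e where
    "open N" "\<phi> y \<in> N" "\<forall>i. e i \<in> sections M A"
    "\<forall>i z. \<forall>u\<in>fib A z. \<forall>v\<in>fib A z. c i z (u + v) = c i z u + c i z v"
    "\<forall>i z r. \<forall>u\<in>fib A z. c i z (r *\<^sub>R u) = r * c i z u"
    "\<forall>z\<in>N. \<forall>u\<in>fib A z. (\<Sum>i<r. c i z u *\<^sub>R e i z) = u"
    "\<forall>i. \<forall>s\<in>sections M A. (\<lambda>y. c i y (s y)) \<in> Cinf M"
    by (rule local_coframe[OF M AV M smooth_map_id[OF M AV], unfolded sections_pullback_id[OF M AV],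
          where x = "\<phi> y"])
  note c = this[rule_format]
  have vY: "act Y y \<in> fib (tangent_bundle F) y" by (rule act_tangent[OF Y])
  define g where "g n h X a z = (\<Sum>i<n. h i z * c a (\<phi> z) (X i (\<phi> z)))"
    for n a z and h :: "nat \<Rightarrow> 'f \<Rightarrow> real" and X
  have c_sum: "c a z (\<Sum>i\<in>I. q i *\<^sub>R u i) = (\<Sum>i\<in>I. q i * c a z (u i))"
    if "\<And>i. i \<in> I \<Longrightarrow> u i \<in> fib A z" for a z q u and I :: "nat set"
    using that
  proof (induction I rule: infinite_finite_induct)
    case (insert i I)
    have "(\<Sum>i\<in>I. q i *\<^sub>R u i) \<in> fib A z"
      using insert by (intro subspace_sum fib_subspace[OF M AV] fib_scale[OF M AV]) auto
    then show ?case using insert by (simp add: c(4,5) fib_scale[OF M AV])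
  qed (use c(5)[OF fib_0[OF M AV], of _ z 0] in simp_all)
  have g_eq: "g n h X a z = c a (\<phi> z) (tensor_section \<phi> n h X z)"
    if "\<And>i. i < n \<Longrightarrow> X i \<in> sections M A" for n h X a z
    unfolding g_def tensor_section_def
    by (rule c_sum[symmetric], rule section_in_fib[of _ M A]) (use that in simp)
  have fC: "(\<lambda>z. c a (\<phi> z) (X (\<phi> z))) \<in> Cinf F" if "X \<in> sections M A" for a X
    using Cinf_compose[OF M AV F \<phi> c(7)[OF that]] .
  have gC: "g n h X a \<in> Cinf F"
    if "\<And>i. i < n \<Longrightarrow> h i \<in> Cinf F" "\<And>i. i < n \<Longrightarrow> X i \<in> sections M A" for n h X a
    unfolding g_def[abs_def] by (intro Cinf_sum[OF F] Cinf_mult[OF F] fC) (use that in auto)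
  have half: "half_bracket n h X Y y = half_bracket r (g n h X) e Y y"
    if h: "\<And>i. i < n \<Longrightarrow> h i \<in> Cinf F" and X: "\<And>i. i < n \<Longrightarrow> X i \<in> sections M A" for n h X
  proof -
    define f where "f i a = c a (\<phi> y) (X i (\<phi> y))" for i a
    define v where "v i a = act Y y (\<lambda>z. c a (\<phi> z) (X i (\<phi> z)))" for i a
    have po: "point_operator M A (\<phi> y) (\<lambda>X. bracket A X Y (\<phi> y))"
      by (simp add: point_operator_def bracket_add Y bracket_mult_left)
    have X_y: "X i (\<phi> y) = (\<Sum>a<r. f i a *\<^sub>R e a (\<phi> y))" if "i < n" for i
      using c(6)[OF c(2) section_in_fib[OF X[OF that]]] by (simp add: f_def)
    have br: "bracket A (X i) Y (\<phi> y)
        = (\<Sum>a<r. f i a *\<^sub>R bracket A (e a) Y (\<phi> y) - v i a *\<^sub>R e a (\<phi> y))" if "i < n" for i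
    proof -
      have ce: "(\<lambda>z. c a z (X i z) *\<^sub>R e a z) \<in> sections M A" for a
        by (intro section_mult[OF M AV] c X that)
      have "bracket A (X i) Y (\<phi> y) = bracket A (\<Sum>a<r. (\<lambda>z. c a z (X i z) *\<^sub>R e a z)) Y (\<phi> y)"
        by (rule point_operator_local[OF M AV po X[OF that] section_sum[OF M AV ce] c(1,2)])
          (simp add: sum_fun_apply c(6) section_in_fib[OF X[OF that]])
      also have "\<dots> = (\<Sum>a<r. bracket A (\<lambda>z. c a z (X i z) *\<^sub>R e a z) Y (\<phi> y))"
        by (rule point_operator_sum[OF M AV po ce])
      \<comment> \<open>The Leibniz rule in \<open>A\<close> differentiates the coefficient along
        the anchor of \<open>Y\<close>; by projectability this is \<open>v i a\<close>, a derivative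
        along the action on \<open>F\<close>.\<close>
      also have "\<dots> = (\<Sum>a<r. f i a *\<^sub>R bracket A (e a) Y (\<phi> y) - v i a *\<^sub>R e a (\<phi> y))"
        by (simp add: bracket_mult_left[OF c(3) Y c(7)[OF X[OF that]]] f_def v_def
            act_project[OF Y c(7)[OF X[OF that]]])
      finally show ?thesis .
    qed
    have vg: "act Y y (g n h X a) = (\<Sum>i<n. h i y * v i a + act Y y (h i) * f i a)" for a
    proof -
      have "act Y y (g n h X a) = (\<Sum>i<n. act Y y (\<lambda>z. h i z * c a (\<phi> z) (X i (\<phi> z))))"
        unfolding g_def[abs_def]
        by (rule tangent_sum[OF F vY]) (use h X fC Cinf_mult[OF F] in simp)
      also have "\<dots> = (\<Sum>i<n. h i y * v i a + act Y y (h i) * f i a)"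
        by (intro sum.cong refl) (simp add: tangent_mult[OF F vY] h X fC v_def f_def)
      finally show ?thesis .
    qed
    have "half_bracket n h X Y y
        = (\<Sum>i<n. \<Sum>a<r. (h i y * f i a) *\<^sub>R bracket A (e a) Y (\<phi> y)
            - (h i y * v i a + act Y y (h i) * f i a) *\<^sub>R e a (\<phi> y))"
      unfolding half_bracket_def
    proof (intro sum.cong refl)
      fix i assume "i \<in> {..<n}"
      then have i: "i < n" by simp
      show "h i y *\<^sub>R bracket A (X i) Y (\<phi> y) - act Y y (h i) *\<^sub>R X i (\<phi> y)
        = (\<Sum>a<r. (h i y * f i a) *\<^sub>R bracket A (e a) Y (\<phi> y)
            - (h i y * v i a + act Y y (h i) * f i a) *\<^sub>R e a (\<phi> y))"
        unfolding br[OF i] X_y[OF i]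
        by (simp add: scaleR_sum_right sum_subtractf[symmetric] algebra_simps)
    qed
    \<comment> \<open>By the product rule \<open>vg\<close>, the terms with \<open>v\<close> from
      the bracket and those with derivatives of \<open>h i\<close> together form the derivative of
      the new coefficient \<open>g n h X a\<close>.\<close>
    also have "\<dots> = half_bracket r (g n h X) e Y y"
      unfolding half_bracket_def vg
      by (subst sum.swap)
        (simp add: g_def f_def scaleR_sum_left sum_subtractf[symmetric])
    finally show ?thesis .
  qed
  have "g n h X a z = g n' h' X' a z" if "z \<in> U" for a z
    using g_eq[OF X] g_eq[OF X'] eq[OF that] by simp
  moreover from this have "act Y y (g n h X a) = act Y y (g n' h' X' a)" for a
    by (intro tangent_local[OF F vY gC gC U] h h' X X')
  ultimately have "half_bracket r (g n h X) e Y y = half_bracket r (g n' h' X') e Y y"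
    using U(2) by (simp add: half_bracket_def)
  then show ?thesis using half[OF h X] half[OF h' X'] by simp
qed

text \<open>Both ingredients of \<open>tensor_bracket_half\<close> depend on the germ of the first
  section alone: the anchor on its value at \<open>y\<close>, the half brackets by
  \<open>half_bracket_local\<close>.\<close>

lemma tensor_bracket_local_left:
  assumes h: "\<And>i. i < n \<Longrightarrow> h i \<in> Cinf F" and X: "\<And>i. i < n \<Longrightarrow> X i \<in> sections M A"
    and h': "\<And>i. i < n' \<Longrightarrow> h' i \<in> Cinf F" and X': "\<And>i. i < n' \<Longrightarrow> X' i \<in> sections M A"
    and Y: "\<And>j. j < m \<Longrightarrow> Y j \<in> sections M A" and U: "open U" "y \<in> U"
    and eq: "\<And>z. z \<in> U \<Longrightarrow> tensor_section \<phi> n h X z = tensor_section \<phi> n' h' X' z"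
  shows "tensor_bracket_at A \<phi> act n h X m k Y y = tensor_bracket_at A \<phi> act n' h' X' m k Y y"
proof -
  have s: "(\<Sum>i<n. h i y *\<^sub>R X i) \<in> sections M A"
    if "\<And>i. i < n \<Longrightarrow> X i \<in> sections M A" for n and h :: "nat \<Rightarrow> 'f \<Rightarrow> real" and X
    by (intro section_sum[OF M algebroid_vector_bundle] section_scale[OF M algebroid_vector_bundle])
      (use that in auto)
  have "act (\<Sum>i<n. h i y *\<^sub>R X i) y = act (\<Sum>i<n'. h' i y *\<^sub>R X' i) y"
  proof (rule act_tensorial[OF s[OF X] s[OF X']])
    show "(\<Sum>i<n. h i y *\<^sub>R X i) (\<phi> y) = (\<Sum>i<n'. h' i y *\<^sub>R X' i) (\<phi> y)"
      using eq[OF U(2)] unfolding tensor_section_def sum_fun_apply scaleR_fun_apply .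
  qed
  moreover have "half_bracket n h X (Y j) y = half_bracket n' h' X' (Y j) y" if "j < m" for j
    by (rule half_bracket_local[OF h X h' X' Y[OF that] U eq])
  ultimately show ?thesis
    by (simp add: tensor_bracket_half X X')
qed

text \<open>Two pairs of expressions are compared on the intersection of their neighbourhoods. The
  left expression is exchanged first; antisymmetry then brings the right one to the left, where it
  is exchanged in the same way.\<close>

lemma action_bracket:
  assumes U: "open U" "y \<in> U"
    and h: "\<And>i. i < n \<Longrightarrow> h i \<in> Cinf F" and X: "\<And>i. i < n \<Longrightarrow> X i \<in> sections M A"
    and k: "\<And>j. j < m \<Longrightarrow> k j \<in> Cinf F" and Y: "\<And>j. j < m \<Longrightarrow> Y j \<in> sections M A"
    and s: "\<And>z. z \<in> U \<Longrightarrow> s z = tensor_section \<phi> n h X z"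
    and t: "\<And>z. z \<in> U \<Longrightarrow> t z = tensor_section \<phi> m k Y z"
  shows "bracket (action_algebroid M F A \<phi> act) s t y = tensor_bracket_at A \<phi> act n h X m k Y y"
proof -
  have "(THE u. \<forall>U n h X m k Y. open U \<and> y \<in> U
        \<and> (\<forall>i<n. h i \<in> Cinf F \<and> X i \<in> sections M A)
        \<and> (\<forall>j<m. k j \<in> Cinf F \<and> Y j \<in> sections M A)
        \<and> (\<forall>z\<in>U. s z = tensor_section \<phi> n h X z)
        \<and> (\<forall>z\<in>U. t z = tensor_section \<phi> m k Y z)
        \<longrightarrow> u = tensor_bracket_at A \<phi> act n h X m k Y y)
      = tensor_bracket_at A \<phi> act n h X m k Y y"
  proof (rule the_equality, intro allI impI)
    fix U' n' h' X' m' k' Y'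
    assume a: "open U' \<and> y \<in> U'
        \<and> (\<forall>i<n'. h' i \<in> Cinf F \<and> X' i \<in> sections M A)
        \<and> (\<forall>j<m'. k' j \<in> Cinf F \<and> Y' j \<in> sections M A)
        \<and> (\<forall>z\<in>U'. s z = tensor_section \<phi> n' h' X' z)
        \<and> (\<forall>z\<in>U'. t z = tensor_section \<phi> m' k' Y' z)"
    then have UU: "open (U \<inter> U')" "y \<in> U \<inter> U'" using U by auto
    have h': "\<And>i. i < n' \<Longrightarrow> h' i \<in> Cinf F" and X': "\<And>i. i < n' \<Longrightarrow> X' i \<in> sections M A"
      and k': "\<And>j. j < m' \<Longrightarrow> k' j \<in> Cinf F" and Y': "\<And>j. j < m' \<Longrightarrow> Y' j \<in> sections M A"
      using a by blast+
    have "tensor_bracket_at A \<phi> act n h X m k Y y = tensor_bracket_at A \<phi> act n' h' X' m k Y y"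
      by (rule tensor_bracket_local_left[OF h X h' X' Y UU]) (use s a in force)+
    also have "\<dots> = - tensor_bracket_at A \<phi> act m k Y n' h' X' y"
      by (rule tensor_bracket_antisym[OF X' Y])
    also have "\<dots> = - tensor_bracket_at A \<phi> act m' k' Y' n' h' X' y"
      by (rule arg_cong[of _ _ uminus], rule tensor_bracket_local_left[OF k Y k' Y' X' UU])
        (use t a in force)+
    also have "\<dots> = tensor_bracket_at A \<phi> act n' h' X' m' k' Y' y"
      by (rule tensor_bracket_antisym[OF X' Y', symmetric])
    finally show "tensor_bracket_at A \<phi> act n h X m k Y y
      = tensor_bracket_at A \<phi> act n' h' X' m' k' Y' y" .
  next
    fix u
    assume "\<forall>U n h X m k Y. open U \<and> y \<in> U
        \<and> (\<forall>i<n. h i \<in> Cinf F \<and> X i \<in> sections M A)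
        \<and> (\<forall>j<m. k j \<in> Cinf F \<and> Y j \<in> sections M A)
        \<and> (\<forall>z\<in>U. s z = tensor_section \<phi> n h X z)
        \<and> (\<forall>z\<in>U. t z = tensor_section \<phi> m k Y z)
        \<longrightarrow> u = tensor_bracket_at A \<phi> act n h X m k Y y"
    from this[rule_format, of U n h X m k Y]
    show "u = tensor_bracket_at A \<phi> act n h X m k Y y"
      using U h X k Y s t by blast
  qed
  then show ?thesis by (simp add: action_algebroid_def)
qed

text \<open>Both arguments have the constant coefficient 1, on which the derivative terms of the
  formula vanish.\<close>

lemma action_bracket_pullback:
  assumes X: "X \<in> sections M A" and Y: "Y \<in> sections M A"
  shows "bracket (action_algebroid M F A \<phi> act) (\<lambda>y. X (\<phi> y)) (\<lambda>y. Y (\<phi> y)) y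
    = bracket A X Y (\<phi> y)"
proof -
  have "bracket (action_algebroid M F A \<phi> act) (\<lambda>y. X (\<phi> y)) (\<lambda>y. Y (\<phi> y)) y
      = tensor_bracket_at A \<phi> act 1 (\<lambda>_ _. 1) (\<lambda>_. X) 1 (\<lambda>_ _. 1) (\<lambda>_. Y) y"
    by (rule action_bracket[of UNIV]) (simp_all add: X Y Cinf_const tensor_section_def)
  then show ?thesis
    by (simp add: tensor_bracket_at_def tangent_const[OF F act_tangent] X Y)
qed

text \<open>The coefficients are cut-off coordinates and hence smooth on all of \<open>F\<close>;
  only the validity of the expression is confined to a neighbourhood, as the description of the
  bracket permits.\<close>

lemma local_tensor_expression:
  assumes s: "s \<in> sections F (action_algebroid M F A \<phi> act)"
  obtains U n h X where "open U" "y \<in> U" "\<And>i. h i \<in> Cinf F" "\<And>i. X i \<in> sections M A"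
    "\<And>z. z \<in> U \<Longrightarrow> s z = tensor_section \<phi> n h X z"
proof -
  obtain r N and c :: "nat \<Rightarrow> 'm \<Rightarrow> 'a \<Rightarrow> real" and e where
    "open N" "\<phi> y \<in> N" "\<forall>i. e i \<in> sections M A"
    "\<forall>z\<in>N. \<forall>u\<in>fib A z. (\<Sum>i<r. c i z u *\<^sub>R e i z) = u"
    "\<forall>i. \<forall>s\<in>sections F (pullback_bundle \<phi> A). (\<lambda>y. c i (\<phi> y) (s y)) \<in> Cinf F"
    by (rule local_coframe[OF M algebroid_vector_bundle F \<phi>, where x = "\<phi> y"])
  note c = this[rule_format]
  have "s z \<in> fib A (\<phi> z)" for z
    using section_in_fib[OF s] by (simp add: action_algebroid_simps)
  then show thesis
    using c s vimage_open[OF M algebroid_vector_bundle F \<phi> c(1)]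
    by (intro that[of "\<phi> -` N" "\<lambda>i y. c i (\<phi> y) (s y)" e r])
      (simp_all add: tensor_section_def sections_action)
qed

end


section \<open>Representations\<close>

lemma deriv_algebroid_bracket:
  "bracket (deriv_algebroid F E) D1 D2 y
    = ((\<lambda>\<psi>. fst (D1 y) (\<lambda>z. fst (D2 z) \<psi>) - fst (D2 y) (\<lambda>z. fst (D1 z) \<psi>)),
       vf_bracket (\<lambda>z. snd (D1 z)) (\<lambda>z. snd (D2 z)) y)"
  by (simp add: deriv_algebroid_def)

context
  fixes M :: "('m::{t2_space,second_countable_topology}, 'p::real_inner) atlas"
    and F :: "('f::{t2_space,second_countable_topology}, 'n::real_inner) atlas"
    and A :: "('m, 'k::real_inner, 'a::real_vector, 'z) algebroid_scheme"
    and E :: "('f, 'l::real_inner, 'e::real_vector, 'y) vbundle_scheme"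
    and \<phi> :: "'f \<Rightarrow> 'm"
    and act :: "('m \<Rightarrow> 'a) \<Rightarrow> 'f \<Rightarrow> 'f tangent"
  assumes M: "manifold M" and A: "lie_algebroid M A" and F: "manifold F"
    and \<phi>: "smooth_map F M \<phi>" and act: "infinitesimal_action M F A \<phi> act"
    and E: "vector_bundle F E"
begin

abbreviation (input) "AF \<equiv> action_algebroid M F A \<phi> act"

lemmas AV = algebroid_vector_bundle[OF M A F \<phi> act]
lemmas action_assms = M A F \<phi> act

section \<open>From representations to derivative representations\<close>

lemma representation_apply:
  assumes R: "R \<in> representations F AF E" and X: "X \<in> sections M A"
  shows "R y (X (\<phi> y)) \<in> deriv_fib F E y"
    and "snd (R y (X (\<phi> y))) = act X y"
    and "(\<lambda>y. R y (X (\<phi> y))) \<in> sections F (deriv_algebroid F E)"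
proof -
  have mor: "algebroid_morphism F AF (deriv_algebroid F E) R"
    using R by (simp add: representations_def)
  then have bm: "bundle_morphism F AF (deriv_algebroid F E) R"
    by (simp add: algebroid_morphism_def)
  have u: "X (\<phi> y) \<in> fib AF y" for y
    using section_in_fib[OF X] by (simp add: action_algebroid_simps[OF action_assms])
  show "R y (X (\<phi> y)) \<in> deriv_fib F E y"
    using bm u by (simp add: bundle_morphism_def deriv_algebroid_simps[OF F E])
  show "snd (R y (X (\<phi> y))) = act X y"
    using mor u action_anchor[OF action_assms X]
    by (simp add: algebroid_morphism_def deriv_algebroid_simps[OF F E])
  show "(\<lambda>y. R y (X (\<phi> y))) \<in> sections F (deriv_algebroid F E)"
    by (rule bundle_morphism_section[OF F action_vector_bundle[OF action_assms] bm _ _ _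
          action_section[OF action_assms X]]) (rule deriv_algebroid_triv[OF F E]; assumption)+
qed

lemma restrict_representation_apply:
  "X \<in> sections M A \<Longrightarrow> \<psi> \<in> sections F E
    \<Longrightarrow> restrict_representation M F A \<phi> E R X \<psi> = (\<lambda>y. fst (R y (X (\<phi> y))) \<psi>)"
  by (simp add: restrict_representation_def)

text \<open>\<open>R\<close> is a family of derivations at the points of \<open>F\<close> with
  prescribed symbols; the rules for the global operator are their rules, point by point.\<close>

lemma derivative_endomorphism_act:
  assumes X: "X \<in> sections M A" and D: "D \<in> extensional (sections F E)"
    and Dsec: "\<And>\<psi>. \<psi> \<in> sections F E \<Longrightarrow> D \<psi> \<in> sections F E"
    and R: "\<And>y. R y \<in> deriv_fib F E y" "\<And>y. snd (R y) = act X y"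
    and DR: "\<And>\<psi>. \<psi> \<in> sections F E \<Longrightarrow> D \<psi> = (\<lambda>y. fst (R y) \<psi>)"
  shows "derivative_endomorphism F E D (\<lambda>h y. act X y h)"
  unfolding derivative_endomorphism_def
proof (intro conjI ballI allI)
  note tan = act_tangent[OF action_assms X]
  show "D \<in> sections F E \<rightarrow>\<^sub>E sections F E"
    using D Dsec by (auto simp: PiE_def)
  show "(\<lambda>h y. act X y h) \<in> Cinf F \<rightarrow> Cinf F"
    using vector_field_apply_Cinf[OF F act_vector_field[OF action_assms X]] by auto
  show "(\<lambda>y. act X y (g + h)) = (\<lambda>y. act X y g) + (\<lambda>y. act X y h)"
    if "g \<in> Cinf F" "h \<in> Cinf F" for g h
    using tangent_add[OF F tan that] by (simp add: plus_fun_def)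
  show "(\<lambda>y. act X y (c *\<^sub>R h)) = c *\<^sub>R (\<lambda>y. act X y h)" if "h \<in> Cinf F" for c h
    using tangent_scale[OF F tan that] by (simp add: scaleR_fun_def)
  show "D (\<psi> + \<eta>) = D \<psi> + D \<eta>" if "\<psi> \<in> sections F E" "\<eta> \<in> sections F E" for \<psi> \<eta>
    by (simp add: DR that section_add[OF F E] deriv_fibD(3)[OF F E R(1)]
        plus_fun_def[of "\<lambda>y. fst (R y) \<psi>"])
  show "D (c *\<^sub>R \<psi>) = c *\<^sub>R D \<psi>" if "\<psi> \<in> sections F E" for c \<psi>
    by (simp add: DR that section_scale[OF F E] deriv_fibD(4)[OF F E R(1)]
        scaleR_fun_def[of c "\<lambda>y. fst (R y) \<psi>"])
  show "D (\<lambda>y. h y *\<^sub>R \<psi> y) = (\<lambda>y. h y *\<^sub>R D \<psi> y + act X y h *\<^sub>R \<psi> y)"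
    if "h \<in> Cinf F" "\<psi> \<in> sections F E" for h \<psi>
    by (simp add: DR that section_mult[OF F E] deriv_fibD(5)[OF F E R(1)] R(2))
qed

text \<open>Every condition is the one for \<open>R\<close>, evaluated on sections of the form
  \<open>1 \<otimes> X\<close>. These are closed under the bracket: that of
  \<open>1 \<otimes> X\<close> and \<open>1 \<otimes> Y\<close> is
  \<open>1 \<otimes> bracket A X Y\<close>.\<close>

lemma restrict_representation_into:
  assumes R: "R \<in> representations F AF E"
  shows "restrict_representation M F A \<phi> E R \<in> derivative_representations M F A \<phi> act E"
proof -
  let ?\<rho> = "restrict_representation M F A \<phi> E R"
  note app = representation_apply[OF R]
  note \<rho> = restrict_representation_apply
  have mor: "algebroid_morphism F AF (deriv_algebroid F E) R"
    using R by (simp add: representations_def)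
  then have bm: "bundle_morphism F AF (deriv_algebroid F E) R"
    by (simp add: algebroid_morphism_def)
  have Radd: "R y (u + v) = R y u + R y v" if "u \<in> fib A (\<phi> y)" "v \<in> fib A (\<phi> y)" for y u v
    using bm that by (simp add: bundle_morphism_def action_algebroid_simps[OF action_assms])
  have Rscale: "R y (c *\<^sub>R u) = c *\<^sub>R R y u" if "u \<in> fib A (\<phi> y)" for y u and c :: real
    using bm that by (simp add: bundle_morphism_def action_algebroid_simps[OF action_assms])
  have fibA: "X x \<in> fib A x" if "X \<in> sections M A" for X x
    using section_in_fib[OF that] .
  have sec: "(\<lambda>y. fst (R y (X (\<phi> y))) \<psi>) \<in> sections F E"
    if "X \<in> sections M A" "\<psi> \<in> sections F E" for X \<psi>
    by (rule deriv_section_apply[OF F E app(3)[OF that(1)] that(2)])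
  show ?thesis
    unfolding derivative_representations_def mem_Collect_eq
  proof (intro conjI ballI allI)
    show "?\<rho> \<in> extensional (sections M A)"
      by (simp add: restrict_representation_def)
    show "derivative_endomorphism F E (?\<rho> X) (\<lambda>h y. act X y h)" if "X \<in> sections M A" for X
      by (rule derivative_endomorphism_act[where R = "\<lambda>y. R y (X (\<phi> y))", OF that])
        (use that sec app \<rho> in \<open>simp_all add: restrict_representation_def\<close>)
    show "?\<rho> (X + Y) \<psi> = ?\<rho> X \<psi> + ?\<rho> Y \<psi>"
      if "X \<in> sections M A" "Y \<in> sections M A" "\<psi> \<in> sections F E" for X Y \<psi>
      by (simp add: \<rho> that section_add[OF M AV] Radd fibA fun_eq_iff)
    show "?\<rho> (c *\<^sub>R X) \<psi> = c *\<^sub>R ?\<rho> X \<psi>"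
      if "X \<in> sections M A" "\<psi> \<in> sections F E" for X c \<psi>
      by (simp add: \<rho> that section_scale[OF M AV] Rscale fibA fun_eq_iff scaleR_fun_apply)
    show "?\<rho> (\<lambda>x. f x *\<^sub>R X x) \<psi> = (\<lambda>y. f (\<phi> y) *\<^sub>R ?\<rho> X \<psi> y)"
      if "X \<in> sections M A" "f \<in> Cinf M" "\<psi> \<in> sections F E" for X f \<psi>
      by (simp add: \<rho> that section_mult[OF M AV] Rscale fibA fun_eq_iff scaleR_fun_apply)
    show "?\<rho> (bracket A X Y) \<psi> = ?\<rho> X (?\<rho> Y \<psi>) - ?\<rho> Y (?\<rho> X \<psi>)"
      if X: "X \<in> sections M A" and Y: "Y \<in> sections M A" and \<psi>: "\<psi> \<in> sections F E" for X Y \<psi>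
    proof
      fix y
      have "(\<lambda>y. R y (bracket AF (\<lambda>y. X (\<phi> y)) (\<lambda>y. Y (\<phi> y)) y))
          = bracket (deriv_algebroid F E) (\<lambda>y. R y (X (\<phi> y))) (\<lambda>y. R y (Y (\<phi> y)))"
        using mor action_section[OF action_assms X] action_section[OF action_assms Y]
        unfolding algebroid_morphism_def by blast
      then have "R y (bracket A X Y (\<phi> y))
          = bracket (deriv_algebroid F E) (\<lambda>y. R y (X (\<phi> y))) (\<lambda>y. R y (Y (\<phi> y))) y"
        by (simp add: action_bracket_pullback[OF action_assms X Y] fun_eq_iff)
      then show "?\<rho> (bracket A X Y) \<psi> y = (?\<rho> X (?\<rho> Y \<psi>) - ?\<rho> Y (?\<rho> X \<psi>)) y"
        by (simp add: \<rho> X Y \<psi> sec bracket_section[OF action_assms] deriv_algebroid_bracket)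
    qed
  qed
qed

text \<open>Values of global sections exhaust each fibre, so the operator part is recovered from the
  restriction. The restriction forgets the symbol, but the anchor condition fixes it as
  \<open>act X y\<close>.\<close>

lemma restrict_representation_inj:
  "inj_on (restrict_representation M F A \<phi> E) (representations F AF E)"
proof (intro inj_onI ext)
  fix R S y u
  assume R: "R \<in> representations F AF E" and S: "S \<in> representations F AF E"
    and eq: "restrict_representation M F A \<phi> E R = restrict_representation M F A \<phi> E S"
  show "R y u = S y u"
  proof (cases "u \<in> fib A (\<phi> y)")
    case True
    then obtain X where X: "X \<in> sections M A" "X (\<phi> y) = u"
      using section_through[OF M AV] by blast
    have "R y (X (\<phi> y)) = S y (X (\<phi> y))"
    proof (rule deriv_fib_eqI[OF F E representation_apply(1)[OF R X(1)]
          representation_apply(1)[OF S X(1)]])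
      show "snd (R y (X (\<phi> y))) = snd (S y (X (\<phi> y)))"
        by (simp add: representation_apply(2)[OF R X(1)] representation_apply(2)[OF S X(1)])
      fix \<psi> assume \<psi>: "\<psi> \<in> sections F E"
      show "fst (R y (X (\<phi> y))) \<psi> = fst (S y (X (\<phi> y))) \<psi>"
        using fun_cong[OF fun_cong[OF fun_cong[OF eq, of X], of \<psi>], of y]
        by (simp add: restrict_representation_apply X(1) \<psi>)
    qed
    then show ?thesis by (simp add: X(2))
  next
    case False
    moreover have "R y \<in> extensional (fib A (\<phi> y))" "S y \<in> extensional (fib A (\<phi> y))"
      using R S by (simp_all add: representations_def action_algebroid_simps[OF action_assms])
    ultimately show ?thesis by (simp add: extensional_def)
  qed
qed

section \<open>From derivative representations to representations\<close>

context
  fixes \<rho> :: "('m \<Rightarrow> 'a) \<Rightarrow> ('f \<Rightarrow> 'e) \<Rightarrow> 'f \<Rightarrow> 'e"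
  assumes \<rho>: "\<rho> \<in> derivative_representations M F A \<phi> act E"
begin

text \<open>The inverse of the restriction. The section through \<open>u\<close> is chosen
  arbitrarily; \<open>extend_rep_eq\<close> removes the choice. The value 0 off the sections is the
  normalization required by \<open>deriv_fib\<close>.\<close>

definition extend_rep :: "'f \<Rightarrow> 'a \<Rightarrow> ('f, 'e) deriv_point" where
  "extend_rep y = (\<lambda>u\<in>fib A (\<phi> y). let X = (SOME X. X \<in> sections M A \<and> X (\<phi> y) = u) in
     (\<lambda>\<psi>. if \<psi> \<in> sections F E then \<rho> X \<psi> y else 0, act X y))"

lemma rep_endomorphism:
  "X \<in> sections M A \<Longrightarrow> derivative_endomorphism F E (\<rho> X) (\<lambda>h y. act X y h)"
  using \<rho> by (simp add: derivative_representations_def)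

lemma rep_add: "X \<in> sections M A \<Longrightarrow> Y \<in> sections M A \<Longrightarrow> \<psi> \<in> sections F E
    \<Longrightarrow> \<rho> (X + Y) \<psi> = \<rho> X \<psi> + \<rho> Y \<psi>"
  using \<rho> by (simp add: derivative_representations_def)

lemma rep_scale: "X \<in> sections M A \<Longrightarrow> \<psi> \<in> sections F E \<Longrightarrow> \<rho> (c *\<^sub>R X) \<psi> = c *\<^sub>R \<rho> X \<psi>"
  using \<rho> by (simp add: derivative_representations_def)

lemma rep_bracket: "X \<in> sections M A \<Longrightarrow> Y \<in> sections M A \<Longrightarrow> \<psi> \<in> sections F E
    \<Longrightarrow> \<rho> (bracket A X Y) \<psi> = \<rho> X (\<rho> Y \<psi>) - \<rho> Y (\<rho> X \<psi>)"
  using \<rho> by (simp add: derivative_representations_def)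

lemma rep_mult: "X \<in> sections M A \<Longrightarrow> f \<in> Cinf M \<Longrightarrow> \<psi> \<in> sections F E
    \<Longrightarrow> \<rho> (\<lambda>x. f x *\<^sub>R X x) \<psi> = (\<lambda>y. f (\<phi> y) *\<^sub>R \<rho> X \<psi> y)"
  using \<rho> by (simp add: derivative_representations_def)

lemma rep_section: "X \<in> sections M A \<Longrightarrow> \<psi> \<in> sections F E \<Longrightarrow> \<rho> X \<psi> \<in> sections F E"
  using rep_endomorphism[of X] unfolding derivative_endomorphism_def by (auto simp: PiE_iff)

lemma rep_tensorial:
  assumes "X \<in> sections M A" "Y \<in> sections M A" "X (\<phi> y) = Y (\<phi> y)" "\<psi> \<in> sections F E"
  shows "\<rho> X \<psi> y = \<rho> Y \<psi> y"
  by (rule point_operator_tensorial[OF M AV, of "\<phi> y" "\<lambda>X. \<rho> X \<psi> y"])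
    (simp_all add: point_operator_def rep_add rep_mult assms)

lemma extend_rep_eq:
  assumes X: "X \<in> sections M A"
  shows "extend_rep y (X (\<phi> y)) = (\<lambda>\<psi>. if \<psi> \<in> sections F E then \<rho> X \<psi> y else 0, act X y)"
proof -
  define Z where "Z = (SOME Z. Z \<in> sections M A \<and> Z (\<phi> y) = X (\<phi> y))"
  have Z: "Z \<in> sections M A \<and> Z (\<phi> y) = X (\<phi> y)"
    unfolding Z_def by (rule someI[of _ X]) (simp add: X)
  have "extend_rep y (X (\<phi> y)) = (\<lambda>\<psi>. if \<psi> \<in> sections F E then \<rho> Z \<psi> y else 0, act Z y)"
    using section_in_fib[OF X] unfolding extend_rep_def Z_def by (simp add: Let_def)
  also have "\<dots> = (\<lambda>\<psi>. if \<psi> \<in> sections F E then \<rho> X \<psi> y else 0, act X y)"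
    using Z X act_tensorial[OF action_assms, of Z X y] by (auto simp: fun_eq_iff intro!: rep_tensorial)
  finally show ?thesis .
qed

lemma fst_extend_rep:
  "X \<in> sections M A \<Longrightarrow> \<psi> \<in> sections F E \<Longrightarrow> fst (extend_rep y (X (\<phi> y))) \<psi> = \<rho> X \<psi> y"
  by (simp add: extend_rep_eq)

lemma snd_extend_rep: "X \<in> sections M A \<Longrightarrow> snd (extend_rep y (X (\<phi> y))) = act X y"
  by (simp add: extend_rep_eq)

lemma section_through_base:
  assumes "u \<in> fib A (\<phi> y)"
  obtains X where "X \<in> sections M A" "u = X (\<phi> y)"
  using section_through[OF M AV assms] by blast

lemma extend_rep_fib:
  assumes X: "X \<in> sections M A"
  shows "extend_rep y (X (\<phi> y)) \<in> deriv_fib F E y"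
  using rep_endomorphism[OF X] act_tangent[OF action_assms X, of y]
  unfolding derivative_endomorphism_def extend_rep_eq[OF X] deriv_fib_def
  by (auto simp: PiE_iff scaleR_fun_apply section_add[OF F E] section_scale[OF F E]
      section_mult[OF F E] section_in_fib[of _ F E])

lemma extend_rep_in_fib: "u \<in> fib A (\<phi> y) \<Longrightarrow> extend_rep y u \<in> deriv_fib F E y"
  using section_through_base extend_rep_fib by metis

lemma extend_rep_add:
  assumes "u \<in> fib A (\<phi> y)" "v \<in> fib A (\<phi> y)"
  shows "extend_rep y (u + v) = extend_rep y u + extend_rep y v"
proof -
  obtain X Y where X: "X \<in> sections M A" "u = X (\<phi> y)" and Y: "Y \<in> sections M A" "v = Y (\<phi> y)"
    using section_through_base assms by metis
  show ?thesis
    using extend_rep_eq[OF section_add[OF M AV X(1) Y(1)], of y]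
    by (auto simp: X Y extend_rep_eq rep_add act_add[OF action_assms] fun_eq_iff)
qed

lemma extend_rep_scale:
  assumes "u \<in> fib A (\<phi> y)"
  shows "extend_rep y (c *\<^sub>R u) = c *\<^sub>R extend_rep y u"
proof -
  obtain X where X: "X \<in> sections M A" "u = X (\<phi> y)"
    using section_through_base assms by metis
  show ?thesis
    using extend_rep_eq[OF section_scale[OF M AV X(1), of c], of y]
    by (auto simp: X extend_rep_eq rep_scale act_scale[OF action_assms] fun_eq_iff scaleR_fun_apply)
qed

lemma extend_rep_sum:
  assumes "\<And>i. i \<in> I \<Longrightarrow> u i \<in> fib A (\<phi> y)"
  shows "extend_rep y (\<Sum>i\<in>I. u i) = (\<Sum>i\<in>I. extend_rep y (u i))"
  using assms
proof (induction I rule: infinite_finite_induct)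
  case (insert i I)
  have "(\<Sum>i\<in>I. u i) \<in> fib A (\<phi> y)"
    using insert by (intro subspace_sum fib_subspace[OF M AV]) auto
  then show ?case using insert by (simp add: extend_rep_add)
qed (use extend_rep_scale[OF fib_0[OF M AV], of _ 0] in simp_all)

lemma extend_rep_morphism: "bundle_morphism F AF (deriv_algebroid F E) extend_rep"
  unfolding bundle_morphism_def action_algebroid_simps[OF action_assms] deriv_algebroid_simps[OF F E]
proof (intro conjI allI ballI)
  show "extend_rep y u \<in> deriv_fib F E y" if "u \<in> fib A (\<phi> y)" for y u
    using that by (rule extend_rep_in_fib)
  show "extend_rep y (u + v) = extend_rep y u + extend_rep y v"
    if "u \<in> fib A (\<phi> y)" "v \<in> fib A (\<phi> y)" for y u v
    using that by (rule extend_rep_add)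
  show "extend_rep y (c *\<^sub>R u) = c *\<^sub>R extend_rep y u" if "u \<in> fib A (\<phi> y)" for y u c
    using that by (rule extend_rep_scale)
next
  have main: "smooth_fun_on F (\<phi> -` T \<inter> (U \<inter> V))
      (\<lambda>y. inv (deriv_triv F E (U, \<kappa>) (V, \<sigma>) y) (extend_rep y (\<tau> (\<phi> y) w)))"
    if a: "(T, \<tau>) \<in> triv A" and c: "(U, \<kappa>) \<in> F" and t: "(V, \<sigma>) \<in> triv E" for T \<tau> U \<kappa> V \<sigma> w
  proof (rule smooth_fun_on_local[OF F])
    fix y0 assume y0: "y0 \<in> \<phi> -` T \<inter> (U \<inter> V)"
    then have "\<phi> y0 \<in> T" "y0 \<in> V" by auto
    obtain N1 where N1: "open N1" "\<phi> y0 \<in> N1" "N1 \<subseteq> T"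
      "\<forall>w. \<exists>X\<in>sections M A. \<forall>z\<in>N1. X z = \<tau> z w"
      by (rule local_frame_section[OF M AV a \<open>\<phi> y0 \<in> T\<close>])
    obtain N2 where N2: "open N2" "y0 \<in> N2" "N2 \<subseteq> V"
      "\<forall>w. \<exists>X\<in>sections F E. \<forall>z\<in>N2. X z = \<sigma> z w"
      by (rule local_frame_section[OF F E t \<open>y0 \<in> V\<close>])
    \<comment> \<open>Near \<open>\<phi> y0\<close> the frame vector \<open>\<tau> z w\<close> is
      the value of a global section, along which \<open>extend_rep\<close> is given by
      \<open>\<rho> X\<close> and \<open>act X\<close>; these are smooth by assumption.\<close>
    obtain X where X: "X \<in> sections M A" "\<And>z. z \<in> N1 \<Longrightarrow> X z = \<tau> z w"
      using N1(4) by blast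
    obtain n and b :: "nat \<Rightarrow> 'l" where b: "parseval_frame n b"
      using finite_dim_parseval_frame[OF finite_dim_fibre[OF F E]] by blast
    obtain S where "\<And>w. S w \<in> sections F E \<and> (\<forall>z\<in>N2. S w z = \<sigma> z w)"
      using choice[OF N2(4)[unfolded Bex_def]] by blast
    then have S: "\<And>i. S (b i) \<in> sections F E" "\<And>i z. z \<in> N2 \<Longrightarrow> S (b i) z = \<sigma> z (b i)"
      by simp_all
    define W where "W = \<phi> -` N1 \<inter> (U \<inter> N2)"
    have W: "open W" "W \<subseteq> U \<inter> V" "W \<subseteq> U" "W \<subseteq> V" "y0 \<in> W" "W \<subseteq> N2"
      using N1 N2 y0 vimage_open[OF M AV F \<phi> N1(1)] chart_open[OF F c] by (auto simp: W_def)
    have S2: "\<And>i z. z \<in> W \<Longrightarrow> S (b i) z = \<sigma> z (b i)"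
      using S(2) W(6) by blast
    have "smooth_fun_on F W
        (\<lambda>y. inv (deriv_triv F E (U, \<kappa>) (V, \<sigma>) y) (extend_rep y (X (\<phi> y))))"
    proof (rule smooth_deriv_coordinates[OF F E c t W(1,2) b S(1) S2 extend_rep_fib[OF X(1)]])
      show "smooth_fun_on F W (\<lambda>y. inv (chart_vector F (U, \<kappa>) y) (snd (extend_rep y (X (\<phi> y)))))"
        using smooth_fun_on_subset[OF vector_field_smooth_coordinates[OF F
              act_vector_field[OF action_assms X(1)] c] W(3)]
        by (simp add: snd_extend_rep X(1))
      show "smooth_fun_on F W (\<lambda>y. inv (\<sigma> y) (fst (extend_rep y (X (\<phi> y))) (S (b i))))" for i
        using smooth_fun_on_subset[OF section_smooth[OF rep_section[OF X(1) S(1)] t] W(4)]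
        by (simp add: fst_extend_rep X(1) S(1))
    qed
    then have "smooth_fun_on F W
        (\<lambda>y. inv (deriv_triv F E (U, \<kappa>) (V, \<sigma>) y) (extend_rep y (\<tau> (\<phi> y) w)))"
      by (rule smooth_fun_on_cong[OF F W(1)]) (simp add: X(2) W_def)
    then show "\<exists>N. open N \<and> y0 \<in> N \<and> smooth_fun_on F N
        (\<lambda>y. inv (deriv_triv F E (U, \<kappa>) (V, \<sigma>) y) (extend_rep y (\<tau> (\<phi> y) w)))"
      using W by blast
  qed
  show "case p of (U, \<tau>) \<Rightarrow> \<forall>(V, \<sigma>)\<in>{(U \<inter> V, deriv_triv F E (U, \<kappa>) (V, \<tau>)) |U \<kappa> V \<tau>.
      (U, \<kappa>) \<in> F \<and> (V, \<tau>) \<in> triv E}.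
      \<forall>w. smooth_fun_on F (U \<inter> V) (\<lambda>x. inv (\<sigma> x) (extend_rep x (\<tau> x w)))"
    if "p \<in> triv (pullback_bundle \<phi> A)" for p
    using that main by (auto simp: pullback_bundle_def)
qed

lemma extend_rep_tensor_section:
  assumes "\<And>i. i < n \<Longrightarrow> X i \<in> sections M A"
  shows "extend_rep z (tensor_section \<phi> n h X z) = (\<Sum>i<n. h i z *\<^sub>R extend_rep z (X i (\<phi> z)))"
  unfolding tensor_section_def
  using assms extend_rep_sum[of "{..<n}" "\<lambda>i. h i z *\<^sub>R X i (\<phi> z)" z]
  by (simp add: fib_scale[OF M AV] section_in_fib[of _ M A] extend_rep_scale)

lemma fst_extend_rep_tensor:
  assumes "\<And>i. i < n \<Longrightarrow> X i \<in> sections M A" "\<psi> \<in> sections F E"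
  shows "fst (extend_rep z (tensor_section \<phi> n h X z)) \<psi> = (\<Sum>i<n. h i z *\<^sub>R \<rho> (X i) \<psi> z)"
  by (simp add: extend_rep_tensor_section assms fst_sum sum_fun_apply scaleR_fun_apply
      fst_extend_rep)

lemma snd_extend_rep_tensor:
  assumes "\<And>i. i < n \<Longrightarrow> X i \<in> sections M A"
  shows "snd (extend_rep z (tensor_section \<phi> n h X z)) f = (\<Sum>i<n. h i z * act (X i) z f)"
  by (simp add: extend_rep_tensor_section assms snd_sum sum_fun_apply scaleR_fun_apply
      snd_extend_rep)

lemma extend_rep_section:
  assumes "s \<in> sections F AF"
  shows "(\<lambda>z. extend_rep z (s z)) \<in> sections F (deriv_algebroid F E)"
  by (rule bundle_morphism_section[OF F action_vector_bundle[OF action_assms] extend_rep_morphism _ _ _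
        assms]) (rule deriv_algebroid_triv[OF F E]; assumption)+

text \<open>Linearity of \<open>extend_rep\<close> is available on the fibre only, so membership in
  the fibre is tracked for every term of the double sum.\<close>

lemma extend_rep_tensor_bracket:
  assumes X: "\<And>i. i < n \<Longrightarrow> X i \<in> sections M A" and Y: "\<And>j. j < m \<Longrightarrow> Y j \<in> sections M A"
  shows "extend_rep y (tensor_bracket_at A \<phi> act n h X m k Y y)
    = (\<Sum>i<n. \<Sum>j<m. (h i y * k j y) *\<^sub>R extend_rep y (bracket A (X i) (Y j) (\<phi> y))
        + (h i y * act (X i) y (k j)) *\<^sub>R extend_rep y (Y j (\<phi> y))
        - (k j y * act (Y j) y (h i)) *\<^sub>R extend_rep y (X i (\<phi> y)))"
proof -
  note fibX = section_in_fib[of _ M A]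
  have diff: "extend_rep y (u - v) = extend_rep y u - extend_rep y v"
    if "u \<in> fib A (\<phi> y)" "v \<in> fib A (\<phi> y)" for u v
    using extend_rep_add[OF that(1) fib_scale[OF M AV that(2)], of "-1"]
      extend_rep_scale[OF that(2), of "-1"] by simp
  have sub: "u - v \<in> fib A (\<phi> y)" if "u \<in> fib A (\<phi> y)" "v \<in> fib A (\<phi> y)" for u v
    using fib_subspace[OF M AV] that by (rule subspace_diff)
  define T where "T i j = (h i y * k j y) *\<^sub>R bracket A (X i) (Y j) (\<phi> y)
        + (h i y * act (X i) y (k j)) *\<^sub>R Y j (\<phi> y)
        - (k j y * act (Y j) y (h i)) *\<^sub>R X i (\<phi> y)" for i j
  have val: "bracket A (X i) (Y j) (\<phi> y) \<in> fib A (\<phi> y)" "Y j (\<phi> y) \<in> fib A (\<phi> y)"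
    "X i (\<phi> y) \<in> fib A (\<phi> y)" if "i < n" "j < m" for i j
    using that by (auto intro!: fibX bracket_section[OF action_assms] X Y)
  have mem: "(h i y * k j y) *\<^sub>R bracket A (X i) (Y j) (\<phi> y) \<in> fib A (\<phi> y)"
    "(h i y * act (X i) y (k j)) *\<^sub>R Y j (\<phi> y) \<in> fib A (\<phi> y)"
    "(k j y * act (Y j) y (h i)) *\<^sub>R X i (\<phi> y) \<in> fib A (\<phi> y)" if "i < n" "j < m" for i j
    using val[OF that] by (simp_all add: fib_scale[OF M AV])
  have T_fib: "T i j \<in> fib A (\<phi> y)" if "i < n" "j < m" for i j
    unfolding T_def by (intro sub fib_add[OF M AV] mem that)
  have T_ext: "extend_rep y (T i j) = (h i y * k j y) *\<^sub>R extend_rep y (bracket A (X i) (Y j) (\<phi> y))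
        + (h i y * act (X i) y (k j)) *\<^sub>R extend_rep y (Y j (\<phi> y))
        - (k j y * act (Y j) y (h i)) *\<^sub>R extend_rep y (X i (\<phi> y))" if "i < n" "j < m" for i j
    unfolding T_def using val[OF that]
    by (simp add: diff[OF fib_add[OF M AV mem(1,2)[OF that]] mem(3)[OF that]]
        extend_rep_add[OF mem(1,2)[OF that]] extend_rep_scale)
  have "extend_rep y (\<Sum>i<n. \<Sum>j<m. T i j) = (\<Sum>i<n. extend_rep y (\<Sum>j<m. T i j))"
    by (rule extend_rep_sum) (use T_fib in \<open>auto intro!: subspace_sum fib_subspace[OF M AV]\<close>)
  also have "\<dots> = (\<Sum>i<n. \<Sum>j<m. extend_rep y (T i j))"
    by (intro sum.cong refl extend_rep_sum) (use T_fib in auto)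
  finally show ?thesis
    by (simp add: tensor_bracket_at_def T_def[symmetric] T_ext)
qed

text \<open>Derivations P and Q satisfy [h P, k Q] = h k [P, Q] + h P(k) Q - k Q(h) P, which has the
  shape of the bracket formula on tensors. With both sections written as sums of tensors near
  \<open>y\<close>, the operator parts agree because \<open>\<rho>\<close> respects brackets, and
  the symbols because the action does.\<close>

lemma extend_rep_bracket:
  assumes s: "s \<in> sections F AF" and t: "t \<in> sections F AF"
  shows "extend_rep y (bracket AF s t y)
    = bracket (deriv_algebroid F E) (\<lambda>z. extend_rep z (s z)) (\<lambda>z. extend_rep z (t z)) y"
proof -
  let ?Ds = "\<lambda>z. extend_rep z (s z)" and ?Dt = "\<lambda>z. extend_rep z (t z)"
  have fib: "u z \<in> fib A (\<phi> z)" if "u \<in> sections F AF" for u z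
    using section_in_fib[OF that] by (simp add: action_algebroid_simps[OF action_assms])
  have Dfib: "extend_rep z (u z) \<in> deriv_fib F E z" if "u \<in> sections F AF" for u z
    by (rule extend_rep_in_fib[OF fib[OF that]])
  obtain U n h X where U: "open U" "y \<in> U" "\<And>i. h i \<in> Cinf F" "\<And>i. X i \<in> sections M A"
    "\<And>z. z \<in> U \<Longrightarrow> s z = tensor_section \<phi> n h X z"
    using local_tensor_expression[OF action_assms s, of y] by metis
  obtain V m k Y where V: "open V" "y \<in> V" "\<And>i. k i \<in> Cinf F" "\<And>i. Y i \<in> sections M A"
    "\<And>z. z \<in> V \<Longrightarrow> t z = tensor_section \<phi> m k Y z"
    using local_tensor_expression[OF action_assms t, of y] by metis
  have br: "bracket AF s t y = tensor_bracket_at A \<phi> act n h X m k Y y"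
    by (rule action_bracket[OF action_assms, of "U \<inter> V"]) (use U V in auto)
  have lhs: "extend_rep y (bracket AF s t y)
      = (\<Sum>i<n. \<Sum>j<m. (h i y * k j y) *\<^sub>R extend_rep y (bracket A (X i) (Y j) (\<phi> y))
        + (h i y * act (X i) y (k j)) *\<^sub>R extend_rep y (Y j (\<phi> y))
        - (k j y * act (Y j) y (h i)) *\<^sub>R extend_rep y (X i (\<phi> y)))"
    unfolding br by (rule extend_rep_tensor_bracket[OF U(4) V(4)])
  note act_fib = act_tangent[OF action_assms]
  have act_C: "(\<lambda>z. act X z f) \<in> Cinf F" if "X \<in> sections M A" "f \<in> Cinf F" for X f
    by (rule vector_field_apply_Cinf[OF F act_vector_field[OF action_assms that(1)] that(2)])
  text \<open>One half of the commutator; the other half is the same with the two sections exchanged.\<close>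
  have half_fst: "fst (extend_rep y (u y)) (\<lambda>z. fst (extend_rep z (v z)) \<psi>)
      = (\<Sum>i<n. \<Sum>j<m. (h i y * k j y) *\<^sub>R \<rho> (X i) (\<rho> (Y j) \<psi>) y
          + (h i y * act (X i) y (k j)) *\<^sub>R \<rho> (Y j) \<psi> y)"
    if \<psi>: "\<psi> \<in> sections F E" and u: "u \<in> sections F AF" and v: "v \<in> sections F AF"
      and U: "y \<in> U" "\<And>z. z \<in> U \<Longrightarrow> u z = tensor_section \<phi> n h X z"
      and V: "open V" "y \<in> V" "\<And>z. z \<in> V \<Longrightarrow> v z = tensor_section \<phi> m k Y z"
      and k: "\<And>j. k j \<in> Cinf F" and X: "\<And>i. X i \<in> sections M A" and Y: "\<And>j. Y j \<in> sections M A"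
    for \<psi> u v U V n m and h k :: "nat \<Rightarrow> 'f \<Rightarrow> real" and X Y
  proof -
    note D = Dfib[OF u, of y]
    have kr: "(\<lambda>z. k j z *\<^sub>R \<rho> (Y j) \<psi> z) \<in> sections F E" for j
      by (intro section_mult[OF F E] k rep_section Y \<psi>)
    \<comment> \<open>The tensor expression of \<open>v\<close> is valid near \<open>y\<close> only,
      while a derivation acts on global sections. Since the coefficients \<open>k j\<close> are
      global, the sum is a section, and locality of the derivation permits the replacement.\<close>
    have "fst (extend_rep y (u y)) (\<lambda>z. fst (extend_rep z (v z)) \<psi>)
        = fst (extend_rep y (u y)) (\<Sum>j<m. (\<lambda>z. k j z *\<^sub>R \<rho> (Y j) \<psi> z))"
      by (rule point_operator_local[OF F E deriv_fib_point_operator[OF F E D]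
            deriv_section_apply[OF F E extend_rep_section[OF v] \<psi>] section_sum[OF F E kr] V(1,2)])
        (simp add: V(3) fst_extend_rep_tensor[OF Y \<psi>] sum_fun_apply)
    also have "\<dots> = (\<Sum>j<m. fst (extend_rep y (u y)) (\<lambda>z. k j z *\<^sub>R \<rho> (Y j) \<psi> z))"
      by (rule point_operator_sum[OF F E deriv_fib_point_operator[OF F E D] kr])
    also have "\<dots> = (\<Sum>j<m. k j y *\<^sub>R fst (extend_rep y (u y)) (\<rho> (Y j) \<psi>)
        + snd (extend_rep y (u y)) (k j) *\<^sub>R \<rho> (Y j) \<psi> y)"
      by (simp add: deriv_fibD(5)[OF F E D] k rep_section Y \<psi>)
    also have "\<dots> = (\<Sum>j<m. \<Sum>i<n. (h i y * k j y) *\<^sub>R \<rho> (X i) (\<rho> (Y j) \<psi>) y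
          + (h i y * act (X i) y (k j)) *\<^sub>R \<rho> (Y j) \<psi> y)"
      unfolding U(2)[OF U(1)]
      by (simp add: fst_extend_rep_tensor[OF X] snd_extend_rep_tensor[OF X] rep_section Y \<psi>
          scaleR_sum_right scaleR_sum_left sum.distrib mult.commute)
    also have "\<dots> = (\<Sum>i<n. \<Sum>j<m. (h i y * k j y) *\<^sub>R \<rho> (X i) (\<rho> (Y j) \<psi>) y
          + (h i y * act (X i) y (k j)) *\<^sub>R \<rho> (Y j) \<psi> y)"
      by (rule sum.swap)
    finally show ?thesis .
  qed
  have half_snd: "snd (extend_rep y (u y)) (\<lambda>z. snd (extend_rep z (v z)) f)
      = (\<Sum>i<n. \<Sum>j<m. h i y * k j y * act (X i) y (\<lambda>z. act (Y j) z f)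
          + h i y * act (X i) y (k j) * act (Y j) y f)"
    if f: "f \<in> Cinf F" and u: "u \<in> sections F AF" and v: "v \<in> sections F AF"
      and U: "y \<in> U" "\<And>z. z \<in> U \<Longrightarrow> u z = tensor_section \<phi> n h X z"
      and V: "open V" "y \<in> V" "\<And>z. z \<in> V \<Longrightarrow> v z = tensor_section \<phi> m k Y z"
      and k: "\<And>j. k j \<in> Cinf F" and X: "\<And>i. X i \<in> sections M A" and Y: "\<And>j. Y j \<in> sections M A"
    for f u v U V n m and h k :: "nat \<Rightarrow> 'f \<Rightarrow> real" and X Y
  proof -
    have "(\<lambda>z. snd (extend_rep z (v z))) \<in> vector_fields F"
      using deriv_section_snd[OF F E extend_rep_section[OF v]] .
    then have Cv: "(\<lambda>z. snd (extend_rep z (v z)) f) \<in> Cinf F"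
      by (rule vector_field_apply_Cinf[OF F _ f])
    have Ck: "(\<lambda>z. k j z * act (Y j) z f) \<in> Cinf F" for j
      by (intro Cinf_mult[OF F] k act_C Y f)
    have tan: "snd (extend_rep y (u y)) \<in> fib (tangent_bundle F) y"
      by (rule deriv_fibD(1)[OF F E Dfib[OF u]])
    have "snd (extend_rep y (u y)) (\<lambda>z. snd (extend_rep z (v z)) f)
        = snd (extend_rep y (u y)) (\<lambda>z. \<Sum>j<m. k j z * act (Y j) z f)"
      by (rule tangent_local[OF F tan Cv Cinf_sum[OF F Ck] V(1,2)])
        (simp add: V(3) snd_extend_rep_tensor[OF Y])
    also have "\<dots> = (\<Sum>j<m. k j y * snd (extend_rep y (u y)) (\<lambda>z. act (Y j) z f)
        + snd (extend_rep y (u y)) (k j) * act (Y j) y f)"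
      by (simp add: tangent_sum[OF F tan Ck] tangent_mult[OF F tan k act_C[OF Y f]])
    also have "\<dots> = (\<Sum>j<m. \<Sum>i<n. h i y * k j y * act (X i) y (\<lambda>z. act (Y j) z f)
          + h i y * act (X i) y (k j) * act (Y j) y f)"
      unfolding U(2)[OF U(1)]
      by (simp add: snd_extend_rep_tensor[OF X] sum_distrib_left sum_distrib_right sum.distrib
          mult_ac)
    also have "\<dots> = (\<Sum>i<n. \<Sum>j<m. h i y * k j y * act (X i) y (\<lambda>z. act (Y j) z f)
          + h i y * act (X i) y (k j) * act (Y j) y f)"
      by (rule sum.swap)
    finally show ?thesis .
  qed
  show ?thesis
    unfolding deriv_algebroid_bracket
  proof (intro prod_eqI ext)
    fix \<psi>
    show "fst (extend_rep y (bracket AF s t y)) \<psi>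
      = fst (\<lambda>\<psi>. fst (?Ds y) (\<lambda>z. fst (?Dt z) \<psi>) - fst (?Dt y) (\<lambda>z. fst (?Ds z) \<psi>),
          vf_bracket (\<lambda>z. snd (?Ds z)) (\<lambda>z. snd (?Dt z)) y) \<psi>"
    proof (cases "\<psi> \<in> sections F E")
      case True
      have e1: "fst (?Ds y) (\<lambda>z. fst (?Dt z) \<psi>)
          = (\<Sum>i<n. \<Sum>j<m. (h i y * k j y) *\<^sub>R \<rho> (X i) (\<rho> (Y j) \<psi>) y
              + (h i y * act (X i) y (k j)) *\<^sub>R \<rho> (Y j) \<psi> y)"
        by (rule half_fst[OF True s t U(2,5) V(1,2,5) V(3) U(4) V(4)])
      have e2: "fst (?Dt y) (\<lambda>z. fst (?Ds z) \<psi>)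
          = (\<Sum>j<m. \<Sum>i<n. (k j y * h i y) *\<^sub>R \<rho> (Y j) (\<rho> (X i) \<psi>) y
              + (k j y * act (Y j) y (h i)) *\<^sub>R \<rho> (X i) \<psi> y)"
        by (rule half_fst[OF True t s V(2,5) U(1,2,5) U(3) V(4) U(4)])
      have "fst (?Ds y) (\<lambda>z. fst (?Dt z) \<psi>) - fst (?Dt y) (\<lambda>z. fst (?Ds z) \<psi>)
          = (\<Sum>i<n. \<Sum>j<m. (h i y * k j y) *\<^sub>R \<rho> (X i) (\<rho> (Y j) \<psi>) y
              + (h i y * act (X i) y (k j)) *\<^sub>R \<rho> (Y j) \<psi> y)
            - (\<Sum>i<n. \<Sum>j<m. (k j y * h i y) *\<^sub>R \<rho> (Y j) (\<rho> (X i) \<psi>) y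
              + (k j y * act (Y j) y (h i)) *\<^sub>R \<rho> (X i) \<psi> y)"
        unfolding e1 e2 by (subst (2) sum.swap) (rule refl)
      moreover have "fst (extend_rep y (bracket AF s t y)) \<psi>
          = (\<Sum>i<n. \<Sum>j<m. ((h i y * k j y) *\<^sub>R \<rho> (X i) (\<rho> (Y j) \<psi>) y
              + (h i y * act (X i) y (k j)) *\<^sub>R \<rho> (Y j) \<psi> y)
            - ((k j y * h i y) *\<^sub>R \<rho> (Y j) (\<rho> (X i) \<psi>) y
              + (k j y * act (Y j) y (h i)) *\<^sub>R \<rho> (X i) \<psi> y))"
        unfolding lhs fst_sum sum_fun_apply
        by (intro sum.cong refl)
          (simp add: scaleR_fun_apply fst_extend_rep bracket_section[OF action_assms] U(4) V(4) True
            rep_bracket scaleR_diff_right mult.commute)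
      ultimately show ?thesis by (simp add: sum_subtractf)
    next
      \<comment> \<open>Off the sections both sides are 0: the inner functions are then the zero
        section by normalization, and every derivation annihilates it.\<close>
      case False
      then have "(\<lambda>z. fst (extend_rep z (u z)) \<psi>) = 0" if "u \<in> sections F AF" for u
        using deriv_fibD(6)[OF F E Dfib[OF that]] by (simp add: fun_eq_iff)
      moreover have "fst (extend_rep y (u y)) 0 = 0" if "u \<in> sections F AF" for u
        by (rule point_operator_0[OF F E deriv_fib_point_operator[OF F E Dfib[OF that]]])
      moreover have "fst (extend_rep y (bracket AF s t y)) \<psi> = 0"
        unfolding lhs fst_sum sum_fun_apply
        by (simp add: scaleR_fun_apply extend_rep_eq bracket_section[OF action_assms] U(4) V(4) False)
      ultimately show ?thesis by (simp add: s t)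
    qed
  next
    fix f
    show "snd (extend_rep y (bracket AF s t y)) f
      = snd (\<lambda>\<psi>. fst (?Ds y) (\<lambda>z. fst (?Dt z) \<psi>) - fst (?Dt y) (\<lambda>z. fst (?Ds z) \<psi>),
          vf_bracket (\<lambda>z. snd (?Ds z)) (\<lambda>z. snd (?Dt z)) y) f"
    proof (cases "f \<in> Cinf F")
      case True
      have e1: "snd (?Ds y) (\<lambda>z. snd (?Dt z) f)
          = (\<Sum>i<n. \<Sum>j<m. h i y * k j y * act (X i) y (\<lambda>z. act (Y j) z f)
              + h i y * act (X i) y (k j) * act (Y j) y f)"
        by (rule half_snd[OF True s t U(2,5) V(1,2,5) V(3) U(4) V(4)])
      have e2: "snd (?Dt y) (\<lambda>z. snd (?Ds z) f)
          = (\<Sum>j<m. \<Sum>i<n. k j y * h i y * act (Y j) y (\<lambda>z. act (X i) z f)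
              + k j y * act (Y j) y (h i) * act (X i) y f)"
        by (rule half_snd[OF True t s V(2,5) U(1,2,5) U(3) V(4) U(4)])
      have "vf_bracket (\<lambda>z. snd (?Ds z)) (\<lambda>z. snd (?Dt z)) y f
          = (\<Sum>i<n. \<Sum>j<m. h i y * k j y * act (X i) y (\<lambda>z. act (Y j) z f)
              + h i y * act (X i) y (k j) * act (Y j) y f)
            - (\<Sum>i<n. \<Sum>j<m. k j y * h i y * act (Y j) y (\<lambda>z. act (X i) z f)
              + k j y * act (Y j) y (h i) * act (X i) y f)"
        unfolding vf_bracket_def e1 e2 by (subst (2) sum.swap) (rule refl)
      moreover have "snd (extend_rep y (bracket AF s t y)) f
          = (\<Sum>i<n. \<Sum>j<m. (h i y * k j y * act (X i) y (\<lambda>z. act (Y j) z f)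
              + h i y * act (X i) y (k j) * act (Y j) y f)
            - (k j y * h i y * act (Y j) y (\<lambda>z. act (X i) z f)
              + k j y * act (Y j) y (h i) * act (X i) y f))"
        unfolding lhs snd_sum sum_fun_apply
        by (intro sum.cong refl)
          (simp add: scaleR_fun_apply snd_extend_rep bracket_section[OF action_assms] U(4) V(4)
            act_bracket[OF action_assms] vf_bracket_def algebra_simps)
      ultimately show ?thesis by (simp add: sum_subtractf)
    next
      case False
      then have "snd (extend_rep z (u z)) f = 0" if "u \<in> sections F AF" for u z
        using tangent_outside[OF F deriv_fibD(1)[OF F E Dfib[OF that]]] by simp
      moreover have "snd (extend_rep y (u y)) (\<lambda>_. 0) = 0" if "u \<in> sections F AF" for u
        by (rule tangent_const[OF F deriv_fibD(1)[OF F E Dfib[OF that]]])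
      moreover have "snd (extend_rep y (bracket AF s t y)) f = 0"
        unfolding lhs snd_sum sum_fun_apply
        using tangent_outside[OF F act_fib False]
        by (simp add: scaleR_fun_apply snd_extend_rep bracket_section[OF action_assms] U(4) V(4))
      ultimately show ?thesis by (simp add: s t vf_bracket_def)
    qed
  qed
qed

lemma extend_rep_representation: "extend_rep \<in> representations F AF E"
  unfolding representations_def algebroid_morphism_def mem_Collect_eq
proof (intro conjI allI ballI extend_rep_morphism)
  show "extend_rep y \<in> extensional (fib AF y)" for y
    by (simp add: extend_rep_def action_algebroid_simps[OF action_assms])
  show "anchor (deriv_algebroid F E) y (extend_rep y u) = anchor AF y u" if "u \<in> fib AF y" for y u
  proof -
    have "u \<in> fib A (\<phi> y)" using that by (simp add: action_algebroid_simps[OF action_assms])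
    then obtain X where "X \<in> sections M A" "u = X (\<phi> y)" by (rule section_through_base)
    then show ?thesis
      by (simp add: deriv_algebroid_simps[OF F E] snd_extend_rep action_anchor[OF action_assms])
  qed
  show "(\<lambda>y. extend_rep y (bracket AF s t y))
      = bracket (deriv_algebroid F E) (\<lambda>y. extend_rep y (s y)) (\<lambda>y. extend_rep y (t y))"
    if "s \<in> sections F AF" "t \<in> sections F AF" for s t
    using extend_rep_bracket[OF that] by (simp add: fun_eq_iff)
qed

lemma restrict_extend_rep: "restrict_representation M F A \<phi> E extend_rep = \<rho>"
proof (intro ext)
  fix X \<psi> y
  show "restrict_representation M F A \<phi> E extend_rep X \<psi> y = \<rho> X \<psi> y"
  proof (cases "X \<in> sections M A")
    case X: True
    then have "\<rho> X \<in> extensional (sections F E)"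
      using rep_endomorphism[of X] by (simp add: derivative_endomorphism_def PiE_def)
    then show ?thesis
      using X by (cases "\<psi> \<in> sections F E")
        (auto simp: restrict_representation_def fst_extend_rep extensional_def)
  next
    case False
    moreover have "\<rho> \<in> extensional (sections M A)"
      using \<rho> by (simp add: derivative_representations_def)
    ultimately show ?thesis
      by (simp add: restrict_representation_def extensional_def)
  qed
qed

end

section \<open>Bijectivity of the restriction map\<close>

lemma restrict_representation_bij:
  "bij_betw (restrict_representation M F A \<phi> E) (representations F AF E)
     (derivative_representations M F A \<phi> act E)"
  unfolding bij_betw_def
proof (intro conjI equalityI subsetI)
  show "inj_on (restrict_representation M F A \<phi> E) (representations F AF E)"
    by (rule restrict_representation_inj)
  show "\<rho> \<in> restrict_representation M F A \<phi> E ` representations F AF E"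
    if "\<rho> \<in> derivative_representations M F A \<phi> act E" for \<rho>
    using restrict_extend_rep[OF that] extend_rep_representation[OF that] by (metis image_eqI)
qed (auto intro: restrict_representation_into)

end

theorem theorem3p5:
  fixes M :: "('m::{t2_space,second_countable_topology}, 'p::real_inner) atlas"
    and F :: "('f::{t2_space,second_countable_topology}, 'n::real_inner) atlas"
    and A :: "('m, 'k::real_inner, 'a::real_vector) algebroid"
    and E :: "('f, 'l::real_inner, 'e::real_vector) vbundle"
    and \<phi> :: "'f \<Rightarrow> 'm"
    and act :: "('m \<Rightarrow> 'a) \<Rightarrow> 'f \<Rightarrow> 'f tangent"
  assumes "manifold M" and "lie_algebroid M A"
    and "manifold F" and "fibered_manifold F M \<phi>"
    and "infinitesimal_action M F A \<phi> act"
    and "vector_bundle F E"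
  shows "bij_betw (restrict_representation M F A \<phi> E)
           (representations F (action_algebroid M F A \<phi> act) E)
           (derivative_representations M F A \<phi> act E)"
proof -
  have "smooth_map F M \<phi>"
    using assms(4) by (simp add: fibered_manifold_def)
  then show ?thesis
    using assms by (intro restrict_representation_bij)
qed

end
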